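(* Gorenstein ideals of codimension $4$ with Betti table of type $[310]$ give a negative answer to Reid's question: "For odd $k$, are hypersurfaces in a codimension $3$ Gorenstein variety the only cases?" That is, a homogeneous Gorenstein ideal $I$ of codimension $4$ with Betti table of type $[310]$ (which has $k+1=8$ minimal generators, so $k=7$ is odd) is not of the form $I=J+(f)$ with $J$ a Gorenstein ideal of codimension $3$ and $f$ a nonzerodivisor modulo $J$.
   Context: For a Gorenstein ideal $I$ of codimension $4$ in a polynomial ring $S$, the minimal free resolution has the form $0\to S\to S^{k+1}\to S^{2k}\to S^{k+1}\to S\to S/I\to0$. Reid asked whether, for odd $k$ (an even number $k+1$ of generators), every such $I$ is a hypersurface section of a codimension $3$ Gorenstein (Pfaffian) ideal. For $I$ homogeneous without linear forms, with $S/I$ Gorenstein of codimension $4$ and regularity $4$, write $b_{i,j}=\dim\operatorname{Tor}_i^S(S/I,\mathbb C)_j$; the Betti table is determined by $(b_{12},b_{23},b_{34})$ and is said to be of type $[b_{12}b_{23}b_{34}]$. Type $[310]$ means $b_{12}=3,\ b_{23}=1,\ b_{34}=0$; then $b_{13}=5$ and $b_{14}=0$. Ideals of this type exist, e.g. as $F^\perp=\{G\in\mathbb C[x_0,\dots,x_3]\mid G(F)=0\}$ (action by differentiation) for suitable quartic forms $F\in\mathbb C[y_0,\dots,y_3]$. *)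

theory Defs
  imports
    "HOL-Library.Poly_Mapping"
    "HOL-Library.Extended_Nat"
    "HOL-Algebra.Ideal"
    "Jordan_Normal_Form.Matrix_Kernel"
    "Jordan_Normal_Form.DL_Rank"
    "Jordan_Normal_Form.DL_Submatrix"
begin

section \<open>Ideals of a polynomial ring\<close>

text \<open>
  The polynomial ring over the complex numbers with a finite set \<open>'x\<close> of variables: a polynomial
  is a finitely supported function from exponent vectors to coefficients. As a structure in the
  sense of HOL-Algebra it is \<open>class_ring\<close>.
\<close>

type_synonym 'x cpoly = "('x \<Rightarrow>\<^sub>0 nat) \<Rightarrow>\<^sub>0 complex"

definition mdeg :: "('x::finite \<Rightarrow>\<^sub>0 nat) \<Rightarrow> nat" where
  "mdeg m = (\<Sum>x\<in>UNIV. Poly_Mapping.lookup m x)"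

definition homogeneous :: "nat \<Rightarrow> 'x::finite cpoly \<Rightarrow> bool" where
  "homogeneous k p \<longleftrightarrow> (\<forall>m\<in>Poly_Mapping.keys p. mdeg m = k)"

definition homogeneous_ideal :: "'x::finite cpoly set \<Rightarrow> bool" where
  "homogeneous_ideal I \<longleftrightarrow>
     ideal I class_ring \<and> I = genideal class_ring {p \<in> I. \<exists>k. homogeneous k p}"

definition min_number_of_generators :: "'x::finite cpoly set \<Rightarrow> nat" where
  "min_number_of_generators I =
     (LEAST n. \<exists>G. finite G \<and> card G = n \<and> genideal class_ring G = I)"

definition nonzerodivisor_mod :: "'x::finite cpoly set \<Rightarrow> 'x cpoly \<Rightarrow> bool" where
  "nonzerodivisor_mod J f \<longleftrightarrow> (\<forall>g. f * g \<in> J \<longrightarrow> g \<in> J)"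

definition prime_height :: "'x::finite cpoly set \<Rightarrow> enat" where
  "prime_height P =
     Sup {enat n | n. \<exists>C. (\<forall>i\<le>n. primeideal (C i) class_ring) \<and>
                          (\<forall>i<n. C i \<subset> C (Suc i)) \<and> C n = P}"

definition codim :: "'x::finite cpoly set \<Rightarrow> enat" where
  "codim I = Inf (prime_height ` {P. primeideal P class_ring \<and> I \<subseteq> P})"

section \<open>Free resolutions and Ext\<close>

text \<open>
  A complex of finitely generated free modules
  \<open>\<dots> \<rightarrow> F 2 \<rightarrow> F 1 \<rightarrow> F 0\<close> is given by its differentials: the matrix \<open>d i\<close> represents
  \<open>F (i + 1) \<rightarrow> F i\<close>, acting on column vectors, and \<open>F i\<close> has rank \<open>dim_row (d i)\<close>.
\<close>

definition mat_image :: "'a::comm_ring_1 mat \<Rightarrow> 'a vec set" where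
  "mat_image A = (\<lambda>v. A *\<^sub>v v) ` carrier_vec (dim_col A)"

definition free_resolution :: "'x::finite cpoly set \<Rightarrow> (nat \<Rightarrow> 'x cpoly mat) \<Rightarrow> bool" where
  "free_resolution I d \<longleftrightarrow>
     dim_row (d 0) = 1 \<and>
     mat_image (d 0) = {v \<in> carrier_vec 1. v $ 0 \<in> I} \<and>
     (\<forall>i. dim_row (d (Suc i)) = dim_col (d i)) \<and>
     (\<forall>i. mat_kernel (d i) = mat_image (d (Suc i)))"

text \<open>
  Applying \<open>Hom(-, S)\<close> transposes the differentials. If \<open>d\<close> is a free resolution of \<open>S/I\<close>, then
  \<open>Ext\<^sup>i(S/I, S)\<close> is the quotient of \<open>ext_cocycles d i\<close> by \<open>ext_coboundaries d i\<close>.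
\<close>

definition ext_cocycles :: "(nat \<Rightarrow> 'x::finite cpoly mat) \<Rightarrow> nat \<Rightarrow> 'x cpoly vec set" where
  "ext_cocycles d i = mat_kernel (transpose_mat (d i))"

definition ext_coboundaries :: "(nat \<Rightarrow> 'x::finite cpoly mat) \<Rightarrow> nat \<Rightarrow> 'x cpoly vec set" where
  "ext_coboundaries d i =
     (case i of 0 \<Rightarrow> {0\<^sub>v (dim_row (d 0))} | Suc k \<Rightarrow> mat_image (transpose_mat (d k)))"

text \<open>
  An isomorphism of \<open>S\<close>-modules from \<open>S/I\<close> to \<open>Ext\<^sup>c(S/I, S)\<close> is determined by the class of a cocycle
  \<open>\<xi>\<close>, the image of \<open>1\<close>; the two clauses say that multiplication of \<open>\<xi>\<close> by scalars induces a map
  that is onto, and that is well defined and injective.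
\<close>

definition ext_iso_quotient :: "'x::finite cpoly set \<Rightarrow> (nat \<Rightarrow> 'x cpoly mat) \<Rightarrow> nat \<Rightarrow> bool" where
  "ext_iso_quotient I d c \<longleftrightarrow>
     (\<exists>\<xi>\<in>ext_cocycles d c.
        (\<forall>\<eta>\<in>ext_cocycles d c. \<exists>s. \<eta> - s \<cdot>\<^sub>v \<xi> \<in> ext_coboundaries d c) \<and>
        {s. s \<cdot>\<^sub>v \<xi> \<in> ext_coboundaries d c} = I)"

text \<open>
  A Gorenstein ideal of codimension \<open>c\<close> is a perfect ideal with \<open>Ext\<^sup>c(S/I, S)\<close> isomorphic to
  \<open>S/I\<close>. Perfect means that \<open>S/I\<close> has projective dimension equal to the grade of \<open>I\<close>, the least
  \<open>i\<close> with \<open>Ext\<^sup>i(S/I, S)\<close> nonzero. In a polynomial ring the grade is the codimension. The ideal is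
  not required to be homogeneous; for homogeneous \<open>I\<close> this says that \<open>S/I\<close> is Cohen-Macaulay and
  isomorphic, up to a shift of the grading, to its canonical module.
\<close>

definition gorenstein_ideal :: "nat \<Rightarrow> 'x::finite cpoly set \<Rightarrow> bool" where
  "gorenstein_ideal c I \<longleftrightarrow>
     ideal I class_ring \<and> codim I = enat c \<and>
     (\<exists>d. free_resolution I d \<and> (\<forall>i>c. dim_row (d i) = 0) \<and>
          (\<forall>i<c. ext_cocycles d i = ext_coboundaries d i) \<and>
          ext_iso_quotient I d c)"

section \<open>Graded resolutions, Tor and Betti tables\<close>

text \<open>
  In a graded resolution the \<open>p\<close>-th basis vector of \<open>F i\<close> has degree \<open>a i p\<close>, so
  \<open>F i\<close> is the direct sum of the \<open>S(- a i p)\<close>, and the differentials preserve degrees.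
\<close>

definition graded_free_resolution ::
  "'x::finite cpoly set \<Rightarrow> (nat \<Rightarrow> 'x cpoly mat) \<Rightarrow> (nat \<Rightarrow> nat \<Rightarrow> nat) \<Rightarrow> bool" where
  "graded_free_resolution I d a \<longleftrightarrow>
     free_resolution I d \<and> a 0 0 = 0 \<and>
     (\<forall>i. \<forall>p<dim_row (d i). \<forall>q<dim_col (d i). \<forall>m\<in>Poly_Mapping.keys (d i $$ (p, q)).
        a i p + mdeg m = a (Suc i) q)"

text \<open>Minimality: all entries lie in the ideal generated by the variables.\<close>

definition minimal_resolution :: "(nat \<Rightarrow> 'x::finite cpoly mat) \<Rightarrow> bool" where
  "minimal_resolution d \<longleftrightarrow>
     (\<forall>i. \<forall>p<dim_row (d i). \<forall>q<dim_col (d i). Poly_Mapping.lookup (d i $$ (p, q)) 0 = 0)"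

text \<open>
  Tensoring with \<open>\<complex> = S/(variables)\<close> replaces every entry by its constant term; the part of degree
  \<open>j\<close> of the resulting complex of vector spaces is spanned by the basis vectors of degree \<open>j\<close>.
  The dimension of the degree \<open>j\<close> part of \<open>Tor\<^sub>i(S/I, \<complex>)\<close> is that of the cycles minus that of the
  boundaries.
\<close>

definition tor_differential ::
  "(nat \<Rightarrow> 'x::finite cpoly mat) \<Rightarrow> (nat \<Rightarrow> nat \<Rightarrow> nat) \<Rightarrow> nat \<Rightarrow> nat \<Rightarrow> complex mat" where
  "tor_differential d a j i =
     submatrix (map_mat (\<lambda>p. Poly_Mapping.lookup p 0) (d i)) {p. a i p = j} {q. a (Suc i) q = j}"

definition tor_dim ::
  "(nat \<Rightarrow> 'x::finite cpoly mat) \<Rightarrow> (nat \<Rightarrow> nat \<Rightarrow> nat) \<Rightarrow> nat \<Rightarrow> nat \<Rightarrow> nat" where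
  "tor_dim d a i j =
     (case i of 0 \<Rightarrow> dim_row (tor_differential d a j 0)
              | Suc k \<Rightarrow> kernel_dim (tor_differential d a j k))
     - vec_space.rank (dim_row (tor_differential d a j i)) (tor_differential d a j i)"

text \<open>
  \<open>b\<close> is the Betti table of \<open>S/I\<close>, with \<open>b i j\<close> the dimension of \<open>Tor\<^sub>i(S/I, \<complex>)\<close> in degree \<open>j\<close>.
  Tor may be computed from any graded free resolution; we take a minimal one, which exists for every
  homogeneous ideal and is unique up to isomorphism.
\<close>

definition betti_table :: "'x::finite cpoly set \<Rightarrow> (nat \<Rightarrow> nat \<Rightarrow> nat) \<Rightarrow> bool" where
  "betti_table I b \<longleftrightarrow>
     (\<exists>d a. graded_free_resolution I d a \<and> minimal_resolution d \<and>
            (\<forall>i j. b i j = tor_dim d a i j))"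

text \<open>The Castelnuovo-Mumford regularity of \<open>S/I\<close> is the largest \<open>j - i\<close> with \<open>b i j \<noteq> 0\<close>.\<close>

definition has_regularity :: "(nat \<Rightarrow> nat \<Rightarrow> nat) \<Rightarrow> int \<Rightarrow> bool" where
  "has_regularity b r \<longleftrightarrow>
     (\<forall>i j. b i j \<noteq> 0 \<longrightarrow> int j - int i \<le> r) \<and>
     (\<exists>i j. b i j \<noteq> 0 \<and> int j - int i = r)"

end

theory Submission
  imports Defs "HOL-Library.Function_Algebras" "HOL-Library.Cardinality"
    "HOL-Analysis.Infinite_Sum" "HOL-Analysis.Elementary_Metric_Spaces"
begin

text \<open>
  Let \<open>F\<close> be the minimal graded free resolution of \<open>S/I\<close>; the degrees of its basis vectors are the
  Betti table (\<open>tor_dim_minimal\<close>). As \<open>I\<close> is Gorenstein of codimension 4, the transposed complex is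
  again a minimal resolution of \<open>S/I\<close>, and it has the same degrees up to a shift, which regularity 4
  forces to be 8: \<open>b i j = b (4 - i) (8 - j)\<close> (\<open>betti_symmetry\<close>). There are no linear forms in \<open>I\<close>, so
  type [310] leaves only \<open>b 1 3\<close> and \<open>b 2 4\<close> open. The Hilbert series of \<open>S/I\<close> is a polynomial,
  the alternating sum of the \<open>b i j * t ^ j\<close>, divided by \<open>(1 - t) ^ n\<close> with \<open>n\<close> the number of variables.
  Codimension 4 makes the polynomial vanish to order 4 at 1 (\<open>numerator_vanishes\<close>), and this yields \<open>b 1 3 = 5\<close>
  (\<open>type_310\<close>), hence \<open>3 + 5 = 8\<close> minimal generators.

  The order of vanishing is bounded by relating prime chains to monomials. If \<open>I\<close> contains no
  nonzero polynomial in a set \<open>U\<close> of variables, then neither does some prime \<open>P\<close> above \<open>I\<close>. Every step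
  down a chain of primes below \<open>P\<close> adds an algebraically independent element, so
  \<open>card U + 4 \<le> n\<close> (\<open>codim_bound\<close>). For all larger \<open>U\<close> there is thus a polynomial of \<open>I\<close> in the
  variables \<open>U\<close>, and its leading monomial excludes from a basis of \<open>S/I\<close> the monomials with large
  exponents at all of \<open>U\<close>. What remains has at most \<open>n - 4\<close> large exponents
  (\<open>standard_monomials_span\<close>) and grows like \<open>(1 - t) ^ (4 - n)\<close>.

  Suppose that \<open>I = J + (f)\<close> with \<open>f\<close> a nonzerodivisor modulo \<open>J\<close>. Then
  \<open>Tor(S/I) = Tor(S/J) \<otimes> \<Lambda>(f)\<close>, so the kernel of multiplication by the class of \<open>f\<close> from
  \<open>Tor\<^sub>1(S/I)\<close> to \<open>Tor\<^sub>2(S/I)\<close> is the line spanned by this class. But \<open>f\<close> has no terms of degree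
  below 2, so its products with the five cubic generators lie in degrees 5 and above, where
  \<open>Tor\<^sub>2(S/I)\<close> has dimension 1: a kernel of dimension at least 4. The lemma
  \<open>not_hypersurface_section\<close> carries this out with Koszul syzygies in place of products, for \<open>J\<close> and \<open>f\<close>
  that may be inhomogeneous.
\<close>

section \<open>Polynomials\<close>

abbreviation coef :: "('a \<Rightarrow>\<^sub>0 'b::zero) \<Rightarrow> 'a \<Rightarrow> 'b" where "coef \<equiv> Poly_Mapping.lookup"
abbreviation keys :: "('a \<Rightarrow>\<^sub>0 'b::zero) \<Rightarrow> 'a set" where "keys \<equiv> Poly_Mapping.keys"
abbreviation single :: "'a \<Rightarrow> 'b \<Rightarrow> ('a \<Rightarrow>\<^sub>0 'b::zero)" where "single \<equiv> Poly_Mapping.single"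

text \<open>
  Weights 1 give the degree. Weights 0 make every polynomial homogeneous, so that ungraded statements
  are instances of graded ones. Weights that separate the monomials of a finite set take the place of
  a monomial order.
\<close>

definition weight :: "('x::finite \<Rightarrow> nat) \<Rightarrow> ('x \<Rightarrow>\<^sub>0 nat) \<Rightarrow> nat" where
  "weight w m = (\<Sum>x\<in>UNIV. w x * coef m x)"

lemma weight_add [simp]: "weight w (m + m') = weight w m + weight w m'"
  by (simp add: weight_def lookup_add distrib_left sum.distrib)

lemma weight_zero [simp]: "weight w 0 = 0"
  by (simp add: weight_def)

lemma mdeg_eq_weight: "mdeg = weight (\<lambda>_. 1)"
  by (simp add: fun_eq_iff mdeg_def weight_def)

lemma mdeg_eq_0_iff: "mdeg m = 0 \<longleftrightarrow> m = 0"
  by (auto simp: mdeg_def poly_mapping_eq_iff fun_eq_iff)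

lemma poly_expand: "p = (\<Sum>m\<in>keys p. single m (coef p m))"
  by (rule poly_mapping_eqI) (auto simp: lookup_sum lookup_single when_def in_keys_iff)

lemma poly_mult_expand:
  fixes p q :: "'x cpoly"
  shows "p * q = (\<Sum>m\<in>keys p. \<Sum>m'\<in>keys q. single (m + m') (coef p m * coef q m'))"
proof -
  have "p * q = (\<Sum>m\<in>keys p. single m (coef p m)) * (\<Sum>m\<in>keys q. single m (coef q m))"
    using poly_expand by metis
  then show ?thesis by (simp add: sum_product mult_single)
qed

lemma coef_mult_expand:
  fixes p q :: "'x cpoly"
  shows "coef (p * q) k = (\<Sum>m\<in>keys p. \<Sum>m'\<in>keys q. (coef p m * coef q m' when m + m' = k))"
  by (subst poly_mult_expand) (simp add: lookup_sum lookup_single)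

abbreviation ct :: "'x cpoly \<Rightarrow> complex" where "ct p \<equiv> coef p 0"

text \<open>
  Exponents do not cancel, so only the two constant terms contribute.
\<close>

lemma ct_mult: 
  fixes p q :: "'x::finite cpoly"
  shows "ct (p * q) = ct p * ct q"
proof -
  have eq: "m + m' = 0 \<longleftrightarrow> m = 0 \<and> m' = 0" for m m' :: "'x \<Rightarrow>\<^sub>0 nat"
    by (metis mdeg_eq_0_iff mdeg_eq_weight weight_add add_eq_0_iff_both_eq_0 add.left_neutral)
  have sum_when: "(\<Sum>m\<in>keys p. coef p m when m = 0) = ct p" for p :: "'x cpoly"
    by (auto simp: when_def in_keys_iff)
  have "ct (p * q) = (\<Sum>m\<in>keys p. \<Sum>m'\<in>keys q. ((coef p m when m = 0) * (coef q m' when m' = 0)))"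
    by (subst coef_mult_expand, intro sum.cong refl) (auto simp: eq when_def)
  also have "\<dots> = (\<Sum>m\<in>keys p. coef p m when m = 0) * (\<Sum>m\<in>keys q. coef q m when m = 0)"
    by (simp add: sum_product)
  finally show ?thesis by (simp add: sum_when)
qed

lemma ct_sum: "ct (sum f A) = (\<Sum>x\<in>A. ct (f x))" by (simp add: lookup_sum)

text \<open>
  The part of degree \<open>k\<close> of a coordinate that belongs to a basis vector of degree
  \<open>s\<close>.
\<close>

definition degree_part :: "('x::finite \<Rightarrow> nat) \<Rightarrow> nat \<Rightarrow> nat \<Rightarrow> 'x cpoly \<Rightarrow> 'x cpoly" where
  "degree_part w s k p = (\<Sum>m\<in>{m\<in>keys p. s + weight w m = k}. single m (coef p m))"

lemma coef_degree_part: "coef (degree_part w s k p) m = (coef p m when s + weight w m = k)"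
  by (auto simp: degree_part_def lookup_sum lookup_single when_def in_keys_iff)

lemma degree_part_sum: "degree_part w s k (sum f A) = (\<Sum>x\<in>A. degree_part w s k (f x))"
  by (rule poly_mapping_eqI) (simp add: coef_degree_part lookup_sum when_def)

lemma degree_part_id: "(\<And>m. m \<in> keys p \<Longrightarrow> s + weight w m = k) \<Longrightarrow> degree_part w s k p = p"
  by (rule poly_mapping_eqI) (auto simp: coef_degree_part when_def in_keys_iff)

lemma keys_degree_part: "m \<in> keys (degree_part w s k p) \<Longrightarrow> s + weight w m = k \<and> m \<in> keys p"
  by (auto simp: coef_degree_part in_keys_iff when_def split: if_splits)

lemma degree_part_single: "degree_part w s k (single m c) = (single m c when s + weight w m = k)"
  by (rule poly_mapping_eqI) (auto simp: coef_degree_part lookup_single when_def)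

text \<open>
  The entries of a graded matrix relate the degrees \<open>s\<close> and \<open>t\<close> of two basis
  vectors in this way; therefore taking the parts of degree \<open>k\<close> commutes with the matrix.
\<close>

lemma degree_part_homogeneous_mult:
  assumes "\<And>m. m \<in> keys A \<Longrightarrow> s + weight w m = t"
  shows "degree_part w s k (A * p) = A * degree_part w t k p"
proof -
  have "degree_part w s k (single m c * single m' c') = single m c * degree_part w t k (single m' c')"
    if "m \<in> keys A" for m m' c c'
    using assms[OF that] by (auto simp: mult_single degree_part_single when_def)
  note 1 = this
  have 2: "degree_part w s k (single m c * p) = single m c * degree_part w t k p" if "m \<in> keys A" for m c p
  proof -
    have "degree_part w s k (single m c * (\<Sum>m\<in>keys p. single m (coef p m)))
        = single m c * degree_part w t k (\<Sum>m\<in>keys p. single m (coef p m))"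
      by (simp add: degree_part_sum sum_distrib_left 1[OF that])
    then show ?thesis using poly_expand[of p] by simp
  qed
  have "degree_part w s k ((\<Sum>m\<in>keys A. single m (coef A m)) * p)
      = (\<Sum>m\<in>keys A. single m (coef A m)) * degree_part w t k p"
    by (simp add: degree_part_sum sum_distrib_right 2)
  then show ?thesis using poly_expand[of A] by simp
qed

section \<open>Ideals of a commutative ring\<close>

text \<open>
  The ideals of \<open>class_ring\<close> without carriers, see \<open>ideal_iff\<close>.
\<close>

definition is_ideal :: "'a::comm_ring_1 set \<Rightarrow> bool" where
  "is_ideal I \<longleftrightarrow> 0 \<in> I \<and> (\<forall>a\<in>I. \<forall>b\<in>I. a + b \<in> I) \<and> (\<forall>a\<in>I. \<forall>r. r * a \<in> I)"

lemma cring_class_ring: "cring (class_ring :: 'a::comm_ring_1 ring)"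
  by (rule class_cring.cring_axioms)

lemma ideal_iff: "ideal I (class_ring :: 'a::comm_ring_1 ring) \<longleftrightarrow> is_ideal I"
proof
  assume "ideal I (class_ring :: 'a ring)"
  then interpret ideal I "class_ring :: 'a ring" .
  show "is_ideal I"
    using additive_subgroup.zero_closed[OF is_additive_subgroup] a_closed I_l_closed
    by (auto simp: is_ideal_def)
next
  interpret cring "class_ring :: 'a ring" by (rule cring_class_ring)
  assume I: "is_ideal I"
  have neg: "- a \<in> I" if "a \<in> I" for a
    using I that unfolding is_ideal_def by (metis mult_minus1)
  have inv: "inv\<^bsub>add_monoid class_ring\<^esub> a = - a" for a :: 'a
    using class_ring_simps(8)[where 'a = 'a] unfolding a_inv_def by metis
  have "subgroup I (add_monoid (class_ring :: 'a ring))"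
    by (rule subgroup.intro) (use I neg inv in \<open>auto simp: is_ideal_def\<close>)
  then show "ideal I (class_ring :: 'a ring)"
    by (intro idealI) (use I class_ring.ring_axioms in \<open>auto simp: is_ideal_def mult.commute\<close>)
qed

lemma primeideal_iff:
  "primeideal P (class_ring :: 'a::comm_ring_1 ring) \<longleftrightarrow>
    is_ideal P \<and> P \<noteq> UNIV \<and> (\<forall>a b. a * b \<in> P \<longrightarrow> a \<in> P \<or> b \<in> P)"
proof
  assume "primeideal P (class_ring :: 'a ring)"
  then interpret primeideal P "class_ring :: 'a ring" .
  show "is_ideal P \<and> P \<noteq> UNIV \<and> (\<forall>a b. a * b \<in> P \<longrightarrow> a \<in> P \<or> b \<in> P)"
    using I_notcarr I_prime ideal_iff is_ideal by auto
next
  assume "is_ideal P \<and> P \<noteq> UNIV \<and> (\<forall>a b. a * b \<in> P \<longrightarrow> a \<in> P \<or> b \<in> P)"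
  then show "primeideal P (class_ring :: 'a ring)"
    by (intro primeidealI) (auto simp: ideal_iff cring_class_ring)
qed

lemma is_ideal_sum: "is_ideal I \<Longrightarrow> (\<And>x. x \<in> A \<Longrightarrow> f x \<in> I) \<Longrightarrow> sum f A \<in> I"
  by (induction A rule: infinite_finite_induct) (auto simp: is_ideal_def)

lemma is_ideal_mult: "is_ideal I \<Longrightarrow> a \<in> I \<Longrightarrow> r * a \<in> I" "is_ideal I \<Longrightarrow> a \<in> I \<Longrightarrow> a * r \<in> I"
  by (auto simp: is_ideal_def mult.commute)

lemma is_ideal_diff: "is_ideal I \<Longrightarrow> a \<in> I \<Longrightarrow> b \<in> I \<Longrightarrow> a - b \<in> I"
  unfolding is_ideal_def by (metis add_uminus_conv_diff mult_minus1)

lemma is_ideal_add: "is_ideal I \<Longrightarrow> a \<in> I \<Longrightarrow> b \<in> I \<Longrightarrow> a + b \<in> I"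
  unfolding is_ideal_def by blast

lemma is_ideal_zero: "is_ideal I \<Longrightarrow> 0 \<in> I"
  unfolding is_ideal_def by blast

lemma genideal_eq:
  fixes G :: "'a::comm_ring_1 set"
  assumes "finite G"
  shows "genideal class_ring G = {\<Sum>g\<in>G. c g * g | c. True}" (is "_ = ?R")
proof -
  have id: "is_ideal ?R"
    unfolding is_ideal_def
  proof (intro conjI ballI allI)
    show "0 \<in> ?R" by (rule CollectI, rule exI[of _ "\<lambda>_. 0"]) simp
  next
    fix a b assume "a \<in> ?R" "b \<in> ?R"
    then obtain c c' where "a = (\<Sum>g\<in>G. c g * g)" "b = (\<Sum>g\<in>G. c' g * g)" by auto
    then have "a + b = (\<Sum>g\<in>G. (c g + c' g) * g)" by (simp add: distrib_right sum.distrib)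
    then show "a + b \<in> ?R" by (intro CollectI exI[of _ "\<lambda>g. c g + c' g"]) simp
  next
    fix a r assume "a \<in> ?R"
    then obtain c where "a = (\<Sum>g\<in>G. c g * g)" by auto
    then have "r * a = (\<Sum>g\<in>G. (r * c g) * g)" by (simp add: sum_distrib_left mult.assoc)
    then show "r * a \<in> ?R" by (intro CollectI exI[of _ "\<lambda>g. r * c g"]) simp
  qed
  have sub: "G \<subseteq> ?R"
  proof
    fix x assume x: "x \<in> G"
    have "(\<Sum>g\<in>G. (if g = x then 1 else 0) * g) = x"
      using assms x by (simp add: if_distrib[of "\<lambda>y. y * _"] cong: if_cong)
    then show "x \<in> ?R" by (intro CollectI exI[of _ "\<lambda>g. if g = x then 1 else 0"]) simp
  qed
  show ?thesis
  proof
    show "genideal class_ring G \<subseteq> ?R"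
      unfolding genideal_def using id sub by (auto simp: ideal_iff)
    show "?R \<subseteq> genideal class_ring G"
      unfolding genideal_def by (auto simp: ideal_iff subset_iff intro!: is_ideal_sum is_ideal_mult(1))
  qed
qed

section \<open>Graded matrices\<close>

text \<open>
  A map of degree 0 from the free module with basis degrees \<open>b\<close> to the one with basis
  degrees \<open>a\<close>.
\<close>

definition graded_mat ::
  "('x::finite \<Rightarrow> nat) \<Rightarrow> (nat \<Rightarrow> nat) \<Rightarrow> (nat \<Rightarrow> nat) \<Rightarrow> 'x cpoly mat \<Rightarrow> bool" where
  "graded_mat w a b M \<longleftrightarrow>
     (\<forall>p<dim_row M. \<forall>q<dim_col M. \<forall>m\<in>keys (M $$ (p, q)). a p + weight w m = b q)"

lemma graded_mat_trivial: "graded_mat (\<lambda>_. 0) (\<lambda>_. 0) (\<lambda>_. 0) M"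
  by (simp add: graded_mat_def weight_def)

lemma mat_imageI: "v \<in> carrier_vec (dim_col A) \<Longrightarrow> A *\<^sub>v v \<in> mat_image A"
  by (auto simp: mat_image_def)

lemma mat_kernel_iff: "v \<in> mat_kernel A \<longleftrightarrow> v \<in> carrier_vec (dim_col A) \<and> A *\<^sub>v v = 0\<^sub>v (dim_row A)"
  by (auto simp: mat_kernel_def)

lemma mult_mat_entry:
  "A \<in> carrier_mat r s \<Longrightarrow> B \<in> carrier_mat s t \<Longrightarrow> p < r \<Longrightarrow> q < t \<Longrightarrow>
    (A * B) $$ (p, q) = (\<Sum>i<s. A $$ (p, i) * B $$ (i, q))"
  by (auto simp: scalar_prod_def atLeast0LessThan intro!: sum.cong)

lemma mult_mat_vec_entry:
  "A \<in> carrier_mat r s \<Longrightarrow> v \<in> carrier_vec s \<Longrightarrow> p < r \<Longrightarrow>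
    (A *\<^sub>v v) $ p = (\<Sum>i<s. A $$ (p, i) * v $ i)"
  by (auto simp: scalar_prod_def atLeast0LessThan intro!: sum.cong)

text \<open>
  Any lift of the columns may be replaced by its part of the right degrees, because taking parts
  commutes with \<open>A\<close>.
\<close>

lemma lift_columns:
  fixes A M :: "'x::finite cpoly mat"
  assumes A: "A \<in> carrier_mat r s" and M: "M \<in> carrier_mat r t"
    and im: "\<And>j. j < t \<Longrightarrow> col M j \<in> mat_image A"
    and gA: "graded_mat w a b A" and gM: "graded_mat w a c M"
  obtains N where "N \<in> carrier_mat s t" "A * N = M" "graded_mat w b c N"
proof -
  have "\<forall>j\<in>{..<t}. \<exists>v. v \<in> carrier_vec s \<and> col M j = A *\<^sub>v v"
    using im A by (auto simp: mat_image_def)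
  then obtain v where v: "\<And>j. j < t \<Longrightarrow> v j \<in> carrier_vec s \<and> col M j = A *\<^sub>v v j"
    by (metis lessThan_iff)
  define N where "N = mat s t (\<lambda>(i, j). degree_part w (b i) (c j) (v j $ i))"
  have N: "N \<in> carrier_mat s t" by (simp add: N_def)
  have "A * N = M"
  proof (rule eq_matI)
    fix p j assume "p < dim_row M" "j < dim_col M"
    then have p: "p < r" and j: "j < t" using M by auto
    have "(A * N) $$ (p, j) = (\<Sum>i<s. A $$ (p, i) * degree_part w (b i) (c j) (v j $ i))"
      using p j by (subst mult_mat_entry[OF A N]) (auto simp: N_def)
    also have "\<dots> = (\<Sum>i<s. degree_part w (a p) (c j) (A $$ (p, i) * v j $ i))"
      using gA A p by (intro sum.cong refl degree_part_homogeneous_mult[symmetric]) (auto simp: graded_mat_def)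
    also have "\<dots> = degree_part w (a p) (c j) ((A *\<^sub>v v j) $ p)"
      using v[OF j] p by (subst mult_mat_vec_entry[OF A]) (auto simp: degree_part_sum)
    also have "(A *\<^sub>v v j) $ p = M $$ (p, j)"
      using v[OF j] p j M by (metis carrier_matD index_col)
    also have "degree_part w (a p) (c j) (M $$ (p, j)) = M $$ (p, j)"
      using gM M p j by (intro degree_part_id) (auto simp: graded_mat_def)
    finally show "(A * N) $$ (p, j) = M $$ (p, j)" .
  qed (use A M N in auto)
  moreover have "graded_mat w b c N"
    by (auto simp: graded_mat_def N_def dest!: keys_degree_part)
  ultimately show ?thesis using N that by blast
qed

lemma mat_mult_unit_vec_col:
  "A \<in> carrier_mat r s \<Longrightarrow> j < s \<Longrightarrow> A *\<^sub>v unit_vec s j = col A j"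
  for A :: "'a::comm_ring_1 mat"
  by (intro eq_vecI) auto

lemma zero_mult_imp_col_in_kernel:
  assumes "A \<in> carrier_mat r s" "M \<in> carrier_mat s t" "A * M = 0\<^sub>m r t" "j < t"
  shows "col M j \<in> mat_kernel A"
proof -
  have "A *\<^sub>v col M j = col (A * M) j" using assms by (intro col_mult2[symmetric])
  then show ?thesis using assms by (simp add: mat_kernel_iff)
qed

lemma mat_mult_assoc: "dim_col A = dim_row B \<Longrightarrow> dim_col B = dim_row C \<Longrightarrow> A * B * C = A * (B * C)"
  for A B C :: "'a::comm_ring_1 mat"
  by (rule assoc_mult_mat) auto

lemma mat_mult_diff_right: "dim_col A = dim_row B \<Longrightarrow> dim_row C = dim_row B \<Longrightarrow> dim_col C = dim_col B \<Longrightarrow>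
    A * (B - C) = A * B - A * C"
  for A B C :: "'a::comm_ring_1 mat"
  by (rule mult_minus_distrib_mat[of _ "dim_row A" "dim_col A" _ "dim_col B"]) auto

lemma mat_mult_diff_left: "dim_col A = dim_row C \<Longrightarrow> dim_row B = dim_row A \<Longrightarrow> dim_col B = dim_col A \<Longrightarrow>
    (A - B) * C = A * C - B * C"
  for A B C :: "'a::comm_ring_1 mat"
  by (rule minus_mult_distrib_mat[of _ "dim_row A" "dim_col A" _ _ "dim_col C"]) auto

section \<open>Free resolutions and their comparison\<close>

abbreviation rk :: "(nat \<Rightarrow> 'a mat) \<Rightarrow> nat \<Rightarrow> nat" where "rk d i \<equiv> dim_row (d i)"

context
  fixes I :: "'x::finite cpoly set" and d :: "nat \<Rightarrow> 'x cpoly mat"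
  assumes res: "free_resolution I d"
begin

lemma res_carrier: "d i \<in> carrier_mat (rk d i) (rk d (Suc i))"
  using res unfolding free_resolution_def by auto

lemma res_dim_col: "dim_col (d i) = rk d (Suc i)"
  using res unfolding free_resolution_def by auto


lemma res_rk0: "rk d 0 = 1"
  using res by (simp add: free_resolution_def)

lemma res_exact: "mat_kernel (d i) = mat_image (d (Suc i))"
  using res by (simp add: free_resolution_def)

lemma res_aug: "mat_image (d 0) = {v \<in> carrier_vec 1. v $ 0 \<in> I}"
  using res by (simp add: free_resolution_def)

lemma res_dd: "d i * d (Suc i) = 0\<^sub>m (rk d i) (rk d (Suc (Suc i)))"
proof (rule eq_matI)
  fix p q assume p: "p < dim_row (0\<^sub>m (rk d i) (rk d (Suc (Suc i))) :: 'x cpoly mat)"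
    and q: "q < dim_col (0\<^sub>m (rk d i) (rk d (Suc (Suc i))) :: 'x cpoly mat)"
  have "col (d (Suc i)) q = d (Suc i) *\<^sub>v unit_vec (rk d (Suc (Suc i))) q"
    using q by (intro mat_mult_unit_vec_col[symmetric]) (auto intro: res_carrier)
  then have "col (d (Suc i)) q \<in> mat_image (d (Suc i))"
    using res_carrier[of "Suc i"] by (auto intro!: mat_imageI)
  then have "d i *\<^sub>v col (d (Suc i)) q = 0\<^sub>v (rk d i)"
    by (simp add: res_exact[symmetric] mat_kernel_iff)
  then have "row (d i) p \<bullet> col (d (Suc i)) q = 0"
    using p by (auto simp: vec_eq_iff)
  then show "(d i * d (Suc i)) $$ (p, q) = 0\<^sub>m (rk d i) (rk d (Suc (Suc i))) $$ (p, q)"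
    using p q by (simp add: res_dim_col)
qed (auto simp: res_dim_col)

lemma res_ideal: "p \<in> I \<longleftrightarrow> (\<exists>u\<in>carrier_vec (rk d 1). p = (\<Sum>j<rk d 1. d 0 $$ (0, j) * u $ j))"
proof -
  have "p \<in> I \<longleftrightarrow> vec 1 (\<lambda>_. p) \<in> mat_image (d 0)"
    by (simp add: res_aug)
  also have "\<dots> \<longleftrightarrow> (\<exists>u\<in>carrier_vec (rk d 1). vec 1 (\<lambda>_. p) = d 0 *\<^sub>v u)"
    using res_carrier[of 0] by (auto simp: mat_image_def)
  also have "\<dots> \<longleftrightarrow> (\<exists>u\<in>carrier_vec (rk d 1). p = (\<Sum>j<rk d 1. d 0 $$ (0, j) * u $ j))"
  proof (intro bex_cong refl)
    fix u :: "'x cpoly vec" assume u: "u \<in> carrier_vec (rk d 1)"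
    have "vec 1 (\<lambda>_. p) = d 0 *\<^sub>v u \<longleftrightarrow> p = (d 0 *\<^sub>v u) $ 0"
      using res_rk0 by (auto simp: vec_eq_iff)
    then show "vec 1 (\<lambda>_. p) = d 0 *\<^sub>v u \<longleftrightarrow> p = (\<Sum>j<rk d 1. d 0 $$ (0, j) * u $ j)"
      using mult_mat_vec_entry[OF res_carrier, of u 0 0] u res_rk0 by simp
  qed
  finally show ?thesis .
qed

end

text \<open>
  Chain maps that induce the identity of \<open>S/I\<close>; in position 0 both complexes are
  \<open>S\<close>.
\<close>

definition chain_map :: "(nat \<Rightarrow> 'a::comm_ring_1 mat) \<Rightarrow> (nat \<Rightarrow> 'a mat) \<Rightarrow> (nat \<Rightarrow> 'a mat) \<Rightarrow> bool" where
  "chain_map d d' \<alpha> \<longleftrightarrow> \<alpha> 0 = 1\<^sub>m 1 \<and> (\<forall>i. \<alpha> i \<in> carrier_mat (rk d' i) (rk d i)) \<and>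
     (\<forall>i. d' i * \<alpha> (Suc i) = \<alpha> i * d i)"

text \<open>
  The maps are constructed one after the other: composed with the next differential, the map found
  last takes values in a kernel, hence in the image of the differential through which it has to be
  lifted.
\<close>

lemma comparison:
  fixes d d' :: "nat \<Rightarrow> 'x::finite cpoly mat"
  assumes r: "free_resolution I d" and r': "free_resolution I d'"
    and g: "\<And>i. graded_mat w (a i) (a (Suc i)) (d i)"
    and g': "\<And>i. graded_mat w (a' i) (a' (Suc i)) (d' i)"
    and a0: "a 0 0 = a' 0 0"
  obtains \<alpha> where "chain_map d d' \<alpha>" "\<And>i. graded_mat w (a' i) (a i) (\<alpha> i)"
proof -
  note c = res_carrier[OF r] and c' = res_carrier[OF r']
  define P where "P n x \<longleftrightarrow> x \<in> carrier_mat (rk d' n) (rk d n) \<and> graded_mat w (a' n) (a n) x \<and>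
    (\<forall>j<rk d (Suc n). col (x * d n) j \<in> mat_image (d' n)) \<and> (n = 0 \<longrightarrow> x = 1\<^sub>m 1)" for n x
  have graded_prod: "graded_mat w (a' n) (a (Suc n)) (x * d n)" if x: "x \<in> carrier_mat (rk d' n) (rk d n)"
    and gx: "graded_mat w (a' n) (a n) x" for n x
    unfolding graded_mat_def
  proof (intro allI impI ballI)
    fix p q m assume "p < dim_row (x * d n)" "q < dim_col (x * d n)" and m: "m \<in> keys ((x * d n) $$ (p, q))"
    then have "p < dim_row x" "q < dim_col (d n)" by simp_all
    then have p: "p < rk d' n" and q: "q < rk d (Suc n)" using carrier_matD[OF x] res_dim_col[OF r] by metis+
    have "degree_part w (a' n p) (a (Suc n) q) ((x * d n) $$ (p, q)) = (x * d n) $$ (p, q)"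
    proof -
      have "degree_part w (a' n p) (a (Suc n) q) (x $$ (p, i) * d n $$ (i, q)) = x $$ (p, i) * d n $$ (i, q)"
        if i: "i < rk d n" for i
      proof -
        have "degree_part w (a' n p) (a (Suc n) q) (x $$ (p, i) * d n $$ (i, q))
            = x $$ (p, i) * degree_part w (a n i) (a (Suc n) q) (d n $$ (i, q))"
          using gx p i unfolding graded_mat_def carrier_matD[OF x] by (intro degree_part_homogeneous_mult) blast
        also have "degree_part w (a n i) (a (Suc n) q) (d n $$ (i, q)) = d n $$ (i, q)"
          using g[of n] q i unfolding graded_mat_def res_dim_col[OF r] by (intro degree_part_id) blast
        finally show ?thesis .
      qed
      then show ?thesis unfolding mult_mat_entry[OF x c p q] degree_part_sum by (intro sum.cong) auto
    qed
    then show "a' n p + weight w m = a (Suc n) q" using m keys_degree_part by metis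
  qed
  have "\<exists>x. P 0 x"
  proof (rule exI[of _ "1\<^sub>m 1"])
    have "1\<^sub>m 1 * d 0 = d 0" using c[of 0] res_rk0[OF r] by (simp add: left_mult_one_mat')
    moreover have "col (d 0) j \<in> mat_image (d' 0)" if "j < rk d (Suc 0)" for j
    proof -
      have "col (d 0) j = d 0 *\<^sub>v unit_vec (rk d (Suc 0)) j"
        using that by (intro mat_mult_unit_vec_col[symmetric]) (auto intro: c)
      then have "col (d 0) j \<in> mat_image (d 0)" using c[of 0] by (auto intro!: mat_imageI)
      then show ?thesis by (simp add: res_aug[OF r] res_aug[OF r'])
    qed
    moreover have "graded_mat w (a' 0) (a 0) (1\<^sub>m 1)"
      using a0 by (auto simp: graded_mat_def)
    ultimately show "P 0 (1\<^sub>m 1)" unfolding P_def using res_rk0[OF r] res_rk0[OF r'] by simp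
  qed
  moreover have "\<exists>y. P (Suc n) y \<and> d' n * y = x * d n" if "P n x" for n x
  proof -
    have x: "x \<in> carrier_mat (rk d' n) (rk d n)" and gx: "graded_mat w (a' n) (a n) x"
      and im: "\<And>j. j < rk d (Suc n) \<Longrightarrow> col (x * d n) j \<in> mat_image (d' n)"
      using that by (auto simp: P_def)
    have xd: "x * d n \<in> carrier_mat (rk d' n) (rk d (Suc n))" by (rule mult_carrier_mat[OF x c])
    obtain y where y: "y \<in> carrier_mat (rk d' (Suc n)) (rk d (Suc n))" "d' n * y = x * d n"
      "graded_mat w (a' (Suc n)) (a (Suc n)) y"
      using lift_columns[OF c' xd im g' graded_prod[OF x gx]] by metis
    have xdim: "dim_row x = rk d' n" "dim_col x = rk d n" using carrier_matD[OF x] by simp_all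
    have ydim: "dim_row y = rk d' (Suc n)" "dim_col y = rk d (Suc n)" using carrier_matD[OF y(1)] by simp_all
    note dims = res_dim_col[OF r] res_dim_col[OF r']
    have "d' n * (y * d (Suc n)) = (d' n * y) * d (Suc n)"
      by (rule mat_mult_assoc[symmetric]) (auto simp: dims ydim)
    also have "\<dots> = x * (d n * d (Suc n))"
      unfolding y(2) by (rule mat_mult_assoc) (auto simp: dims xdim)
    also have "\<dots> = 0\<^sub>m (rk d' n) (rk d (Suc (Suc n)))"
      unfolding res_dd[OF r] by (rule right_mult_zero_mat[OF x])
    finally have "col (y * d (Suc n)) j \<in> mat_image (d' (Suc n))" if "j < rk d (Suc (Suc n))" for j
      using zero_mult_imp_col_in_kernel[OF c' mult_carrier_mat[OF y(1) c] _ that] res_exact[OF r'] by simp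
    then have "P (Suc n) y" using y by (simp add: P_def)
    then show ?thesis using y by blast
  qed
  ultimately obtain f where f: "\<And>n. P n (f n) \<and> d' n * f (Suc n) = f n * d n"
    using dependent_nat_choice[of P "\<lambda>n x y. d' n * y = x * d n"] by metis
  have "chain_map d d' f" unfolding chain_map_def using f by (auto simp: P_def)
  moreover have "graded_mat w (a' i) (a i) (f i)" for i using f by (auto simp: P_def)
  ultimately show ?thesis using that by blast
qed

lemma chain_map_comp:
  assumes "free_resolution I d" "free_resolution I d'" "free_resolution I d''"
    "chain_map d d' \<alpha>" "chain_map d' d'' \<beta>"
  shows "chain_map d d'' (\<lambda>i. \<beta> i * \<alpha> i)"
proof -
  have a: "\<alpha> i \<in> carrier_mat (rk d' i) (rk d i)" "d' i * \<alpha> (Suc i) = \<alpha> i * d i"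
   and b: "\<beta> i \<in> carrier_mat (rk d'' i) (rk d' i)" "d'' i * \<beta> (Suc i) = \<beta> i * d' i" for i
    using assms(4,5) by (auto simp: chain_map_def)
  note dims [simp] = res_dim_col[OF assms(1)] res_dim_col[OF assms(2)] res_dim_col[OF assms(3)]
  have [simp]: "dim_row (\<alpha> i) = rk d' i" "dim_col (\<alpha> i) = rk d i" 
    "dim_row (\<beta> i) = rk d'' i" "dim_col (\<beta> i) = rk d' i" for i using a b by auto
  have "d'' i * (\<beta> (Suc i) * \<alpha> (Suc i)) = \<beta> i * \<alpha> i * d i" for i
  proof -
    have "d'' i * (\<beta> (Suc i) * \<alpha> (Suc i)) = (d'' i * \<beta> (Suc i)) * \<alpha> (Suc i)"
      by (simp add: mat_mult_assoc)
    also have "\<dots> = \<beta> i * (d' i * \<alpha> (Suc i))"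
      by (simp only: b(2)) (simp add: mat_mult_assoc)
    also have "\<dots> = \<beta> i * \<alpha> i * d i"
      by (simp only: a(2)) (simp add: mat_mult_assoc)
    finally show ?thesis .
  qed
  moreover have "\<beta> 0 * \<alpha> 0 = 1\<^sub>m 1" using assms(4,5) by (simp add: chain_map_def)
  moreover have "\<beta> i * \<alpha> i \<in> carrier_mat (rk d'' i) (rk d i)" for i
    using a b by (intro mult_carrier_mat)
  ultimately show ?thesis by (auto simp: chain_map_def)
qed

text \<open>
  The homotopy is constructed step by step, starting with 0: what remains of the difference between
  \<open>\<phi>\<close> and the identity, after subtracting the term already known, takes values in a
  kernel and can be lifted.
\<close>

lemma homotopy:
  fixes d :: "nat \<Rightarrow> 'x::finite cpoly mat"
  assumes r: "free_resolution I d" and \<phi>: "chain_map d d \<phi>"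
  obtains h where "\<And>i. h i \<in> carrier_mat (rk d (Suc i)) (rk d i)"
    "\<And>i. \<phi> (Suc i) = 1\<^sub>m (rk d (Suc i)) + d (Suc i) * h (Suc i) + h i * d i"
proof -
  note c = res_carrier[OF r]
  note [simp] = res_dim_col[OF r]
  have p: "\<phi> i \<in> carrier_mat (rk d i) (rk d i)" "d i * \<phi> (Suc i) = \<phi> i * d i" for i
    using \<phi> by (auto simp: chain_map_def)
  define \<psi> where "\<psi> i = \<phi> i - 1\<^sub>m (rk d i)" for i
  have psi: "\<psi> i \<in> carrier_mat (rk d i) (rk d i)" for i using p by (simp add: \<psi>_def minus_carrier_mat)
  have dpsi: "d i * \<psi> (Suc i) = \<psi> i * d i" for i
  proof -
    have [simp]: "dim_row (\<phi> i) = rk d i" "dim_col (\<phi> i) = rk d i" for i using p(1)[of i] by auto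
    have "d i * \<psi> (Suc i) = d i * \<phi> (Suc i) - d i"
      unfolding \<psi>_def by (subst mat_mult_diff_right) (auto simp: right_mult_one_mat[OF c])
    also have "\<dots> = \<phi> i * d i - 1\<^sub>m (rk d i) * d i" by (simp only: p(2) left_mult_one_mat[OF c])
    also have "\<dots> = \<psi> i * d i"
      unfolding \<psi>_def by (subst mat_mult_diff_left) auto
    finally show ?thesis .
  qed
  have [simp]: "dim_row (\<psi> i) = rk d i" "dim_col (\<psi> i) = rk d i" for i using psi[of i] by auto
  define P where "P n h \<longleftrightarrow> h \<in> carrier_mat (rk d (Suc n)) (rk d n) \<and>
    d n * (\<psi> (Suc n) - h * d n) = 0\<^sub>m (rk d n) (rk d (Suc n))" for n h
  have "\<exists>h. P 0 h"
  proof (rule exI[of _ "0\<^sub>m (rk d (Suc 0)) (rk d 0)"])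
    have "\<psi> 0 = 0\<^sub>m (rk d 0) (rk d 0)"
      using \<phi> res_rk0[OF r] by (auto simp: \<psi>_def chain_map_def)
    then have "d 0 * \<psi> (Suc 0) = 0\<^sub>m (rk d 0) (rk d (Suc 0))"
      by (simp only: dpsi left_mult_zero_mat[OF c])
    moreover have "\<psi> (Suc 0) - 0\<^sub>m (rk d (Suc 0)) (rk d 0) * d 0 = \<psi> (Suc 0)"
      by (intro eq_matI) (auto simp: left_mult_zero_mat[OF c])
    ultimately show "P 0 (0\<^sub>m (rk d (Suc 0)) (rk d 0))" by (simp add: P_def)
  qed
  moreover have "\<exists>h'. P (Suc n) h' \<and> \<psi> (Suc n) = d (Suc n) * h' + h * d n" if "P n h" for n h
  proof -
    have h: "h \<in> carrier_mat (rk d (Suc n)) (rk d n)"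
      and z: "d n * (\<psi> (Suc n) - h * d n) = 0\<^sub>m (rk d n) (rk d (Suc n))"
      using that by (auto simp: P_def)
    let ?M = "\<psi> (Suc n) - h * d n"
    have hd: "h * d n \<in> carrier_mat (rk d (Suc n)) (rk d (Suc n))" using h c by (intro mult_carrier_mat)
    have M: "?M \<in> carrier_mat (rk d (Suc n)) (rk d (Suc n))" using hd by (rule minus_carrier_mat)
    have "col ?M j \<in> mat_image (d (Suc n))" if "j < rk d (Suc n)" for j
      using zero_mult_imp_col_in_kernel[OF c M z that] res_exact[OF r] by simp
    then obtain h' where h': "h' \<in> carrier_mat (rk d (Suc (Suc n))) (rk d (Suc n))" "d (Suc n) * h' = ?M"
      using lift_columns[OF c M _ graded_mat_trivial graded_mat_trivial] by metis
    have eq: "\<psi> (Suc n) = d (Suc n) * h' + h * d n"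
      unfolding h'(2) using psi[of "Suc n"] hd by (intro eq_matI) auto
    have [simp]: "dim_row h = rk d (Suc n)" "dim_col h = rk d n"
      "dim_row h' = rk d (Suc (Suc n))" "dim_col h' = rk d (Suc n)" using h h' by auto
    have "d (Suc n) * (\<psi> (Suc (Suc n)) - h' * d (Suc n))
        = \<psi> (Suc n) * d (Suc n) - d (Suc n) * (h' * d (Suc n))"
      by (simp add: mat_mult_diff_right dpsi)
    also have "\<dots> = (\<psi> (Suc n) - d (Suc n) * h') * d (Suc n)"
      by (simp add: mat_mult_assoc mat_mult_diff_left)
    also have "\<psi> (Suc n) - d (Suc n) * h' = h * d n"
      unfolding eq by (intro eq_matI) auto
    also have "h * d n * d (Suc n) = h * (d n * d (Suc n))"
      by (simp add: mat_mult_assoc)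
    also have "\<dots> = 0\<^sub>m (rk d (Suc n)) (rk d (Suc (Suc n)))"
      unfolding res_dd[OF r] by (rule right_mult_zero_mat[OF h])
    finally show ?thesis using h' eq by (auto simp: P_def)
  qed
  ultimately obtain h where h: "\<And>n. P n (h n) \<and> \<psi> (Suc n) = d (Suc n) * h (Suc n) + h n * d n"
    using dependent_nat_choice[of P "\<lambda>n h h'. \<psi> (Suc n) = d (Suc n) * h' + h * d n"] by metis
  show ?thesis
  proof (rule that)
    fix i
    show hi: "h i \<in> carrier_mat (rk d (Suc i)) (rk d i)" for i using h by (auto simp: P_def)
    have dh: "d (Suc i) * h (Suc i) \<in> carrier_mat (rk d (Suc i)) (rk d (Suc i))"
      and hd: "h i * d i \<in> carrier_mat (rk d (Suc i)) (rk d (Suc i))"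
      by (rule mult_carrier_mat[OF c hi], rule mult_carrier_mat[OF hi c])
    have "\<phi> (Suc i) = 1\<^sub>m (rk d (Suc i)) + \<psi> (Suc i)"
      using p(1)[of "Suc i"] by (intro eq_matI) (auto simp: \<psi>_def)
    also have "\<dots> = 1\<^sub>m (rk d (Suc i)) + (d (Suc i) * h (Suc i) + h i * d i)" using h by simp
    also have "\<dots> = 1\<^sub>m (rk d (Suc i)) + d (Suc i) * h (Suc i) + h i * d i"
      by (rule assoc_add_mat[symmetric, OF one_carrier_mat dh hd])
    finally show "\<phi> (Suc i) = 1\<^sub>m (rk d (Suc i)) + d (Suc i) * h (Suc i) + h i * d i" .
  qed
qed

section \<open>Ext and the choice of a resolution\<close>

lemma transpose_mult_vec:
  fixes A B :: "'a::comm_ring_1 mat"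
  assumes "dim_col A = dim_row B" "v \<in> carrier_vec (dim_row A)"
  shows "(A * B)\<^sup>T *\<^sub>v v = B\<^sup>T *\<^sub>v (A\<^sup>T *\<^sub>v v)"
proof -
  have "(A * B)\<^sup>T = B\<^sup>T * A\<^sup>T"
    using assms(1) by (intro transpose_mult[of _ "dim_row A" "dim_col A" _ "dim_col B"]) auto
  also have "\<dots> *\<^sub>v v = B\<^sup>T *\<^sub>v (A\<^sup>T *\<^sub>v v)"
    using assms by (intro assoc_mult_mat_vec[of _ "dim_col B" "dim_row B" _ "dim_row A"]) auto
  finally show ?thesis .
qed

lemma transpose_add_vec:
  fixes A B :: "'a::comm_ring_1 mat"
  assumes "A \<in> carrier_mat r s" "B \<in> carrier_mat r s" "v \<in> carrier_vec r"
  shows "(A + B)\<^sup>T *\<^sub>v v = A\<^sup>T *\<^sub>v v + B\<^sup>T *\<^sub>v v"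
  using assms by (simp add: transpose_add add_mult_distrib_mat_vec[of _ s r])

lemma transpose_vec_carrier: "A \<in> carrier_mat r s \<Longrightarrow> v \<in> carrier_vec r \<Longrightarrow> A\<^sup>T *\<^sub>v v \<in> carrier_vec s"
  by (rule mult_mat_vec_carrier[of _ s r]) auto

lemma vec_cancel:
  fixes u v x :: "'a::comm_ring_1 vec"
  assumes "u \<in> carrier_vec n" "v \<in> carrier_vec n" "x \<in> carrier_vec n"
  shows "u + v - u = v" "u - (u - v) = v" "u - x - (u - v) = v - x"
    "s \<cdot>\<^sub>v u - s \<cdot>\<^sub>v (u - v) = s \<cdot>\<^sub>v v"
  using assms by (auto intro!: eq_vecI simp: algebra_simps)

lemma mat_smult_vec:
  fixes A :: "'a::comm_ring_1 mat"
  assumes "A \<in> carrier_mat r s" "v \<in> carrier_vec s"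
  shows "A *\<^sub>v (k \<cdot>\<^sub>v v) = k \<cdot>\<^sub>v (A *\<^sub>v v)"
  using assms by (intro eq_vecI) (auto simp: scalar_prod_def sum_distrib_left algebra_simps)

lemma cocycle_iff:
  assumes "free_resolution I d"
  shows "v \<in> ext_cocycles d i \<longleftrightarrow>
    v \<in> carrier_vec (rk d i) \<and> (d i)\<^sup>T *\<^sub>v v = 0\<^sub>v (rk d (Suc i))"
  by (simp add: ext_cocycles_def mat_kernel_iff res_dim_col[OF assms])

lemma coboundary_0: "v \<in> ext_coboundaries d 0 \<longleftrightarrow> v = 0\<^sub>v (rk d 0)"
  by (simp add: ext_coboundaries_def)

lemma coboundary_Suc:
  "v \<in> ext_coboundaries d (Suc k) \<longleftrightarrow> (\<exists>u\<in>carrier_vec (rk d k). v = (d k)\<^sup>T *\<^sub>v u)"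
  by (auto simp: ext_coboundaries_def mat_image_def)

context
  fixes I :: "'x::finite cpoly set" and d :: "nat \<Rightarrow> 'x cpoly mat"
  assumes res: "free_resolution I d"
begin

lemma transpose_diff_carrier: "(d i)\<^sup>T \<in> carrier_mat (rk d (Suc i)) (rk d i)"
  using res_carrier[OF res] by simp

lemma coboundary_carrier: "v \<in> ext_coboundaries d i \<Longrightarrow> v \<in> carrier_vec (rk d i)"
  by (cases i) (auto simp: coboundary_0 coboundary_Suc transpose_vec_carrier[OF res_carrier[OF res]])

lemma coboundary_zero: "0\<^sub>v (rk d i) \<in> ext_coboundaries d i"
proof (cases i)
  case (Suc k)
  have "0\<^sub>v (rk d (Suc k)) = (d k)\<^sup>T *\<^sub>v 0\<^sub>v (rk d k)"
    by (intro eq_vecI) (auto simp: res_dim_col[OF res])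
  then show ?thesis unfolding Suc coboundary_Suc by (intro bexI[of _ "0\<^sub>v (rk d k)"]) auto
qed (simp add: coboundary_0)

lemma coboundary_add:
  assumes "u \<in> ext_coboundaries d i" "v \<in> ext_coboundaries d i"
  shows "u + v \<in> ext_coboundaries d i"
proof (cases i)
  case (Suc k)
  then show ?thesis using assms
    by (auto simp: coboundary_Suc mult_add_distrib_mat_vec[OF transpose_diff_carrier, symmetric] intro!: bexI)
qed (use assms in \<open>auto simp: coboundary_0\<close>)

lemma coboundary_smult:
  assumes "v \<in> ext_coboundaries d i"
  shows "s \<cdot>\<^sub>v v \<in> ext_coboundaries d i"
proof (cases i)
  case (Suc k)
  then show ?thesis using assms
    by (auto simp: coboundary_Suc mat_smult_vec[OF transpose_diff_carrier, symmetric] intro!: bexI)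
qed (use assms in \<open>auto simp: coboundary_0\<close>)

lemma coboundary_diff:
  assumes "u \<in> ext_coboundaries d i" "v \<in> ext_coboundaries d i"
  shows "u - v \<in> ext_coboundaries d i"
proof -
  have "u - v = u + (-1) \<cdot>\<^sub>v v"
    using assms[THEN coboundary_carrier] by (intro eq_vecI) auto
  then show ?thesis using coboundary_add coboundary_smult assms by simp
qed

lemma coboundary_cocycle: "v \<in> ext_coboundaries d i \<Longrightarrow> v \<in> ext_cocycles d i"
proof (cases i)
  case 0
  assume "v \<in> ext_coboundaries d i"
  then show ?thesis unfolding cocycle_iff[OF res] 0 coboundary_0
    by (auto simp: scalar_prod_def res_dim_col[OF res] intro!: eq_vecI)
next
  case (Suc k)
  assume "v \<in> ext_coboundaries d i"
  then obtain u where u: "u \<in> carrier_vec (rk d k)" "v = (d k)\<^sup>T *\<^sub>v u"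
    unfolding Suc coboundary_Suc by blast
  have "(d (Suc k))\<^sup>T *\<^sub>v v = (d k * d (Suc k))\<^sup>T *\<^sub>v u"
    unfolding u(2) using u(1) by (intro transpose_mult_vec[symmetric]) (auto simp: res_dim_col[OF res])
  also have "\<dots> = 0\<^sub>v (rk d (Suc (Suc k)))"
    unfolding res_dd[OF res] using u(1) by (intro eq_vecI) (auto simp: scalar_prod_def)
  finally show ?thesis
    unfolding cocycle_iff[OF res] Suc using u transpose_vec_carrier[OF res_carrier[OF res] u(1)] by simp
qed

text \<open>
  Of the two homotopy terms, \<open>d h\<close> is annihilated by the cocycle and \<open>h d\<close>
  turns it into a coboundary.
\<close>

lemma homotopic_to_id_cocycle:
  assumes \<phi>: "chain_map d d \<phi>" and v: "v \<in> ext_cocycles d i"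
  shows "(\<phi> i)\<^sup>T *\<^sub>v v - v \<in> ext_coboundaries d i"
proof (cases i)
  case 0
  have "\<phi> i = 1\<^sub>m 1" using \<phi> 0 by (simp add: chain_map_def)
  moreover have vc: "v \<in> carrier_vec 1" using v 0 res_rk0[OF res] by (simp add: cocycle_iff[OF res])
  ultimately have "(\<phi> i)\<^sup>T *\<^sub>v v - v = 0\<^sub>v (rk d 0)" using res_rk0[OF res] by simp
  then show ?thesis unfolding 0 coboundary_0 .
next
  case (Suc k)
  obtain h where h: "\<And>i. h i \<in> carrier_mat (rk d (Suc i)) (rk d i)"
    "\<And>i. \<phi> (Suc i) = 1\<^sub>m (rk d (Suc i)) + d (Suc i) * h (Suc i) + h i * d i"
    using homotopy[OF res \<phi>] by metis
  let ?r = "rk d (Suc k)"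
  have v': "v \<in> carrier_vec ?r" "(d (Suc k))\<^sup>T *\<^sub>v v = 0\<^sub>v (rk d (Suc (Suc k)))"
    using v by (auto simp: cocycle_iff[OF res] Suc)
  have c1: "d (Suc k) * h (Suc k) \<in> carrier_mat ?r ?r" by (rule mult_carrier_mat[OF res_carrier[OF res] h(1)])
  have c2: "h k * d k \<in> carrier_mat ?r ?r" by (rule mult_carrier_mat[OF h(1) res_carrier[OF res]])
  have c3: "1\<^sub>m ?r + d (Suc k) * h (Suc k) \<in> carrier_mat ?r ?r" using c1 by simp
  have "(d (Suc k) * h (Suc k))\<^sup>T *\<^sub>v v = (h (Suc k))\<^sup>T *\<^sub>v ((d (Suc k))\<^sup>T *\<^sub>v v)"
    using carrier_matD[OF h(1)[of "Suc k"]] v'(1) by (intro transpose_mult_vec) (auto simp: res_dim_col[OF res])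
  also have "\<dots> = 0\<^sub>v ?r"
    unfolding v'(2) using carrier_matD[OF h(1)[of "Suc k"]]
    by (intro eq_vecI) (auto simp: scalar_prod_def)
  finally have z: "(d (Suc k) * h (Suc k))\<^sup>T *\<^sub>v v = 0\<^sub>v ?r" .
  have w: "(h k * d k)\<^sup>T *\<^sub>v v = (d k)\<^sup>T *\<^sub>v ((h k)\<^sup>T *\<^sub>v v)"
    using carrier_matD[OF h(1)[of k]] v'(1) by (intro transpose_mult_vec) auto
  have hv: "(h k)\<^sup>T *\<^sub>v v \<in> carrier_vec (rk d k)" by (rule transpose_vec_carrier[OF h(1) v'(1)])
  have dhv: "(d k)\<^sup>T *\<^sub>v ((h k)\<^sup>T *\<^sub>v v) \<in> carrier_vec ?r"
    by (rule transpose_vec_carrier[OF res_carrier[OF res] hv])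
  have "(\<phi> i)\<^sup>T *\<^sub>v v = v + (d k)\<^sup>T *\<^sub>v ((h k)\<^sup>T *\<^sub>v v)"
    unfolding Suc h(2) transpose_add_vec[OF c3 c2 v'(1)] transpose_add_vec[OF one_carrier_mat c1 v'(1)] z w
    using v'(1) by simp
  then have "(\<phi> i)\<^sup>T *\<^sub>v v - v = (d k)\<^sup>T *\<^sub>v ((h k)\<^sup>T *\<^sub>v v)"
    using vec_cancel(1)[OF v'(1) dhv dhv] by simp
  then show ?thesis using hv unfolding Suc coboundary_Suc by auto
qed

end

context
  fixes I :: "'x::finite cpoly set" and d d' :: "nat \<Rightarrow> 'x cpoly mat" and \<alpha>
  assumes res: "free_resolution I d" and res': "free_resolution I d'"
    and cm: "chain_map d d' \<alpha>"
begin

lemma chain_map_carrier: "\<alpha> i \<in> carrier_mat (rk d' i) (rk d i)"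
  using cm by (simp add: chain_map_def)

lemma chain_map_transpose:
  assumes "v \<in> carrier_vec (rk d' i)"
  shows "(d i)\<^sup>T *\<^sub>v ((\<alpha> i)\<^sup>T *\<^sub>v v) = (\<alpha> (Suc i))\<^sup>T *\<^sub>v ((d' i)\<^sup>T *\<^sub>v v)"
proof -
  have "(d i)\<^sup>T *\<^sub>v ((\<alpha> i)\<^sup>T *\<^sub>v v) = (\<alpha> i * d i)\<^sup>T *\<^sub>v v"
    using carrier_matD[OF chain_map_carrier[of i]] assms by (intro transpose_mult_vec[symmetric]) auto
  also have "\<alpha> i * d i = d' i * \<alpha> (Suc i)" using cm by (simp add: chain_map_def)
  also have "\<dots>\<^sup>T *\<^sub>v v = (\<alpha> (Suc i))\<^sup>T *\<^sub>v ((d' i)\<^sup>T *\<^sub>v v)"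
    using carrier_matD[OF chain_map_carrier[of "Suc i"]] assms
    by (intro transpose_mult_vec) (auto simp: res_dim_col[OF res'])
  finally show ?thesis .
qed

lemma pull_cocycle:
  assumes "v \<in> ext_cocycles d' i"
  shows "(\<alpha> i)\<^sup>T *\<^sub>v v \<in> ext_cocycles d i"
proof -
  have v: "v \<in> carrier_vec (rk d' i)" "(d' i)\<^sup>T *\<^sub>v v = 0\<^sub>v (rk d' (Suc i))"
    using assms by (auto simp: cocycle_iff[OF res'])
  have "(\<alpha> (Suc i))\<^sup>T *\<^sub>v 0\<^sub>v (rk d' (Suc i)) = 0\<^sub>v (rk d (Suc i))"
    using carrier_matD[OF chain_map_carrier[of "Suc i"]]
    by (intro eq_vecI) (auto simp: scalar_prod_def)
  then show ?thesis
    unfolding cocycle_iff[OF res] chain_map_transpose[OF v(1)] v(2) using transpose_vec_carrier[OF chain_map_carrier v(1)] by simp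
qed

lemma pull_coboundary:
  assumes "v \<in> ext_coboundaries d' i"
  shows "(\<alpha> i)\<^sup>T *\<^sub>v v \<in> ext_coboundaries d i"
proof (cases i)
  case 0
  then have "(\<alpha> i)\<^sup>T *\<^sub>v v = 0\<^sub>v (rk d 0)"
    using assms carrier_matD[OF chain_map_carrier[of i]] by (intro eq_vecI) (auto simp: coboundary_0 scalar_prod_def)
  then show ?thesis by (simp add: 0 coboundary_0)
next
  case (Suc k)
  then obtain u where u: "u \<in> carrier_vec (rk d' k)" "v = (d' k)\<^sup>T *\<^sub>v u"
    using assms coboundary_Suc by blast
  have "(\<alpha> i)\<^sup>T *\<^sub>v v = (d k)\<^sup>T *\<^sub>v ((\<alpha> k)\<^sup>T *\<^sub>v u)"
    unfolding u(2) Suc chain_map_transpose[OF u(1)] ..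
  then show ?thesis unfolding Suc coboundary_Suc using transpose_vec_carrier[OF chain_map_carrier u(1)] by blast
qed

end

lemma resolutions_chain_map:
  fixes d d' :: "nat \<Rightarrow> 'x::finite cpoly mat"
  assumes "free_resolution I d" "free_resolution I d'"
  obtains \<alpha> where "chain_map d d' \<alpha>"
  using comparison[OF assms graded_mat_trivial graded_mat_trivial] by metis

lemma pull_comp:
  assumes "free_resolution I d" "free_resolution I d'"
    and "chain_map d d' \<alpha>" "chain_map d' d \<beta>" "v \<in> carrier_vec (rk d i)"
  shows "(\<beta> i * \<alpha> i)\<^sup>T *\<^sub>v v = (\<alpha> i)\<^sup>T *\<^sub>v ((\<beta> i)\<^sup>T *\<^sub>v v)"
  using carrier_matD[OF chain_map_carrier[OF assms(1,2,3), of i]] carrier_matD[OF chain_map_carrier[OF assms(2,1,4), of i]] assms(5)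
  by (intro transpose_mult_vec) auto

lemma round_trip_cocycle:
  assumes "free_resolution I d" "free_resolution I d'"
    and "chain_map d d' \<alpha>" "chain_map d' d \<beta>" "v \<in> ext_cocycles d i"
  shows "(\<alpha> i)\<^sup>T *\<^sub>v ((\<beta> i)\<^sup>T *\<^sub>v v) - v \<in> ext_coboundaries d i"
proof -
  have "chain_map d d (\<lambda>i. \<beta> i * \<alpha> i)" using chain_map_comp assms by blast
  from homotopic_to_id_cocycle[OF assms(1) this assms(5)] show ?thesis
    using pull_comp[OF assms(1-4)] assms(5) by (simp add: cocycle_iff[OF assms(1)])
qed

text \<open>
  The cocycle is transported to the other resolution, where it is a coboundary, and back; up to a
  coboundary it has not changed.
\<close>

lemma ext_vanishing_transfer:
  assumes r: "free_resolution I d" and r': "free_resolution I d'"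
    and v: "ext_cocycles d' i = ext_coboundaries d' i"
  shows "ext_cocycles d i = ext_coboundaries d i"
proof
  show "ext_coboundaries d i \<subseteq> ext_cocycles d i" using coboundary_cocycle[OF r] by blast
  obtain \<alpha> \<beta> where \<alpha>: "chain_map d d' \<alpha>" and \<beta>: "chain_map d' d \<beta>"
    using resolutions_chain_map r r' by metis
  show "ext_cocycles d i \<subseteq> ext_coboundaries d i"
  proof
    fix x assume x: "x \<in> ext_cocycles d i"
    let ?y = "(\<alpha> i)\<^sup>T *\<^sub>v ((\<beta> i)\<^sup>T *\<^sub>v x)"
    have "?y \<in> ext_coboundaries d i"
      using pull_coboundary[OF r r' \<alpha>] pull_cocycle[OF r' r \<beta> x] v by blast
    moreover have "?y - x \<in> ext_coboundaries d i" by (rule round_trip_cocycle[OF r r' \<alpha> \<beta> x])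
    ultimately have "?y - (?y - x) \<in> ext_coboundaries d i" by (rule coboundary_diff[OF r])
    moreover have "?y - (?y - x) = x"
      using coboundary_carrier[OF r \<open>?y \<in> _\<close>] x by (intro vec_cancel(2)) (auto simp: cocycle_iff[OF r])
    ultimately show "x \<in> ext_coboundaries d i" by simp
  qed
qed

text \<open>
  The generator of \<open>Ext\<^sup>c\<close> is transported along a comparison map. Its annihilator
  is preserved because transport back recovers the generator up to a coboundary.
\<close>

lemma ext_iso_transfer:
  assumes r: "free_resolution I d" and r': "free_resolution I d'"
    and iso: "ext_iso_quotient I d' c"
  shows "ext_iso_quotient I d c"
proof -
  obtain \<alpha> \<beta> where \<alpha>: "chain_map d d' \<alpha>" and \<beta>: "chain_map d' d \<beta>"
    using resolutions_chain_map r r' by metis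
  obtain \<xi> where xi: "\<xi> \<in> ext_cocycles d' c"
    and gen: "\<And>v. v \<in> ext_cocycles d' c \<Longrightarrow> \<exists>s. v - s \<cdot>\<^sub>v \<xi> \<in> ext_coboundaries d' c"
    and ann: "{s. s \<cdot>\<^sub>v \<xi> \<in> ext_coboundaries d' c} = I"
    using iso unfolding ext_iso_quotient_def by blast
  let ?A = "\<lambda>v. (\<alpha> c)\<^sup>T *\<^sub>v v" and ?B = "\<lambda>v. (\<beta> c)\<^sup>T *\<^sub>v v"
  have xc: "\<xi> \<in> carrier_vec (rk d' c)" using xi by (simp add: cocycle_iff[OF r'])
  have trA: "(\<alpha> c)\<^sup>T \<in> carrier_mat (rk d c) (rk d' c)" and trB: "(\<beta> c)\<^sup>T \<in> carrier_mat (rk d' c) (rk d c)"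
    using chain_map_carrier[OF r r' \<alpha>] chain_map_carrier[OF r' r \<beta>] by simp_all
  have Ac: "?A u \<in> carrier_vec (rk d c)" if "u \<in> carrier_vec (rk d' c)" for u
    using trA that by (rule mult_mat_vec_carrier)
  have Bc: "?B u \<in> carrier_vec (rk d' c)" if "u \<in> carrier_vec (rk d c)" for u
    using trB that by (rule mult_mat_vec_carrier)
  have A1: "?A (s \<cdot>\<^sub>v \<xi>) = s \<cdot>\<^sub>v ?A \<xi>" for s by (rule mat_smult_vec[OF trA xc])
  have 1: "\<exists>s. v - s \<cdot>\<^sub>v ?A \<xi> \<in> ext_coboundaries d c" if v: "v \<in> ext_cocycles d c" for v
  proof -
    have vc: "v \<in> carrier_vec (rk d c)" using v by (simp add: cocycle_iff[OF r])
    obtain s where s: "?B v - s \<cdot>\<^sub>v \<xi> \<in> ext_coboundaries d' c"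
      using gen[OF pull_cocycle[OF r' r \<beta> v]] by blast
    have "?A (?B v - s \<cdot>\<^sub>v \<xi>) = ?A (?B v) - s \<cdot>\<^sub>v ?A \<xi>"
      using mult_minus_distrib_mat_vec[OF trA Bc[OF vc], of "s \<cdot>\<^sub>v \<xi>"] xc by (simp add: A1)
    then have "?A (?B v) - s \<cdot>\<^sub>v ?A \<xi> \<in> ext_coboundaries d c"
      using pull_coboundary[OF r r' \<alpha> s] by simp
    from coboundary_diff[OF r this round_trip_cocycle[OF r r' \<alpha> \<beta> v]]
    have "?A (?B v) - s \<cdot>\<^sub>v ?A \<xi> - (?A (?B v) - v) \<in> ext_coboundaries d c" .
    moreover have "?A (?B v) - s \<cdot>\<^sub>v ?A \<xi> - (?A (?B v) - v) = v - s \<cdot>\<^sub>v ?A \<xi>"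
      using vc Ac[OF Bc[OF vc]] Ac[OF xc] by (intro vec_cancel(3)) auto
    ultimately show ?thesis by auto
  qed
  have "s \<cdot>\<^sub>v ?A \<xi> \<in> ext_coboundaries d c \<longleftrightarrow> s \<in> I" for s
  proof
    assume "s \<in> I"
    then have "s \<cdot>\<^sub>v \<xi> \<in> ext_coboundaries d' c" using ann by blast
    from pull_coboundary[OF r r' \<alpha> this] show "s \<cdot>\<^sub>v ?A \<xi> \<in> ext_coboundaries d c" by (simp add: A1)
  next
    assume "s \<cdot>\<^sub>v ?A \<xi> \<in> ext_coboundaries d c"
    from pull_coboundary[OF r' r \<beta> this]
    have b: "s \<cdot>\<^sub>v ?B (?A \<xi>) \<in> ext_coboundaries d' c"
      using mat_smult_vec[OF trB Ac[OF xc]] by simp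
    have "s \<cdot>\<^sub>v (?B (?A \<xi>) - \<xi>) \<in> ext_coboundaries d' c"
      by (intro coboundary_smult[OF r'] round_trip_cocycle[OF r' r \<beta> \<alpha> xi])
    from coboundary_diff[OF r' b this]
    have "s \<cdot>\<^sub>v ?B (?A \<xi>) - s \<cdot>\<^sub>v (?B (?A \<xi>) - \<xi>) \<in> ext_coboundaries d' c" .
    moreover have "s \<cdot>\<^sub>v ?B (?A \<xi>) - s \<cdot>\<^sub>v (?B (?A \<xi>) - \<xi>) = s \<cdot>\<^sub>v \<xi>"
      using xc Bc[OF Ac[OF xc]] by (intro vec_cancel(4)) auto
    ultimately show "s \<in> I" using ann by auto
  qed
  then have "{s. s \<cdot>\<^sub>v ?A \<xi> \<in> ext_coboundaries d c} = I" by blast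
  then show ?thesis unfolding ext_iso_quotient_def
    using 1 pull_cocycle[OF r r' \<alpha> xi] by blast
qed

section \<open>Minimal resolutions\<close>

text \<open>
  Independence of a family entails that its members are distinct.
\<close>

lemma (in vector_space) card_le_if_family_independent:
  assumes fin: "finite F" "finite T" and sp: "\<And>i. i \<in> F \<Longrightarrow> b i \<in> span T"
    and ind: "\<And>c i. (\<Sum>i\<in>F. scale (c i) (b i)) = 0 \<Longrightarrow> i \<in> F \<Longrightarrow> c i = 0"
  shows "card F \<le> card T"
proof -
  have inj: "inj_on b F"
  proof (rule inj_onI, rule ccontr)
    fix i j assume ij: "i \<in> F" "j \<in> F" "b i = b j" "i \<noteq> j"
    let ?c = "\<lambda>k. if k = i then 1 else if k = j then -1 else (0::'a)"
    have "(\<Sum>k\<in>F. scale (?c k) (b k)) = (\<Sum>k\<in>{i, j}. scale (?c k) (b k))"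
      using ij fin by (intro sum.mono_neutral_right) auto
    also have "\<dots> = 0" using ij by simp
    finally have "?c i = 0" using ind[of ?c i] ij by blast
    then show False by simp
  qed
  have "independent (b ` F)"
  proof (rule independent_if_scalars_zero)
    fix f x assume z: "(\<Sum>x\<in>b ` F. scale (f x) x) = 0" and x: "x \<in> b ` F"
    have "(\<Sum>i\<in>F. scale (f (b i)) (b i)) = 0"
      using z by (simp add: sum.reindex[OF inj])
    then show "f x = 0" using ind[of "\<lambda>i. f (b i)"] x by blast
  qed (use fin in simp)
  then have "card (b ` F) \<le> card T"
    using independent_span_bound[of T "b ` F"] fin sp by auto
  then show ?thesis using inj by (simp add: card_image)
qed

interpretation fun_vs: vector_space "\<lambda>(c::complex) (f :: 'k \<Rightarrow> complex) x. c * f x"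
  by standard (auto simp: algebra_simps fun_eq_iff)

text \<open>
  The columns of \<open>A\<close> are linearly independent functions on \<open>P\<close>.
\<close>

lemma card_le_if_left_inverse:
  fixes A :: "'p \<Rightarrow> 'q \<Rightarrow> complex" and B :: "'q \<Rightarrow> 'p \<Rightarrow> complex"
  assumes fin: "finite P" "finite Q"
    and inv: "\<And>q q'. q \<in> Q \<Longrightarrow> q' \<in> Q \<Longrightarrow> (\<Sum>p\<in>P. B q p * A p q') = (if q = q' then 1 else 0)"
  shows "card Q \<le> card P"
proof -
  let ?e = "\<lambda>p (x::'p). if x = p then 1 else (0::complex)"
  define v where "v q = (\<lambda>p. if p \<in> P then A p q else 0)" for q
  have fsum: "(\<Sum>i\<in>X. f i) x = (\<Sum>i\<in>X. f i x)" for X :: "'b set" and f :: "'b \<Rightarrow> 'p \<Rightarrow> complex" and x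
    by (induction X rule: infinite_finite_induct) auto
  have "card Q \<le> card (?e ` P)"
  proof (rule fun_vs.card_le_if_family_independent)
    fix q assume "q \<in> Q"
    have "v q = (\<Sum>p\<in>P. (\<lambda>x. A p q * ?e p x))"
      using fin by (auto simp: v_def fsum fun_eq_iff if_distrib[of "\<lambda>y. _ * y"] cong: if_cong)
    also have "\<dots> \<in> fun_vs.span (?e ` P)"
      by (intro fun_vs.span_sum fun_vs.span_scale fun_vs.span_base) auto
    finally show "v q \<in> fun_vs.span (?e ` P)" .
  next
    fix c q assume z: "(\<Sum>q\<in>Q. (\<lambda>x. c q * v q x)) = 0" and q: "q \<in> Q"
    have z': "(\<Sum>q'\<in>Q. c q' * A p q') = 0" if "p \<in> P" for p
      using fun_cong[OF z, of p] that by (simp add: fsum v_def)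
    have "c q = (\<Sum>q'\<in>Q. c q' * (if q = q' then 1 else 0))"
      using fin q by (simp add: if_distrib[of "\<lambda>y. _ * y"] cong: if_cong)
    also have "\<dots> = (\<Sum>q'\<in>Q. c q' * (\<Sum>p\<in>P. B q p * A p q'))"
      using inv q by (intro sum.cong) auto
    also have "\<dots> = (\<Sum>q'\<in>Q. \<Sum>p\<in>P. B q p * (c q' * A p q'))"
      by (simp add: sum_distrib_left mult_ac)
    also have "\<dots> = (\<Sum>p\<in>P. B q p * (\<Sum>q'\<in>Q. c q' * A p q'))"
      by (subst sum.swap) (simp add: sum_distrib_left)
    also have "\<dots> = 0" using z' by simp
    finally show "c q = 0" .
  qed (use fin in auto)
  also have "\<dots> \<le> card P" using fin by (simp add: card_image_le)
  finally show ?thesis .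
qed

lemma minimal_entry_ct: "minimal_resolution d \<Longrightarrow> p < rk d i \<Longrightarrow> q < dim_col (d i) \<Longrightarrow> ct (d i $$ (p, q)) = 0"
  by (simp add: minimal_resolution_def)

lemma minimal_image_ct:
  assumes "minimal_resolution d" "v \<in> mat_image (d i)" "p < rk d i"
  shows "ct (v $ p) = 0"
proof -
  obtain u where u: "u \<in> carrier_vec (dim_col (d i))" "v = d i *\<^sub>v u"
    using assms(2) by (auto simp: mat_image_def)
  have "v $ p = (\<Sum>q<dim_col (d i). d i $$ (p, q) * u $ q)"
    unfolding u(2) using u(1) assms(3) by (intro mult_mat_vec_entry) auto
  then show ?thesis using assms by (simp add: ct_sum ct_mult minimal_entry_ct)
qed

lemma minimal_coboundary_ct:
  assumes "minimal_resolution d" "v \<in> ext_coboundaries d i" "p < rk d i"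
    and r: "free_resolution I d"
  shows "ct (v $ p) = 0"
proof (cases i)
  case 0
  then show ?thesis using assms by (simp add: coboundary_0)
next
  case (Suc k)
  obtain u where u: "u \<in> carrier_vec (rk d k)" "v = (d k)\<^sup>T *\<^sub>v u"
    using assms(2) unfolding Suc coboundary_Suc by blast
  have p: "p < dim_col (d k)" using assms(3) by (simp add: res_dim_col[OF r] Suc)
  have "v $ p = (\<Sum>q<rk d k. (d k)\<^sup>T $$ (p, q) * u $ q)"
    unfolding u(2) using u(1) p by (intro mult_mat_vec_entry[of _ "dim_col (d k)"]) auto
  also have "\<dots> = (\<Sum>q<rk d k. d k $$ (q, p) * u $ q)"
    using p by (intro sum.cong) auto
  finally show ?thesis using assms p by (simp add: ct_sum ct_mult minimal_entry_ct)
qed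

text \<open>
  The homotopy terms contain a differential, so they vanish modulo the variables.
\<close>

lemma homotopic_to_id_ct:
  assumes r: "free_resolution I d" and m: "minimal_resolution d" and \<phi>: "chain_map d d \<phi>"
    and p: "p < rk d i" and q: "q < rk d i"
  shows "ct (\<phi> i $$ (p, q)) = (if p = q then 1 else 0)"
proof (cases i)
  case 0
  then show ?thesis using \<phi> p q res_rk0[OF r] by (simp add: chain_map_def)
next
  case (Suc k)
  obtain h where h: "\<And>i. h i \<in> carrier_mat (rk d (Suc i)) (rk d i)"
    "\<And>i. \<phi> (Suc i) = 1\<^sub>m (rk d (Suc i)) + d (Suc i) * h (Suc i) + h i * d i"
    using homotopy[OF r \<phi>] by metis
  have p': "p < rk d (Suc k)" and q': "q < rk d (Suc k)" using p q Suc by auto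
  note c1 = mult_carrier_mat[OF res_carrier[OF r] h(1), of "Suc k"]
    and c2 = mult_carrier_mat[OF h(1) res_carrier[OF r], of k]
  have "ct ((d (Suc k) * h (Suc k)) $$ (p, q)) = 0"
    unfolding mult_mat_entry[OF res_carrier[OF r] h(1) p' q']
    using m p' by (simp add: ct_sum ct_mult minimal_entry_ct res_dim_col[OF r])
  moreover have "ct ((h k * d k) $$ (p, q)) = 0"
    unfolding mult_mat_entry[OF h(1) res_carrier[OF r] p' q']
    using m q' by (simp add: ct_sum ct_mult minimal_entry_ct res_dim_col[OF r])
  moreover have "\<phi> i $$ (p, q) = 1\<^sub>m (rk d (Suc k)) $$ (p, q) + (d (Suc k) * h (Suc k)) $$ (p, q) + (h k * d k) $$ (p, q)"
    unfolding Suc h(2) using carrier_matD[OF c1] carrier_matD[OF c2] p' q' 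
    by (simp only: index_add_mat index_one_mat(2,3))
  ultimately show ?thesis using p' q' by (simp add: lookup_add)
qed

lemma round_trip_ct:
  assumes r: "free_resolution I d" and r': "free_resolution I d'" and m: "minimal_resolution d"
    and \<alpha>: "chain_map d d' \<alpha>" and \<beta>: "chain_map d' d \<beta>" and p: "p < rk d i" and q: "q < rk d i"
  shows "(\<Sum>k<rk d' i. ct (\<beta> i $$ (p, k)) * ct (\<alpha> i $$ (k, q))) = (if p = q then 1 else 0)"
proof -
  have "chain_map d d (\<lambda>i. \<beta> i * \<alpha> i)" using chain_map_comp r r' \<alpha> \<beta> by blast
  from homotopic_to_id_ct[OF r m this p q] show ?thesis
    unfolding mult_mat_entry[OF chain_map_carrier[OF r' r \<beta>] chain_map_carrier[OF r r' \<alpha>] p q]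
    by (simp add: ct_sum ct_mult)
qed

text \<open>
  Modulo the variables the identity factors through a zero module.
\<close>

lemma minimal_rank_zero:
  assumes r: "free_resolution I d" and r': "free_resolution I d'" and m: "minimal_resolution d"
    and z: "rk d' i = 0"
  shows "rk d i = 0"
proof (rule ccontr)
  assume "rk d i \<noteq> 0"
  then have p: "0 < rk d i" by simp
  obtain \<alpha> \<beta> where "chain_map d d' \<alpha>" "chain_map d' d \<beta>"
    using resolutions_chain_map r r' by metis
  from round_trip_ct[OF r r' m this p p] show False using z by simp
qed

text \<open>
  For a minimal resolution these are the Betti numbers, see \<open>tor_dim_minimal\<close>.
\<close>

definition graded_rank :: "(nat \<Rightarrow> 'x::finite cpoly mat) \<Rightarrow> (nat \<Rightarrow> nat \<Rightarrow> nat) \<Rightarrow> nat \<Rightarrow> nat \<Rightarrow> nat" where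
  "graded_rank d a i j = card {q. q < rk d i \<and> a i q = j}"

text \<open>
  Modulo the variables, a graded comparison map respects the degrees of the basis vectors and has a
  left inverse.
\<close>

lemma graded_rank_le:
  assumes r: "free_resolution I d" and r': "free_resolution I d'" and m: "minimal_resolution d"
    and g: "\<And>i. graded_mat w (a i) (a (Suc i)) (d i)"
    and g': "\<And>i. graded_mat w (a' i) (a' (Suc i)) (d' i)"
    and a0: "a 0 0 = a' 0 0"
  shows "graded_rank d a i j \<le> graded_rank d' a' i j"
proof -
  obtain \<alpha> where \<alpha>: "chain_map d d' \<alpha>" "\<And>i. graded_mat w (a' i) (a i) (\<alpha> i)"
    using comparison[OF r r' g g' a0] by metis
  obtain \<beta> where \<beta>: "chain_map d' d \<beta>"
    using resolutions_chain_map r r' by metis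
  let ?P = "{p. p < rk d' i \<and> a' i p = j}" and ?Q = "{q. q < rk d i \<and> a i q = j}"
  show ?thesis unfolding graded_rank_def
  proof (rule card_le_if_left_inverse)
    fix q q' assume q: "q \<in> ?Q" "q' \<in> ?Q"
    have q': "q' < rk d i" using q by simp
    have "ct (\<alpha> i $$ (p, q')) = 0" if p: "p < rk d' i" "p \<notin> ?P" for p
    proof (rule ccontr)
      assume "ct (\<alpha> i $$ (p, q')) \<noteq> 0"
      then have "0 \<in> keys (\<alpha> i $$ (p, q'))" by (simp add: in_keys_iff)
      moreover have "\<forall>m\<in>keys (\<alpha> i $$ (p, q')). a' i p + weight w m = a i q'"
        using \<alpha>(2)[of i] q' p(1) carrier_matD[OF chain_map_carrier[OF r r' \<alpha>(1)], of i] by (simp add: graded_mat_def)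
      ultimately have "a' i p + weight w 0 = a i q'" by (rule bspec[rotated])
      then show False using p q by simp
    qed
    then have "(\<Sum>p\<in>?P. ct (\<beta> i $$ (q, p)) * ct (\<alpha> i $$ (p, q')))
        = (\<Sum>p<rk d' i. ct (\<beta> i $$ (q, p)) * ct (\<alpha> i $$ (p, q')))"
      by (intro sum.mono_neutral_left) auto
    also have "\<dots> = (if q = q' then 1 else 0)"
      using q by (intro round_trip_ct[OF r r' m \<alpha>(1) \<beta>]) auto
    finally show "(\<Sum>p\<in>?P. ct (\<beta> i $$ (q, p)) * ct (\<alpha> i $$ (p, q'))) = (if q = q' then 1 else 0)" .
  qed auto
qed

lemma graded_rank_unique:
  assumes r: "free_resolution I d" and r': "free_resolution I d'"
    and m: "minimal_resolution d" and m': "minimal_resolution d'"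
    and g: "\<And>i. graded_mat w (a i) (a (Suc i)) (d i)"
    and g': "\<And>i. graded_mat w (a' i) (a' (Suc i)) (d' i)"
    and a0: "a 0 0 = a' 0 0"
  shows "graded_rank d a i j = graded_rank d' a' i j"
  using graded_rank_le[OF r r' m g g' a0] graded_rank_le[OF r' r m' g' g a0[symmetric]] by (rule le_antisym)

text \<open>
  A zero column makes a unit vector lie in the kernel of \<open>d i\<close>, that is, in the image of
  a matrix without constant terms.
\<close>

lemma minimal_column_nonzero:
  assumes r: "free_resolution I d" and m: "minimal_resolution d" and q: "q < rk d (Suc i)"
  obtains p where "p < rk d i" "d i $$ (p, q) \<noteq> 0"
proof (rule ccontr)
  assume "\<not> thesis"
  then have z: "\<And>p. p < rk d i \<Longrightarrow> d i $$ (p, q) = 0" using that by blast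
  have "d i *\<^sub>v unit_vec (rk d (Suc i)) q = col (d i) q"
    by (rule mat_mult_unit_vec_col[OF res_carrier[OF r] q])
  also have "\<dots> = 0\<^sub>v (rk d i)" using z q by (intro eq_vecI) (auto simp: res_dim_col[OF r])
  finally have "unit_vec (rk d (Suc i)) q \<in> mat_image (d (Suc i))"
    by (simp add: res_exact[OF r, symmetric] mat_kernel_iff res_dim_col[OF r])
  from minimal_image_ct[OF m this q] show False using q by simp
qed

text \<open>
  The same argument for the transposed complex.
\<close>

lemma minimal_row_nonzero:
  assumes r: "free_resolution I d" and m: "minimal_resolution d" and p: "p < rk d i"
    and v: "ext_cocycles d i = ext_coboundaries d i"
  obtains q where "q < rk d (Suc i)" "d i $$ (p, q) \<noteq> 0"
proof (rule ccontr)
  assume "\<not> thesis"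
  then have z: "\<And>q. q < rk d (Suc i) \<Longrightarrow> d i $$ (p, q) = 0" using that by blast
  have "(d i)\<^sup>T *\<^sub>v unit_vec (rk d i) p = col ((d i)\<^sup>T) p"
    by (rule mat_mult_unit_vec_col[OF transpose_diff_carrier[OF r] p])
  also have "\<dots> = 0\<^sub>v (rk d (Suc i))" using z p by (intro eq_vecI) (auto simp: res_dim_col[OF r])
  finally have "unit_vec (rk d i) p \<in> ext_coboundaries d i"
    by (simp add: v[symmetric] cocycle_iff[OF r])
  from minimal_coboundary_ct[OF m this p r] show False using p by simp
qed

section \<open>Duality for Gorenstein ideals\<close>

locale finite_graded_resolution =
  fixes I :: "'x::finite cpoly set" and d :: "nat \<Rightarrow> 'x cpoly mat" and a :: "nat \<Rightarrow> nat \<Rightarrow> nat"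
    and c :: nat
  assumes res: "free_resolution I d"
    and graded: "\<And>i. graded_mat (\<lambda>_. 1) (a i) (a (Suc i)) (d i)"
    and a00: "a 0 0 = 0"
    and finite_length: "\<And>i. i > c \<Longrightarrow> rk d i = 0"
begin

lemma ideal_I: "is_ideal I"
  unfolding is_ideal_def
proof (intro conjI ballI allI)
  note R = res_ideal[OF res]
  show "0 \<in> I" unfolding R by (rule bexI[of _ "0\<^sub>v (rk d 1)"]) auto
  fix x assume "x \<in> I"
  then obtain u where u: "u \<in> carrier_vec (rk d 1)" "x = (\<Sum>j<rk d 1. d 0 $$ (0, j) * u $ j)"
    unfolding R by blast
  show "r * x \<in> I" for r
    unfolding R u(2) using u(1)
    by (intro bexI[of _ "r \<cdot>\<^sub>v u"]) (auto simp: sum_distrib_left mult_ac)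
  fix y assume "y \<in> I"
  then obtain v where v: "v \<in> carrier_vec (rk d 1)" "y = (\<Sum>j<rk d 1. d 0 $$ (0, j) * v $ j)"
    unfolding R by blast
  show "x + y \<in> I"
    unfolding R u(2) v(2) using u(1) v(1)
    by (intro bexI[of _ "u + v"]) (simp_all add: sum.distrib distrib_left)
qed

end

text \<open>
  A minimal graded resolution of a Gorenstein ideal of codimension \<open>c\<close>;
  \<open>gorenstein_minimal_resolution\<close> below shows that the conditions of
  \<open>gorenstein_ideal\<close> pass to it.
\<close>

locale gorenstein_graded_resolution = finite_graded_resolution I d a c
  for I :: "'x::finite cpoly set" and d a c +
  assumes minimal: "minimal_resolution d"
    and c_pos: "c > 0"
    and ext_vanish: "\<And>i. i < c \<Longrightarrow> ext_cocycles d i = ext_coboundaries d i"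
    and ext_iso: "ext_iso_quotient I d c"
begin

lemma degree_step:
  assumes "p < rk d i" "q < rk d (Suc i)" "d i $$ (p, q) \<noteq> 0"
  shows "a i p < a (Suc i) q"
proof -
  obtain m where m: "m \<in> keys (d i $$ (p, q))" using assms(3) by (metis ex_in_conv keys_eq_empty)
  have "a i p + weight (\<lambda>_. 1) m = a (Suc i) q"
    using graded[of i] assms m by (auto simp: graded_mat_def res_dim_col[OF res])
  moreover have "weight (\<lambda>_. 1) m \<noteq> 0"
    using m minimal_entry_ct[OF minimal assms(1), of q] assms(2) 
    by (metis in_keys_iff mdeg_eq_0_iff mdeg_eq_weight res_dim_col[OF res])
  ultimately show ?thesis by simp
qed

lemma constant_term_zero: "p \<in> I \<Longrightarrow> ct p = 0"
  using minimal_entry_ct[OF minimal, of 0 0] res_rk0[OF res]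
  by (auto simp: res_ideal[OF res] ct_sum ct_mult res_dim_col[OF res])

lemma degree_lower: "q < rk d (Suc i) \<Longrightarrow> i < a (Suc i) q"
proof (induction i arbitrary: q)
  case 0
  obtain p where "p < rk d 0" "d 0 $$ (p, q) \<noteq> 0" using minimal_column_nonzero[OF res minimal 0] .
  then show ?case using degree_step 0 by fastforce
next
  case (Suc i)
  obtain p where "p < rk d (Suc i)" "d (Suc i) $$ (p, q) \<noteq> 0"
    using minimal_column_nonzero[OF res minimal Suc.prems] .
  then show ?case using degree_step Suc by fastforce
qed

lemma one_notin: "1 \<notin> I"
  using constant_term_zero[of 1] by auto

lemma all_cocycles: "ext_cocycles d c = carrier_vec (rk d c)"
  using finite_length[of "Suc c"] by (auto simp: cocycle_iff[OF res] res_dim_col[OF res] intro!: eq_vecI)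

text \<open>
  \<open>Ext\<^sup>c(S/I, S)\<close> is the cokernel of the last transposed differential, which has no
  constant terms. The module is cyclic, so \<open>F c\<close> has rank 1; it is isomorphic to
  \<open>S/I\<close>, so the entries of this differential generate \<open>I\<close>.
\<close>

lemma last_rank: "rk d c = 1"
  and last_image: "mat_image ((d (c - 1))\<^sup>T) = {v \<in> carrier_vec 1. v $ 0 \<in> I}"
proof -
  obtain \<xi> where xi: "\<xi> \<in> carrier_vec (rk d c)"
    and gen: "\<And>v. v \<in> carrier_vec (rk d c) \<Longrightarrow> \<exists>s. v - s \<cdot>\<^sub>v \<xi> \<in> ext_coboundaries d c"
    and ann: "{s. s \<cdot>\<^sub>v \<xi> \<in> ext_coboundaries d c} = I"
    using ext_iso unfolding ext_iso_quotient_def all_cocycles by blast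
  \<comment> \<open>modulo the variables, \<open>\<xi>\<close> spans\<close>
  have gen_ct: "\<exists>s::'x cpoly. \<forall>p'<rk d c. ct s * ct (\<xi> $ p') = (if p' = p then 1 else 0)" if p: "p < rk d c" for p
  proof -
    obtain s where s: "unit_vec (rk d c) p - s \<cdot>\<^sub>v \<xi> \<in> ext_coboundaries d c"
      using gen[of "unit_vec (rk d c) p"] by auto
    have "ct s * ct (\<xi> $ p') = (if p' = p then 1 else 0)" if p': "p' < rk d c" for p'
    proof -
      have "(unit_vec (rk d c) p - s \<cdot>\<^sub>v \<xi>) $ p' = (if p' = p then 1 else 0) - s * \<xi> $ p'"
        using p p' carrier_vecD[OF xi] by simp
      then show ?thesis
        using minimal_coboundary_ct[OF minimal s p' res] by (cases "p' = p") (simp_all add: lookup_minus ct_mult)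
    qed
    then show ?thesis by (intro exI[of _ s] allI impI)
  qed
  have "rk d c \<noteq> 0"
  proof
    assume z: "rk d c = 0"
    have "1 \<cdot>\<^sub>v \<xi> = 0\<^sub>v (rk d c)" using carrier_vecD[OF xi] z by (intro eq_vecI) simp_all
    then have "1 \<cdot>\<^sub>v \<xi> \<in> ext_coboundaries d c" using coboundary_zero[OF res, of c] by (simp only:)
    then have "1 \<in> I" using ann by blast
    then show False using one_notin by blast
  qed
  moreover have "\<not> rk d c > 1"
  proof
    assume r: "rk d c > 1"
    have r0: "0 < rk d c" using r by linarith
    obtain s :: "'x cpoly" where s: "\<forall>p'<rk d c. ct s * ct (\<xi> $ p') = (if p' = 0 then 1 else 0)"
      using gen_ct[OF r0] ..
    obtain t :: "'x cpoly" where t: "\<forall>p'<rk d c. ct t * ct (\<xi> $ p') = (if p' = 1 then 1 else 0)"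
      using gen_ct[OF r] ..
    have "ct s * ct (\<xi> $ 0) = 1" "ct t * ct (\<xi> $ 0) = 0" using s t r0 by simp_all
    then have "ct t = 0" by auto
    moreover have "ct t * ct (\<xi> $ 1) = 1" using t r by simp
    ultimately show False by simp
  qed
  ultimately show rk1: "rk d c = 1" by simp
  let ?J = "{t. vec 1 (\<lambda>_. t) \<in> ext_coboundaries d c}"
  have cob: "ext_coboundaries d c = mat_image ((d (c - 1))\<^sup>T)"
    using c_pos by (cases c) (auto simp: ext_coboundaries_def)
  have J: "is_ideal ?J" unfolding is_ideal_def
  proof (intro conjI ballI allI)
    have "vec 1 (\<lambda>_. 0 :: 'x cpoly) = 0\<^sub>v (rk d c)" unfolding rk1 by (intro eq_vecI) simp_all
    then show "0 \<in> ?J" using coboundary_zero[OF res, of c] by simp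
    fix x assume x: "x \<in> ?J"
    have "vec 1 (\<lambda>_. r * x) = r \<cdot>\<^sub>v vec 1 (\<lambda>_. x)" for r by auto
    then show "r * x \<in> ?J" for r using coboundary_smult[OF res, of _ c r] x by simp
    fix y assume y: "y \<in> ?J"
    have "vec 1 (\<lambda>_. x + y) = vec 1 (\<lambda>_. x) + vec 1 (\<lambda>_. y)" by auto
    then show "x + y \<in> ?J" using coboundary_add[OF res] x y by simp
  qed
  define x where "x = \<xi> $ 0"
  have sx: "s \<cdot>\<^sub>v \<xi> = vec 1 (\<lambda>_. s * x)" for s using carrier_vecD[OF xi] rk1 by (intro eq_vecI) (simp_all add: x_def)
  \<comment> \<open>the annihilator of the generator \<open>x\<close> of \<open>S/J\<close> is \<open>I\<close>; as \<open>x\<close> is a unit modulo \<open>J\<close>, it is also \<open>J\<close>\<close>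
  have annx: "s * x \<in> ?J \<longleftrightarrow> s \<in> I" for s
    using ann[unfolded sx] by auto
  obtain s where s: "1 - s * x \<in> ?J"
  proof -
    obtain s where "vec 1 (\<lambda>_. 1) - s \<cdot>\<^sub>v \<xi> \<in> ext_coboundaries d c"
      using gen[of "vec 1 (\<lambda>_. 1)"] rk1 by auto
    moreover have "vec 1 (\<lambda>_. 1) - s \<cdot>\<^sub>v \<xi> = vec 1 (\<lambda>_. 1 - s * x)" unfolding sx by auto
    ultimately show ?thesis using that by simp
  qed
  have JI: "t \<in> ?J \<longleftrightarrow> t \<in> I" for t
  proof
    assume "t \<in> ?J"
    then show "t \<in> I" using annx is_ideal_mult(2)[OF J] by blast
  next
    assume "t \<in> I"
    then have "s * (t * x) \<in> ?J" using annx is_ideal_mult(1)[OF J] by blast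
    moreover have "t * (1 - s * x) \<in> ?J" using s is_ideal_mult(1)[OF J] by blast
    ultimately have "s * (t * x) + t * (1 - s * x) \<in> ?J" by (rule is_ideal_add[OF J])
    then show "t \<in> ?J" by (simp add: algebra_simps)
  qed
  show "mat_image ((d (c - 1))\<^sup>T) = {v \<in> carrier_vec 1. v $ 0 \<in> I}"
  proof (rule subset_antisym; rule subsetI)
    fix v assume v: "v \<in> mat_image ((d (c - 1))\<^sup>T)"
    then have vc: "v \<in> carrier_vec 1" using coboundary_carrier[OF res] rk1 cob by metis
    then have "v = vec 1 (\<lambda>_. v $ 0)" by (intro eq_vecI) auto
    then show "v \<in> {v \<in> carrier_vec 1. v $ 0 \<in> I}" using v vc JI[of "v $ 0"] cob by auto
  next
    fix v assume v: "v \<in> {v \<in> carrier_vec 1. v $ 0 \<in> I}"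
    then have "v = vec 1 (\<lambda>_. v $ 0)" by (intro eq_vecI) auto
    then show "v \<in> mat_image ((d (c - 1))\<^sup>T)" using v JI[of "v $ 0"] cob by auto
  qed
qed

text \<open>
  Degrees increase strictly along nonzero entries. As no row is zero, every basis vector is connected
  in this way to the one of \<open>F c\<close>.
\<close>

lemma degree_upper: "i \<le> c \<Longrightarrow> p < rk d i \<Longrightarrow> a i p + (c - i) \<le> a c 0"
proof (induction "c - i" arbitrary: i p)
  case 0
  then show ?case using last_rank by auto
next
  case (Suc k)
  then have i: "i < c" by simp
  obtain q where q: "q < rk d (Suc i)" "d i $$ (p, q) \<noteq> 0"
    using minimal_row_nonzero[OF res minimal Suc.prems(2) ext_vanish[OF i]] .
  have "a (Suc i) q + (c - Suc i) \<le> a c 0" using Suc.hyps(1)[of "Suc i" q] Suc.hyps(2) i q by simp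
  moreover have "a i p < a (Suc i) q" by (rule degree_step[OF Suc.prems(2) q])
  ultimately show ?case using i by simp
qed

text \<open>
  The complex \<open>Hom(F, S)\<close>, numbered from the other end. The zero matrices continue it
  beyond the dual of \<open>F 0\<close>.
\<close>

definition dual :: "nat \<Rightarrow> 'x cpoly mat" where
  "dual i = (if i < c then (d (c - 1 - i))\<^sup>T else if i = c then 0\<^sub>m 1 0 else 0\<^sub>m 0 0)"

text \<open>
  Dualizing negates degrees; the shift puts the generator in degree 0. By \<open>degree_upper\<close>
  the subtraction does not truncate.
\<close>

definition dual_deg :: "nat \<Rightarrow> nat \<Rightarrow> nat" where
  "dual_deg i q = a c 0 - a (c - i) q"

lemma rk_dual: "i \<le> c \<Longrightarrow> rk dual i = rk d (c - i)" "i > c \<Longrightarrow> rk dual i = 0"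
  using res_rk0[OF res] by (auto simp: dual_def res_dim_col[OF res] Suc_diff_Suc)

lemma dual_resolution: "free_resolution I dual"
  unfolding free_resolution_def
proof (intro conjI allI)
  show "rk dual 0 = 1" using last_rank by (simp add: rk_dual)
  show "mat_image (dual 0) = {v \<in> carrier_vec 1. v $ 0 \<in> I}"
    using last_image c_pos by (simp add: dual_def)
  show dims: "rk dual (Suc i) = dim_col (dual i)" for i
  proof -
    consider "Suc i < c" | "Suc i = c" | "i \<ge> c" by linarith
    then show ?thesis
    proof cases
      case 1
      then have "rk dual (Suc i) = rk d (c - Suc i)" by (simp add: rk_dual)
      also have "\<dots> = dim_col (dual i)" using 1 by (simp add: dual_def)
      finally show ?thesis .
    qed (use res_rk0[OF res] in \<open>auto simp: rk_dual dual_def\<close>)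
  qed
  show "mat_kernel (dual i) = mat_image (dual (Suc i))" for i
  proof -
    consider "Suc i < c" | "Suc i = c" | "i \<ge> c" by linarith
    then show ?thesis
    proof cases
      case 1
      then have "mat_kernel (dual i) = ext_cocycles d (c - 1 - i)" by (simp add: dual_def ext_cocycles_def)
      also have "\<dots> = ext_coboundaries d (Suc (c - 1 - Suc i))" using ext_vanish 1 by (simp add: Suc_diff_Suc)
      also have "\<dots> = mat_image (dual (Suc i))" using 1 by (simp add: dual_def ext_coboundaries_def)
      finally show ?thesis .
    next
      case 2
      then have "mat_kernel (dual i) = ext_cocycles d 0" by (auto simp: dual_def ext_cocycles_def)
      also have "\<dots> = {0\<^sub>v 1}" using ext_vanish c_pos res_rk0[OF res] by (simp add: ext_coboundaries_def)
      also have "\<dots> = mat_image (dual (Suc i))" 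
        using 2 by (auto simp: dual_def mat_image_def scalar_prod_def intro!: eq_vecI image_eqI[of _ _ "0\<^sub>v 0"])
      finally show ?thesis .
    next
      case 3
      then have "dim_col (dual i) = 0" "dual (Suc i) = 0\<^sub>m 0 0" by (auto simp: dual_def)
      moreover have "(carrier_vec 0 :: 'x cpoly vec set) = {0\<^sub>v 0}" by auto
      moreover have "dual i *\<^sub>v 0\<^sub>v 0 = 0\<^sub>v (rk dual i)" "0\<^sub>m 0 0 *\<^sub>v 0\<^sub>v 0 = (0\<^sub>v 0 :: 'x cpoly vec)"
        using calculation(1) by (auto simp: scalar_prod_def intro!: eq_vecI)
      ultimately show ?thesis by (auto simp: mat_kernel_def mat_image_def)
    qed
  qed
qed

lemma dual_minimal: "minimal_resolution dual"
  using minimal by (auto simp: minimal_resolution_def dual_def)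

lemma dual_graded: "graded_mat (\<lambda>_. 1) (dual_deg i) (dual_deg (Suc i)) (dual i)"
  unfolding graded_mat_def
proof (intro allI impI ballI)
  fix p q m assume p: "p < rk dual i" and q: "q < dim_col (dual i)" and m: "m \<in> keys (dual i $$ (p, q))"
  have i: "i < c" using p q by (auto simp: dual_def split: if_splits)
  define k where "k = c - 1 - i"
  have ki: "c - i = Suc k" "c - Suc i = k" using i by (auto simp: k_def)
  have p': "p < rk d (Suc k)" using p i rk_dual(1)[of i] ki by simp
  have q': "q < rk d k" using q i by (simp add: dual_def k_def)
  have m': "m \<in> keys (d k $$ (q, p))" using m i p' q' by (simp add: dual_def k_def res_dim_col[OF res])
  have "a k q + weight (\<lambda>_. 1) m = a (Suc k) p"
    using graded[of k] p' q' m' by (auto simp: graded_mat_def res_dim_col[OF res])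
  moreover have "a (Suc k) p \<le> a c 0" using degree_upper[of "Suc k" p] p' i ki
    by linarith
  ultimately show "dual_deg i p + weight (\<lambda>_. 1) m = dual_deg (Suc i) q"
    unfolding dual_deg_def ki by simp
qed

text \<open>
  The dual complex is another minimal graded resolution of \<open>S/I\<close>.
\<close>

lemma betti_symmetry:
  assumes i: "i \<le> c" and j: "j \<le> a c 0"
  shows "graded_rank d a i j = graded_rank d a (c - i) (a c 0 - j)"
proof -
  have "graded_rank d a i j = graded_rank dual dual_deg i j"
    by (rule graded_rank_unique[OF res dual_resolution minimal dual_minimal graded dual_graded])
       (simp add: a00 dual_deg_def)
  also have "\<dots> = graded_rank d a (c - i) (a c 0 - j)"
    unfolding graded_rank_def rk_dual(1)[OF i]
  proof (intro arg_cong[of _ _ card] Collect_cong conj_cong refl)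
    fix q assume "q < rk d (c - i)"
    then have "a (c - i) q \<le> a c 0" using degree_upper[of "c - i" q] by simp
    then show "(dual_deg i q = j) = (a (c - i) q = a c 0 - j)"
      using j by (auto simp: dual_deg_def)
  qed
  finally show ?thesis .
qed

end

section \<open>Tor of a minimal resolution\<close>

lemma kernel_dim_zero: "kernel_dim (0\<^sub>m r n :: complex mat) = n"
proof -
  interpret kernel r n "0\<^sub>m r n :: complex mat" by standard simp
  have "mat_kernel (0\<^sub>m r n :: complex mat) = carrier_vec n"
    by (auto simp: mat_kernel_def)
  then have "NC.V\<lparr>carrier := mat_kernel (0\<^sub>m r n)\<rparr> = NC.V" by (simp add: module_vec_def)
  then show ?thesis using NC.dim_is_n kernel_dim by metis
qed

text \<open>
  The differentials of a minimal resolution become 0 modulo the variables.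
\<close>

lemma tor_dim_minimal:
  assumes r: "free_resolution I d" and m: "minimal_resolution d"
  shows "tor_dim d a i j = graded_rank d a i j"
proof -
  have z: "tor_differential d a j i = 0\<^sub>m (graded_rank d a i j) (graded_rank d a (Suc i) j)" for i
  proof (rule eq_matI)
    fix p q assume "p < dim_row (0\<^sub>m (graded_rank d a i j) (graded_rank d a (Suc i) j) :: complex mat)"
      "q < dim_col (0\<^sub>m (graded_rank d a i j) (graded_rank d a (Suc i) j) :: complex mat)"
    then have p: "p < card {p. p < rk d i \<and> p \<in> {p. a i p = j}}"
      and q: "q < card {q. q < dim_col (d i) \<and> q \<in> {q. a (Suc i) q = j}}"
      by (simp_all add: graded_rank_def res_dim_col[OF r])
    show "tor_differential d a j i $$ (p, q) = 0\<^sub>m (graded_rank d a i j) (graded_rank d a (Suc i) j) $$ (p, q)"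
      using p q pick_le[OF p] pick_le[OF q] minimal_entry_ct[OF m] unfolding tor_differential_def
      by (subst submatrix_index) (simp_all add: graded_rank_def res_dim_col[OF r])
  qed (simp_all add: tor_differential_def dim_submatrix graded_rank_def res_dim_col[OF r])
  show ?thesis unfolding tor_dim_def z
    by (cases i) (simp_all add: vec_space.rank_0I kernel_dim_zero)
qed

section \<open>Codimension and independent sets of variables\<close>

text \<open>
  Induction on \<open>A\<close>: a new variable gets weight 1 and the previous weights are multiplied
  by some \<open>B\<close> greater than all exponents of the new variable, which is then the last
  digit in base \<open>B\<close>.
\<close>

lemma separating_weight_aux:
  fixes S :: "('x \<Rightarrow> nat) set"
  assumes "finite A" "finite S"
  shows "\<exists>w::'x \<Rightarrow> nat. \<forall>m\<in>S. \<forall>m'\<in>S. (\<Sum>x\<in>A. w x * m x) = (\<Sum>x\<in>A. w x * m' x) \<longrightarrow> (\<forall>x\<in>A. m x = m' x)"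
  using assms(1)
proof induction
  case (insert a A)
  then obtain w where w: "\<And>m m'. m \<in> S \<Longrightarrow> m' \<in> S \<Longrightarrow> (\<Sum>x\<in>A. w x * m x) = (\<Sum>x\<in>A. w x * m' x)
      \<Longrightarrow> (\<forall>x\<in>A. m x = m' x)" by blast
  define B where "B = Suc (\<Sum>m\<in>S. m a)"
  have B: "m a < B" if "m \<in> S" for m
    unfolding B_def using member_le_sum[of m S "\<lambda>m. m a"] that assms(2) by simp
  define w' where "w' = (\<lambda>x. if x = a then 1 else B * w x)"
  have eq: "(\<Sum>x\<in>insert a A. w' x * m x) = m a + B * (\<Sum>x\<in>A. w x * m x)" for m :: "'x \<Rightarrow> nat"
  proof -
    have "(\<Sum>x\<in>A. w' x * m x) = B * (\<Sum>x\<in>A. w x * m x)"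
      unfolding sum_distrib_left using insert.hyps by (intro sum.cong) (auto simp: w'_def)
    then show ?thesis using insert.hyps by (simp add: w'_def)
  qed
  show ?case
  proof (intro exI[of _ w'] ballI impI)
    fix m m' x assume m: "m \<in> S" "m' \<in> S" and e: "(\<Sum>x\<in>insert a A. w' x * m x) = (\<Sum>x\<in>insert a A. w' x * m' x)"
      and x: "x \<in> insert a A"
    have e': "m a + B * (\<Sum>x\<in>A. w x * m x) = m' a + B * (\<Sum>x\<in>A. w x * m' x)"
      using e unfolding eq .
    from arg_cong[OF e', of "\<lambda>t. t mod B"] have "m a = m' a" using B m by simp
    moreover from this e' have "B * (\<Sum>x\<in>A. w x * m x) = B * (\<Sum>x\<in>A. w x * m' x)"
      by simp
    then have "(\<Sum>x\<in>A. w x * m x) = (\<Sum>x\<in>A. w x * m' x)"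
      unfolding B_def by (simp only: mult_cancel1) simp
    then have "\<forall>x\<in>A. m x = m' x" by (rule w[OF m])
    ultimately show "m x = m' x" using x by blast
  qed
qed auto

lemma separating_weight:
  fixes S :: "('x::finite \<Rightarrow>\<^sub>0 nat) set"
  assumes "finite S"
  obtains w where "inj_on (weight w) S"
proof -
  obtain w :: "'x \<Rightarrow> nat" where w: "\<forall>m\<in>coef ` S. \<forall>m'\<in>coef ` S. (\<Sum>x\<in>UNIV. w x * m x) = (\<Sum>x\<in>UNIV. w x * m' x)
      \<longrightarrow> (\<forall>x\<in>UNIV. m x = m' x)"
    using separating_weight_aux[of UNIV "coef ` S"] assms by auto
  have "inj_on (weight w) S"
  proof (rule inj_onI)
    fix m m' assume m: "m \<in> S" "m' \<in> S" "weight w m = weight w m'"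
    then have "\<forall>x\<in>UNIV. coef m x = coef m' x"
      using w[rule_format, OF imageI[OF m(1)] imageI[OF m(2)]] unfolding weight_def by blast
    then show "m = m'" by (intro poly_mapping_eqI) simp
  qed
  then show ?thesis using that by blast
qed

text \<open>
  For weights that separate the monomials of both factors, the product of the two heaviest monomials
  arises in one way only.
\<close>

lemma cpoly_mult_nonzero:
  fixes p q :: "'x::finite cpoly"
  assumes "p \<noteq> 0" "q \<noteq> 0"
  shows "p * q \<noteq> 0"
proof -
  obtain w where w: "inj_on (weight w) (keys p \<union> keys q)"
    using separating_weight[of "keys p \<union> keys q"] by auto
  have max: "\<exists>m\<in>keys r. \<forall>m'\<in>keys r. weight w m' \<le> weight w m" if "r \<noteq> 0" for r :: "'x cpoly"
  proof -
    have "Max (weight w ` keys r) \<in> weight w ` keys r" using that by (intro Max_in) auto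
    then obtain m where "m \<in> keys r" and "Max (weight w ` keys r) = weight w m" by (rule imageE)
    moreover have "weight w m' \<le> Max (weight w ` keys r)" if "m' \<in> keys r" for m' using that by simp
    ultimately show ?thesis by auto
  qed
  obtain m0 where m0: "m0 \<in> keys p" "\<And>m. m \<in> keys p \<Longrightarrow> weight w m \<le> weight w m0" using max[OF assms(1)] by blast
  obtain n0 where n0: "n0 \<in> keys q" "\<And>m. m \<in> keys q \<Longrightarrow> weight w m \<le> weight w n0" using max[OF assms(2)] by blast
  have uniq: "m + n = m0 + n0 \<longleftrightarrow> m = m0 \<and> n = n0" if "m \<in> keys p" "n \<in> keys q" for m n
  proof
    assume e: "m + n = m0 + n0"
    then have "weight w m + weight w n = weight w m0 + weight w n0" by (metis weight_add)
    then have "weight w m = weight w m0" using m0(2)[OF that(1)] n0(2)[OF that(2)] by linarith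
    then have "m = m0" using w that m0 by (auto simp: inj_on_def)
    then show "m = m0 \<and> n = n0" using e by simp
  qed simp
  have "coef (p * q) (m0 + n0) = (\<Sum>m\<in>keys p. \<Sum>n\<in>keys q. if m = m0 \<and> n = n0 then coef p m * coef q n else 0)"
    unfolding coef_mult_expand by (intro sum.cong refl) (auto simp: uniq when_def)
  also have "\<dots> = (\<Sum>m\<in>keys p. if m = m0 then coef p m0 * coef q n0 else 0)"
    using n0(1) by (intro sum.cong refl) auto
  also have "\<dots> = coef p m0 * coef q n0" using m0(1) by simp
  finally have "coef (p * q) (m0 + n0) = coef p m0 * coef q n0" .
  moreover have "coef p m0 * coef q n0 \<noteq> 0" using m0(1) n0(1) by (simp add: in_keys_iff)
  ultimately show ?thesis by (metis lookup_zero)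
qed

lemma is_ideal_add_principal:
  fixes P :: "'a::comm_ring_1 set"
  assumes P: "is_ideal P"
  shows "is_ideal {p + r * a | p r. p \<in> P}" 
  unfolding is_ideal_def
proof (intro conjI ballI allI)
  show "0 \<in> {p + r * a | p r. p \<in> P}"
    using is_ideal_zero[OF P] by (intro CollectI exI[of _ 0]) simp
  fix x assume "x \<in> {p + r * a | p r. p \<in> P}"
  then obtain p r where x: "x = p + r * a" "p \<in> P" by blast
  have "s * x = s * p + (s * r) * a" for s by (simp add: x algebra_simps)
  then show "s * x \<in> {p + r * a | p r. p \<in> P}" for s
    using is_ideal_mult(1)[OF P x(2)] by blast
  fix y assume "y \<in> {p + r * a | p r. p \<in> P}"
  then obtain p' r' where y: "y = p' + r' * a" "p' \<in> P" by blast
  have "x + y = (p + p') + (r + r') * a" by (simp add: x y algebra_simps)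
  then show "x + y \<in> {p + r * a | p r. p \<in> P}"
    using is_ideal_add[OF P x(2) y(2)] by blast
qed

text \<open>
  An ideal that is maximal among those disjoint from \<open>M\<close> is prime.
\<close>

lemma prime_avoiding_multiplicative_set:
  fixes I :: "'a::comm_ring_1 set"
  assumes I: "is_ideal I" and M: "1 \<in> M" "\<And>a b. a \<in> M \<Longrightarrow> b \<in> M \<Longrightarrow> a * b \<in> M" and disj: "I \<inter> M = {}"
  obtains P where "primeideal P class_ring" "I \<subseteq> P" "P \<inter> M = {}"
proof -
  define A where "A = {J. is_ideal J \<and> I \<subseteq> J \<and> J \<inter> M = {}}"
  have "\<exists>P\<in>A. \<forall>X\<in>A. P \<subseteq> X \<longrightarrow> X = P"
  proof (rule subset_Zorn_nonempty)
    show "A \<noteq> {}" using I disj by (auto simp: A_def)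
  next
    fix C assume ne: "C \<noteq> {}" and ch: "subset.chain A C"
    then have CA: "\<And>J. J \<in> C \<Longrightarrow> is_ideal J \<and> I \<subseteq> J \<and> J \<inter> M = {}"
      and cmp: "\<And>J K. J \<in> C \<Longrightarrow> K \<in> C \<Longrightarrow> J \<subseteq> K \<or> K \<subseteq> J"
      unfolding subset.chain_def A_def by blast+
    have "is_ideal (\<Union>C)" unfolding is_ideal_def
    proof (intro conjI ballI allI)
      show "0 \<in> \<Union>C" using ne CA is_ideal_zero by blast
      fix x assume "x \<in> \<Union>C"
      then obtain J where J: "J \<in> C" "x \<in> J" by blast
      then show "r * x \<in> \<Union>C" for r using CA is_ideal_mult(1) by blast
      fix y assume "y \<in> \<Union>C"
      then obtain K where K: "K \<in> C" "y \<in> K" by blast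
      then obtain L where "L \<in> C" "x \<in> L" "y \<in> L" using cmp[OF J(1) K(1)] J K by blast
      then show "x + y \<in> \<Union>C" using CA is_ideal_add by blast
    qed
    then show "\<Union>C \<in> A" using CA ne by (auto simp: A_def)
  qed
  then obtain P where P: "is_ideal P" "I \<subseteq> P" "P \<inter> M = {}"
    and max: "\<And>X. is_ideal X \<Longrightarrow> X \<inter> M = {} \<Longrightarrow> P \<subseteq> X \<Longrightarrow> X = P"
  proof -
    assume *: "\<And>P. is_ideal P \<Longrightarrow> I \<subseteq> P \<Longrightarrow> P \<inter> M = {} \<Longrightarrow>
      (\<And>X. is_ideal X \<Longrightarrow> X \<inter> M = {} \<Longrightarrow> P \<subseteq> X \<Longrightarrow> X = P) \<Longrightarrow> thesis"
    assume "\<exists>P\<in>A. \<forall>X\<in>A. P \<subseteq> X \<longrightarrow> X = P"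
    then obtain P where P: "P \<in> A" "\<And>X. X \<in> A \<Longrightarrow> P \<subseteq> X \<Longrightarrow> X = P" by blast
    show thesis
    proof (rule *[of P])
      show "X = P" if "is_ideal X" "X \<inter> M = {}" "P \<subseteq> X" for X
        using P that by (intro P(2)) (auto simp: A_def)
    qed (use P(1) in \<open>auto simp: A_def\<close>)
  qed
  have meet: "\<exists>p r. p \<in> P \<and> p + r * a \<in> M" if "a \<notin> P" for a
  proof (rule ccontr)
    assume n: "\<not> ?thesis"
    let ?X = "{p + r * a | p r. p \<in> P}"
    have "P \<subseteq> ?X"
    proof
      fix x assume "x \<in> P"
      then show "x \<in> ?X" by (intro CollectI exI[of _ x] exI[of _ 0]) simp
    qed
    moreover have "?X \<inter> M = {}" using n by blast
    ultimately have "?X = P" using max is_ideal_add_principal[OF P(1)] by blast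
    moreover have "0 + 1 * a \<in> ?X" using is_ideal_zero[OF P(1)] by blast
    ultimately show False using that by simp
  qed
  have "a \<in> P \<or> b \<in> P" if ab: "a * b \<in> P" for a b
  proof (rule ccontr)
    assume "\<not> ?thesis"
    then obtain p r q s where h: "p \<in> P" "p + r * a \<in> M" "q \<in> P" "q + s * b \<in> M"
      using meet by metis
    have "(p + r * a) * (q + s * b) = (q + s * b) * p + (r * a) * q + (r * s) * (a * b)"
      by (simp add: algebra_simps)
    also have "\<dots> \<in> P" by (intro is_ideal_add[OF P(1)] is_ideal_mult(1)[OF P(1)] h ab)
    finally show False using M(2)[OF h(2,4)] P(3) by blast
  qed
  then have "primeideal P class_ring" using P M(1) by (auto simp: primeideal_iff)
  then show ?thesis using that P by blast
qed

lemma coef_const_mult: "coef (single 0 c * p) m = c * coef p m" for p :: "'x cpoly"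
  by (simp add: mult_map_scale_conv_mult[symmetric] Poly_Mapping.map.rep_eq when_def)

interpretation cpoly_vs: vector_space "\<lambda>c (p :: 'x cpoly). single 0 c * p"
  by standard (auto simp: algebra_simps single_add mult_single mult.assoc[symmetric])

definition indep_mod :: "'x cpoly set \<Rightarrow> 'i set \<Rightarrow> ('i \<Rightarrow> 'x cpoly) \<Rightarrow> bool" where
  "indep_mod P F b \<longleftrightarrow> (\<forall>G c. finite G \<longrightarrow> G \<subseteq> F \<longrightarrow> (\<Sum>i\<in>G. single 0 (c i) * b i) \<in> P \<longrightarrow> (\<forall>i\<in>G. c i = 0))"

lemma indep_modD:
  "indep_mod P F b \<Longrightarrow> finite G \<Longrightarrow> G \<subseteq> F \<Longrightarrow> (\<Sum>i\<in>G. single 0 (c i) * b i) \<in> P \<Longrightarrow> i \<in> G \<Longrightarrow> c i = 0"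
  unfolding indep_mod_def by blast

lemma indep_mod_reindex:
  assumes "indep_mod P F b" "inj_on g F'" "g ` F' \<subseteq> F" "\<And>i. i \<in> F' \<Longrightarrow> b' i = b (g i)"
  shows "indep_mod P F' b'"
  unfolding indep_mod_def
proof (intro allI impI ballI)
  fix G c i assume G: "finite G" "G \<subseteq> F'" "(\<Sum>i\<in>G. single 0 (c i) * b' i) \<in> P" "i \<in> G"
  have inj: "inj_on g G" using assms(2) G(2) by (rule inj_on_subset)
  have "(\<Sum>i\<in>G. single 0 (c i) * b' i) = (\<Sum>j\<in>g ` G. single 0 (c (the_inv_into G g j)) * b j)"
    unfolding sum.reindex[OF inj] using G assms(4) by (intro sum.cong) (auto simp: the_inv_into_f_f[OF inj])
  then have "(\<Sum>j\<in>g ` G. single 0 (c (the_inv_into G g j)) * b j) \<in> P" using G(3) by simp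
  from indep_modD[OF assms(1) _ _ this, of "g i"] show "c i = 0"
    using G assms(3) by (auto simp: the_inv_into_f_f[OF inj])
qed

text \<open>
  This is why the transcendence degree grows when one passes to a smaller prime. In a relation modulo
  \<open>P\<close> the lowest power of \<open>a\<close> can be cancelled, as \<open>P\<close> is
  prime; since \<open>a \<in> Q\<close>, the terms that then contain no \<open>a\<close> form a
  relation modulo \<open>Q\<close>.
\<close>

lemma indep_mod_powers:
  fixes P Q :: "'x::finite cpoly set"
  assumes P: "is_ideal P" "\<And>a b. a * b \<in> P \<Longrightarrow> a \<in> P \<or> b \<in> P" and one: "1 \<notin> P" and Q: "is_ideal Q"
    and PQ: "P \<subseteq> Q" and a: "a \<in> Q" "a \<notin> P" and ind: "indep_mod Q F b"
  shows "indep_mod P (F \<times> (UNIV :: nat set)) (\<lambda>(i, k). b i * a ^ k)"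
  unfolding indep_mod_def
proof (rule allI, rule allI, rule impI, rule impI, rule impI, rule ccontr)
  fix G c assume G: "finite G" "G \<subseteq> F \<times> (UNIV :: nat set)"
    and s: "(\<Sum>z\<in>G. single 0 (c z) * (case z of (i, k) \<Rightarrow> b i * a ^ k)) \<in> P"
    and "\<not> (\<forall>z\<in>G. c z = 0)"
  then have ex: "\<exists>k i. (i, k) \<in> G \<and> c (i, k) \<noteq> 0" by auto
  \<comment> \<open>the lowest power of \<open>a\<close> that occurs\<close>
  define k0 where "k0 = (LEAST k. \<exists>i. (i, k) \<in> G \<and> c (i, k) \<noteq> 0)"
  obtain i0 where i0: "(i0, k0) \<in> G" "c (i0, k0) \<noteq> 0"
    using LeastI_ex[OF ex] unfolding k0_def by blast
  have below: "c (i, k) = 0" if "(i, k) \<in> G" "k < k0" for i k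
    using not_less_Least[of k "\<lambda>k. \<exists>i. (i, k) \<in> G \<and> c (i, k) \<noteq> 0"] that unfolding k0_def by blast
  have pow: "a ^ k \<notin> P" for k
    by (induction k) (use one P(2) a in auto)
  define t where "t z = (if c z = 0 then 0 else single 0 (c z) * (b (fst z) * a ^ (snd z - k0)))" for z
  have "(\<Sum>z\<in>G. single 0 (c z) * (case z of (i, k) \<Rightarrow> b i * a ^ k)) = (\<Sum>z\<in>G. a ^ k0 * t z)"
  proof (intro sum.cong refl)
    fix z assume z: "z \<in> G"
    obtain i k where ik: "z = (i, k)" by (cases z)
    show "single 0 (c z) * (case z of (i, k) \<Rightarrow> b i * a ^ k) = a ^ k0 * t z"
    proof (cases "c z = 0")
      case False
      then have "k \<ge> k0" using below z ik by (meson not_less)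
      then have "a ^ k = a ^ k0 * a ^ (k - k0)" by (simp add: power_add[symmetric])
      then show ?thesis using False by (simp add: t_def ik mult_ac)
    qed (simp add: t_def)
  qed
  then have "a ^ k0 * (\<Sum>z\<in>G. t z) \<in> P" using s by (simp add: sum_distrib_left)
  then have T: "(\<Sum>z\<in>G. t z) \<in> Q" using P(2) pow PQ by blast
  \<comment> \<open>the terms without \<open>a\<close> after the cancellation\<close>
  define G0 where "G0 = {z \<in> G. snd z = k0}"
  have "(\<Sum>z\<in>G. t z) = (\<Sum>z\<in>G0. t z) + (\<Sum>z\<in>G - G0. t z)"
    using G(1) by (subst add.commute, intro sum.subset_diff) (auto simp: G0_def)
  moreover have "(\<Sum>z\<in>G - G0. t z) \<in> Q"
  proof (rule is_ideal_sum[OF Q])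
    fix z assume z: "z \<in> G - G0"
    show "t z \<in> Q"
    proof (cases "c z = 0")
      case False
      have "\<not> snd z < k0" using below[of "fst z" "snd z"] z False by auto
      then have "snd z > k0" using z by (auto simp: G0_def)
      then obtain e where e: "snd z - k0 = Suc e" by (metis Suc_diff_Suc)
      have "t z = (single 0 (c z) * b (fst z) * a ^ e) * a" using False by (simp add: t_def e mult_ac)
      then show ?thesis using is_ideal_mult(1)[OF Q a(1)] by simp
    qed (use is_ideal_zero[OF Q] in \<open>simp add: t_def\<close>)
  qed
  ultimately have T0: "(\<Sum>z\<in>G0. t z) \<in> Q" using is_ideal_diff[OF Q T] by (metis add_diff_cancel_right')
  have inj: "inj_on fst G0" by (auto simp: inj_on_def G0_def)
  have "(\<Sum>z\<in>G0. t z) = (\<Sum>i\<in>fst ` G0. single 0 (c (i, k0)) * b i)"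
    unfolding sum.reindex[OF inj] by (intro sum.cong) (auto simp: t_def G0_def)
  with T0 have "(\<Sum>i\<in>fst ` G0. single 0 (c (i, k0)) * b i) \<in> Q" by simp
  from indep_modD[OF ind _ _ this, of i0] have "c (i0, k0) = 0"
    using G i0 by (force simp: G0_def)
  then show False using i0 by simp
qed

text \<open>
  From each of \<open>k\<close> steps of the chain one takes an element; \<open>l\<close> lists the
  exponents of a monomial in these elements.
\<close>

lemma indep_mod_chain:
  fixes C :: "nat \<Rightarrow> 'x::finite cpoly set"
  assumes prime: "\<And>i. i \<le> n \<Longrightarrow> primeideal (C i) class_ring" and ch: "\<And>i. i < n \<Longrightarrow> C i \<subset> C (Suc i)"
    and ind: "indep_mod (C n) F b"
  shows "k \<le> n \<Longrightarrow> \<exists>as. length as = k \<and>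
    indep_mod (C (n - k)) (F \<times> {l. length l = k}) (\<lambda>(i, l). b i * prod_list (map2 (^) as l))"
proof (induction k)
  case 0
  show ?case
    by (intro exI[of _ "[]"] conjI) (use ind in \<open>auto intro!: indep_mod_reindex[OF ind, of fst] simp: inj_on_def\<close>)
next
  case (Suc k)
  then obtain as where as: "length as = k"
    "indep_mod (C (n - k)) (F \<times> {l. length l = k}) (\<lambda>(i, l). b i * prod_list (map2 (^) as l))"
    by auto
  let ?j = "n - Suc k"
  have j: "?j < n" "Suc ?j = n - k" using Suc.prems by auto
  obtain a where a: "a \<in> C (n - k)" "a \<notin> C ?j" using ch[OF j(1)] j by auto
  have P: "is_ideal (C ?j)" "\<And>a b. a * b \<in> C ?j \<Longrightarrow> a \<in> C ?j \<or> b \<in> C ?j" "C ?j \<noteq> UNIV"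
    using prime[of ?j] by (auto simp: primeideal_iff)
  have one: "1 \<notin> C ?j"
    using P(1,3) is_ideal_mult(1)[OF P(1), of 1] by auto
  have Q: "is_ideal (C (n - k))" using prime[of "n - k"] by (auto simp: primeideal_iff)
  have PQ: "C ?j \<subseteq> C (n - k)" using ch[OF j(1)] j by auto
  have "indep_mod (C ?j) (F \<times> {l. length l = Suc k}) (\<lambda>(i, l). b i * prod_list (map2 (^) (a # as) l))"
  proof (rule indep_mod_reindex[OF indep_mod_powers[OF P(1,2) one Q PQ a as(2)],
          where g = "\<lambda>(i, l). ((i, tl l), hd l)"])
    show "inj_on (\<lambda>(i, l). ((i, tl l), hd l)) (F \<times> {l :: nat list. length l = Suc k})"
    proof (rule inj_onI)
      fix z z' :: "_ \<times> nat list"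
      assume z: "z \<in> F \<times> {l. length l = Suc k}" "z' \<in> F \<times> {l. length l = Suc k}"
        and "(case z of (i, l) \<Rightarrow> ((i, tl l), hd l)) = (case z' of (i, l) \<Rightarrow> ((i, tl l), hd l))"
      then have "fst z = fst z'" "tl (snd z) = tl (snd z')" "hd (snd z) = hd (snd z')"
        by (simp_all add: case_prod_beta)
      moreover have "snd z \<noteq> []" "snd z' \<noteq> []" using z by auto
      ultimately show "z = z'" by (metis list.collapse prod.collapse)
    qed
    show "(\<lambda>(i, l). ((i, tl l), hd l)) ` (F \<times> {l :: nat list. length l = Suc k})
        \<subseteq> (F \<times> {l. length l = k}) \<times> UNIV" by auto
    fix z assume "z \<in> F \<times> {l :: nat list. length l = Suc k}"
    then obtain i e l where "z = (i, e # l)" "length l = k"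
      by (cases z) (auto simp: length_Suc_conv)
    then show "(case z of (i, l) \<Rightarrow> b i * prod_list (map2 (^) (a # as) l)) =
        (case (case z of (i, l) \<Rightarrow> ((i, tl l), hd l)) of
          (z, k) \<Rightarrow> (case z of (i, l) \<Rightarrow> b i * prod_list (map2 (^) as l)) * a ^ k)"
      by (simp add: mult_ac)
  qed
  then show ?case using as(1) by (intro exI[of _ "a # as"]) auto
qed

definition exponents_le :: "nat \<Rightarrow> 'x::finite cpoly \<Rightarrow> bool" where
  "exponents_le B p \<longleftrightarrow> (\<forall>m\<in>keys p. \<forall>x. coef m x \<le> B)"

lemma exponents_le_mult: "exponents_le A p \<Longrightarrow> exponents_le B q \<Longrightarrow> exponents_le (A + B) (p * q)"
  unfolding exponents_le_def using keys_mult[of p q] by (fastforce simp: lookup_add intro: add_mono)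

lemma exponents_le_one: "exponents_le B 1"
  by (auto simp: exponents_le_def)

lemma exponents_le_power: "exponents_le A p \<Longrightarrow> exponents_le (k * A) (p ^ k)"
  by (induction k) (auto simp: exponents_le_one intro: exponents_le_mult)

lemma exponents_le_mono: "exponents_le A p \<Longrightarrow> A \<le> B \<Longrightarrow> exponents_le B p"
  unfolding exponents_le_def using order_trans by blast

lemma exponents_le_exists: "\<exists>B. exponents_le B (p :: 'x::finite cpoly)"
proof -
  have "exponents_le (\<Sum>m\<in>keys p. \<Sum>x\<in>UNIV. coef m x) p" unfolding exponents_le_def
  proof (intro ballI allI)
    fix m x assume m: "m \<in> keys p"
    have "coef m x \<le> (\<Sum>x\<in>UNIV. coef m x)" by (rule member_le_sum) auto
    also have "\<dots> \<le> (\<Sum>m\<in>keys p. \<Sum>x\<in>UNIV. coef m x)" using m by (intro member_le_sum[of m]) auto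
    finally show "coef m x \<le> (\<Sum>m\<in>keys p. \<Sum>x\<in>UNIV. coef m x)" .
  qed
  then show ?thesis by blast
qed

lemma exponents_le_prod_list:
  assumes "\<And>a. a \<in> set as \<Longrightarrow> exponents_le E a" "set l \<subseteq> {..D}" "length as = length l"
  shows "exponents_le (length l * (D * E)) (prod_list (map2 (^) as l))"
  using assms(3,1,2)
proof (induction as l rule: list_induct2)
  case (Cons a as e l)
  have "exponents_le (e * E) (a ^ e)" using Cons.prems by (intro exponents_le_power) auto
  then have "exponents_le (D * E) (a ^ e)" using Cons.prems by (elim exponents_le_mono) (auto intro: mult_le_mono)
  then have "exponents_le (D * E + length l * (D * E)) (a ^ e * prod_list (map2 (^) as l))"
    using Cons by (intro exponents_le_mult) auto
  then show ?case by simp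
qed (simp add: exponents_le_one)

lemma card_bounded_monomials:
  "card {m :: 'x::finite \<Rightarrow>\<^sub>0 nat. keys m \<subseteq> U \<and> (\<forall>x. coef m x \<le> D)} = (D + 1) ^ card U"
  and finite_bounded_monomials: "finite {m :: 'x::finite \<Rightarrow>\<^sub>0 nat. keys m \<subseteq> U \<and> (\<forall>x. coef m x \<le> D)}"
proof -
  let ?M = "{m :: 'x \<Rightarrow>\<^sub>0 nat. keys m \<subseteq> U \<and> (\<forall>x. coef m x \<le> D)}"
  have "bij_betw (\<lambda>m. restrict (coef m) U) ?M (PiE U (\<lambda>_. {..D}))"
  proof (rule bij_betw_byWitness[where f' = "\<lambda>f. Abs_poly_mapping (\<lambda>x. if x \<in> U then f x else 0)"])
    show "\<forall>m\<in>?M. Abs_poly_mapping (\<lambda>x. if x \<in> U then restrict (coef m) U x else 0) = m"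
      by (auto simp: poly_mapping_eq_iff fun_eq_iff in_keys_iff subset_iff)
    show "\<forall>f\<in>PiE U (\<lambda>_. {..D}). restrict (coef (Abs_poly_mapping (\<lambda>x. if x \<in> U then f x else 0))) U = f"
      by (auto simp: fun_eq_iff PiE_def extensional_def restrict_def)
    show "(\<lambda>m. restrict (coef m) U) ` ?M \<subseteq> PiE U (\<lambda>_. {..D})" by auto
    show "(\<lambda>f. Abs_poly_mapping (\<lambda>x. if x \<in> U then f x else 0)) ` PiE U (\<lambda>_. {..D}) \<subseteq> ?M"
      by (auto simp: in_keys_iff PiE_def Pi_def split: if_splits)
  qed
  moreover have "finite (PiE U (\<lambda>_. {..D}))" by (intro finite_PiE) auto
  ultimately show "card ?M = (D + 1) ^ card U" "finite ?M"
    by (auto simp: bij_betw_same_card card_PiE dest: bij_betw_finite)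
qed

lemma in_span_monomials:
  assumes "finite M" "keys p \<subseteq> M"
  shows "p \<in> cpoly_vs.span ((\<lambda>m. single m 1) ` M)"
proof -
  have "p = (\<Sum>m\<in>keys p. single 0 (coef p m) * single m 1)"
    using poly_expand[of p] by (simp add: mult_single)
  also have "\<dots> \<in> cpoly_vs.span ((\<lambda>m. single m 1) ` M)"
    using assms(2) by (intro cpoly_vs.span_sum cpoly_vs.span_scale cpoly_vs.span_base) auto
  finally show ?thesis .
qed

text \<open>
  The products with all exponents at most \<open>D\<close> number
  \<open>(D + 1) ^ (card U + n)\<close> and are combinations of the
  \<open>(D * K + 1) ^ CARD('x)\<close> monomials with exponents at most \<open>D * K\<close>, for
  some \<open>K\<close> that does not depend on \<open>D\<close>. For large \<open>D\<close> the
  powers of \<open>D\<close> decide.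
\<close>

lemma independent_count_bound:
  fixes P :: "'x::finite cpoly set"
  assumes P: "0 \<in> P"
    and ind: "indep_mod P ({m. keys m \<subseteq> U} \<times> {l. length l = n}) (\<lambda>(m, l). single m 1 * prod_list (map2 (^) as l))"
    and as: "length as = n"
  shows "card U + n \<le> CARD('x)"
proof (rule ccontr)
  assume "\<not> ?thesis"
  then have big: "card U + n \<ge> CARD('x) + 1" by simp
  obtain E where E: "\<And>a. a \<in> set as \<Longrightarrow> exponents_le E a"
  proof -
    obtain f where f: "\<And>p :: 'x cpoly. exponents_le (f p) p" using exponents_le_exists by metis
    have "exponents_le (\<Sum>a\<in>set as. f a) a" if "a \<in> set as" for a
      by (rule exponents_le_mono[OF f]) (use that in \<open>auto intro: member_le_sum\<close>)
    then show ?thesis using that by blast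
  qed
  define K where "K = 1 + n * E"
  \<comment> \<open>so large that \<open>K ^ CARD('x) < D + 1\<close>\<close>
  define D where "D = K ^ CARD('x)"
  let ?F = "{m. keys m \<subseteq> U \<and> (\<forall>x. coef m x \<le> D)} \<times> {l. set l \<subseteq> {..D} \<and> length l = n}"
  let ?M = "{m :: 'x \<Rightarrow>\<^sub>0 nat. keys m \<subseteq> UNIV \<and> (\<forall>x. coef m x \<le> D * K)}"
  let ?b = "\<lambda>(m, l). single m 1 * prod_list (map2 (^) as l)"
  have finF: "finite ?F" by (intro finite_cartesian_product finite_bounded_monomials finite_lists_length_eq) simp
  have finM: "finite ?M" by (rule finite_bounded_monomials)
  have "card ?F \<le> card ((\<lambda>m. single m (1::complex)) ` ?M)"
  proof (rule cpoly_vs.card_le_if_family_independent[where b = ?b])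
    fix z assume z: "z \<in> ?F"
    obtain m l where ml: "z = (m, l)" by (cases z)
    have "exponents_le D (single m 1)" using z ml by (auto simp: exponents_le_def)
    moreover have "exponents_le (n * (D * E)) (prod_list (map2 (^) as l))"
      using exponents_le_prod_list[of as E l D] E as z ml by auto
    ultimately have "exponents_le (D + n * (D * E)) (?b z)" unfolding ml using exponents_le_mult by auto
    then have "exponents_le (D * K) (?b z)" by (simp add: K_def algebra_simps)
    then show "?b z \<in> cpoly_vs.span ((\<lambda>m. single m 1) ` ?M)"
      by (intro in_span_monomials finM) (auto simp: exponents_le_def)
  next
    fix c z assume "(\<Sum>z\<in>?F. single 0 (c z) * ?b z) = 0" and z: "z \<in> ?F"
    then have "(\<Sum>z\<in>?F. single 0 (c z) * ?b z) \<in> P" using P by simp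
    from indep_modD[OF ind finF _ this z] show "c z = 0" by auto
  qed (use finF finM in auto)
  also have "\<dots> \<le> card ?M" using finM by (rule card_image_le)
  also have "\<dots> = (D * K + 1) ^ CARD('x)" by (rule card_bounded_monomials)
  also have "\<dots> \<le> ((D + 1) * K) ^ CARD('x)" by (intro power_mono) (auto simp: K_def)
  also have "\<dots> = (D + 1) ^ CARD('x) * D" by (simp only: power_mult_distrib D_def)
  also have "\<dots> < (D + 1) ^ CARD('x) * (D + 1)" by simp
  also have "\<dots> = (D + 1) ^ (CARD('x) + 1)" by simp
  also have "\<dots> \<le> (D + 1) ^ (card U + n)" using big by (intro power_increasing) auto
  also have "\<dots> = card ?F"
    by (simp add: card_cartesian_product card_bounded_monomials card_lists_length_eq power_add)
  finally show False by simp
qed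

text \<open>
  The nonzero polynomials in the variables \<open>U\<close> form a multiplicative set, so some prime
  above \<open>I\<close> avoids them; modulo this prime, whose height is at least \<open>h\<close>,
  the monomials in \<open>U\<close> are independent. A chain of primes below it adds at least
  \<open>h\<close> independent elements, and there are no more than the number of variables.
\<close>

lemma codim_bound:
  fixes I :: "'x::finite cpoly set"
  assumes I: "is_ideal I" and h: "codim I = enat h" "h > 0"
    and U: "\<And>p. p \<in> I \<Longrightarrow> (\<And>m. m \<in> keys p \<Longrightarrow> keys m \<subseteq> U) \<Longrightarrow> p = 0"
  shows "card U + h \<le> CARD('x)"
proof -
  define M where "M = {p :: 'x cpoly. p \<noteq> 0 \<and> (\<forall>m\<in>keys p. keys m \<subseteq> U)}"
  have "1 \<in> M" by (simp add: M_def)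
  moreover have "a * b \<in> M" if "a \<in> M" "b \<in> M" for a b
  proof -
    have "keys m \<subseteq> U" if m: "m \<in> keys (a * b)" for m
    proof -
      obtain u v where uv: "m = u + v" "u \<in> keys a" "v \<in> keys b" using keys_mult[of a b] m by blast
      then have "keys u \<subseteq> U" "keys v \<subseteq> U" using \<open>a \<in> M\<close> \<open>b \<in> M\<close> by (auto simp: M_def)
      then show ?thesis using keys_add[of u v] uv(1) by auto
    qed
    then show ?thesis using that cpoly_mult_nonzero by (auto simp: M_def)
  qed
  moreover have "I \<inter> M = {}" using U by (auto simp: M_def)
  ultimately obtain P where P: "primeideal P class_ring" "I \<subseteq> P" "P \<inter> M = {}"
    using prime_avoiding_multiplicative_set[OF I] by metis
  have "codim I \<le> prime_height P" unfolding codim_def using P by (intro Inf_lower) auto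
  then have ht: "enat h \<le> prime_height P" using h by simp
  have "\<exists>n\<ge>h. \<exists>C. (\<forall>i\<le>n. primeideal (C i) class_ring) \<and> (\<forall>i<n. C i \<subset> C (Suc i)) \<and> C n = P"
  proof (rule ccontr)
    assume n: "\<not> ?thesis"
    have "prime_height P \<le> enat (h - 1)" unfolding prime_height_def
    proof (rule Sup_least)
      fix e assume "e \<in> {enat n | n. \<exists>C. (\<forall>i\<le>n. primeideal (C i) class_ring) \<and>
                          (\<forall>i<n. C i \<subset> C (Suc i)) \<and> C n = P}"
      then obtain n' where n': "e = enat n'" and "\<exists>C. (\<forall>i\<le>n'. primeideal (C i) class_ring) \<and>
                          (\<forall>i<n'. C i \<subset> C (Suc i)) \<and> C n' = P" by blast
      then have "\<not> n' \<ge> h" using n by blast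
      with n' show "e \<le> enat (h - 1)" by simp
    qed
    with ht have "enat h \<le> enat (h - 1)" by (rule order_trans)
    then show False using h(2) by simp
  qed
  then obtain n C where n: "n \<ge> h" and C: "\<And>i. i \<le> n \<Longrightarrow> primeideal (C i) class_ring"
    "\<And>i. i < n \<Longrightarrow> C i \<subset> C (Suc i)" "C n = P" by blast
  have "indep_mod P {m. keys m \<subseteq> U} (\<lambda>m. single m 1)" unfolding indep_mod_def
  proof (intro allI impI ballI)
    fix G and c :: "_ \<Rightarrow> complex" and i assume G: "finite G" "G \<subseteq> {m. keys m \<subseteq> U}" "(\<Sum>i\<in>G. single 0 (c i) * single i 1) \<in> P" "i \<in> G"
    let ?p = "\<Sum>i\<in>G. single 0 (c i) * single i 1"
    have coef: "coef ?p m = (if m \<in> G then c m else 0)" for m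
      using G(1) by (simp add: lookup_sum mult_single lookup_single when_def)
    have "?p = 0"
    proof (rule ccontr)
      assume "?p \<noteq> 0"
      moreover have "m \<in> G" if "m \<in> keys ?p" for m using that coef[of m] by (simp only: in_keys_iff) (metis)
      ultimately have "?p \<in> M" using G(2) by (auto simp: M_def)
      then show False using P(3) G(3) by blast
    qed
    then show "c i = 0" using coef[of i] G(4) by simp
  qed
  then have "indep_mod (C n) {m. keys m \<subseteq> U} (\<lambda>m. single m 1)" using C by simp
  from indep_mod_chain[OF C(1,2) this, of n] obtain as where as: "length as = n"
    "indep_mod (C (n - n)) ({m. keys m \<subseteq> U} \<times> {l. length l = n}) (\<lambda>(m, l). single m 1 * prod_list (map2 (^) as l))"
    by auto
  have "0 \<in> C (n - n)" using C(1)[of "n - n"] is_ideal_zero by (auto simp: primeideal_iff)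
  from independent_count_bound[OF this as(2,1)] n show ?thesis by simp
qed

section \<open>The Hilbert function\<close>

text \<open>
  For an ideal of codimension \<open>h\<close> and a suitable \<open>e\<close>, these monomials span
  the quotient by the ideal.
\<close>

definition standard :: "nat \<Rightarrow> nat \<Rightarrow> ('x::finite \<Rightarrow>\<^sub>0 nat) set" where
  "standard h e = {m. card {x. e \<le> coef m x} + h \<le> CARD('x)}"

text \<open>
  For every large set \<open>U\<close> one chooses a homogeneous element of \<open>I\<close> in the
  variables \<open>U\<close>. Separating weights distinguish a leading monomial in each, and
  \<open>e\<close> bounds all exponents. A monomial that is not standard has exponents at least
  \<open>e\<close> at all variables of some large \<open>U\<close>, so it is divisible by the leading
  monomial for \<open>U\<close> and can be replaced, modulo \<open>I\<close>, by lighter monomials of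
  the same degree.
\<close>

lemma standard_monomials_span:
  fixes I :: "'x::finite cpoly set"
  assumes I: "is_ideal I"
    and hom: "\<And>p k. p \<in> I \<Longrightarrow> degree_part (\<lambda>_. 1) 0 k p \<in> I"
    and dep: "\<And>U. card U + h > CARD('x) \<Longrightarrow> \<exists>p\<in>I. p \<noteq> 0 \<and> (\<forall>m\<in>keys p. keys m \<subseteq> U)"
  obtains e where "\<And>p k. (\<And>m. m \<in> keys p \<Longrightarrow> mdeg m = k) \<Longrightarrow>
    \<exists>q\<in>I. keys (p - q) \<subseteq> {m \<in> standard h e. mdeg m = k}"
proof -
  let ?UU = "{U :: 'x set. card U + h > CARD('x)}"
  have "\<exists>p\<in>I. p \<noteq> 0 \<and> (\<forall>m\<in>keys p. keys m \<subseteq> U) \<and> (\<exists>k. \<forall>m\<in>keys p. mdeg m = k)"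
    if U: "U \<in> ?UU" for U
  proof -
    obtain p where p: "p \<in> I" "p \<noteq> 0" "\<forall>m\<in>keys p. keys m \<subseteq> U" using dep U by blast
    then obtain m where m: "m \<in> keys p" by (metis ex_in_conv keys_eq_empty)
    let ?g = "degree_part (\<lambda>_. 1) 0 (mdeg m) p"
    have "coef ?g m \<noteq> 0" using m by (simp add: coef_degree_part mdeg_eq_weight in_keys_iff)
    then have "?g \<noteq> 0" by auto
    moreover have "\<forall>m'\<in>keys ?g. mdeg m' = mdeg m \<and> m' \<in> keys p"
      using keys_degree_part[of _ "\<lambda>_. 1" 0 "mdeg m" p] by (auto simp: mdeg_eq_weight)
    ultimately show ?thesis using hom[OF p(1)] p(3) by (intro bexI[of _ ?g]) auto
  qed
  then obtain f where f: "\<And>U. U \<in> ?UU \<Longrightarrow> f U \<in> I \<and> f U \<noteq> 0 \<and> (\<forall>m\<in>keys (f U). keys m \<subseteq> U) \<and>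
      (\<exists>k. \<forall>m\<in>keys (f U). mdeg m = k)" by metis
  define S where "S = (\<Union>U\<in>?UU. keys (f U))"
  have finS: "finite S" unfolding S_def by (intro finite_UN_I) auto
  obtain w where w: "inj_on (weight w) S" using separating_weight[OF finS] .
  define e where "e = (\<Sum>m\<in>S. \<Sum>x\<in>UNIV. coef m x)"
  have e: "coef m x \<le> e" if "m \<in> S" for m x
  proof -
    have "coef m x \<le> (\<Sum>x\<in>UNIV. coef m x)" by (rule member_le_sum) auto
    also have "\<dots> \<le> e" unfolding e_def using that finS by (intro member_le_sum[of m]) auto
    finally show ?thesis .
  qed
  have lead: "\<exists>\<mu>\<in>keys (f U). \<forall>m\<in>keys (f U). m \<noteq> \<mu> \<longrightarrow> weight w m < weight w \<mu>" if U: "U \<in> ?UU" for U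
  proof -
    have "Max (weight w ` keys (f U)) \<in> weight w ` keys (f U)" using f[OF U] by (intro Max_in) auto
    then obtain \<mu> where mu: "\<mu> \<in> keys (f U)" and eq: "Max (weight w ` keys (f U)) = weight w \<mu>" by (rule imageE)
    have "weight w m < weight w \<mu>" if "m \<in> keys (f U)" "m \<noteq> \<mu>" for m
    proof -
      have "m \<in> S" "\<mu> \<in> S" using that mu U by (auto simp: S_def)
      then have "weight w m \<noteq> weight w \<mu>" using w that(2) by (metis inj_onD)
      moreover have "weight w m \<le> weight w \<mu>" unfolding eq[symmetric] using that(1) by simp
      ultimately show ?thesis by simp
    qed
    then show ?thesis using mu by blast
  qed
  define T where "T k = {p. \<exists>q\<in>I. keys (p - q) \<subseteq> {m \<in> standard h e. mdeg m = k}}" for k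
  have T_add: "p + p' \<in> T k" if pp: "p \<in> T k" "p' \<in> T k" for p p' k
  proof -
    obtain q q' where q: "q \<in> I" "keys (p - q) \<subseteq> {m \<in> standard h e. mdeg m = k}"
      "q' \<in> I" "keys (p' - q') \<subseteq> {m \<in> standard h e. mdeg m = k}" using pp unfolding T_def by blast
    have "p + p' - (q + q') = (p - q) + (p' - q')" by simp
    moreover have "keys ((p - q) + (p' - q')) \<subseteq> {m \<in> standard h e. mdeg m = k}"
      using keys_add[of "p - q" "p' - q'"] q by blast
    ultimately have "keys (p + p' - (q + q')) \<subseteq> {m \<in> standard h e. mdeg m = k}" by (simp only:)
    then show ?thesis unfolding T_def using is_ideal_add[OF I q(1,3)] by blast
  qed
  have T_scale: "single 0 s * p \<in> T k" if p: "p \<in> T k" for p k s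
  proof -
    obtain q where q: "q \<in> I" "keys (p - q) \<subseteq> {m \<in> standard h e. mdeg m = k}"
      using p unfolding T_def by blast
    have "keys (single 0 s * (p - q)) \<subseteq> keys (p - q)" by (auto simp: in_keys_iff coef_const_mult)
    moreover have "single 0 s * (p - q) = single 0 s * p - single 0 s * q" by (rule right_diff_distrib)
    ultimately have "keys (single 0 s * p - single 0 s * q) \<subseteq> {m \<in> standard h e. mdeg m = k}"
      using q(2) by (simp only:) 
    then show ?thesis unfolding T_def using is_ideal_mult(1)[OF I q(1)] by blast
  qed
  have T_I: "q \<in> T k" if "q \<in> I" for q k unfolding T_def using that by (intro CollectI bexI[of _ q]) auto
  have T_sum: "sum g A \<in> T k" if "\<And>x. x \<in> A \<Longrightarrow> g x \<in> T k" for g :: "('x \<Rightarrow>\<^sub>0 nat) \<Rightarrow> 'x cpoly" and A k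
    using that by (induction A rule: infinite_finite_induct) (auto intro: T_add T_I is_ideal_zero[OF I])
  have mono: "single m 1 \<in> T (mdeg m)" for m
  proof (induction "weight w m" arbitrary: m rule: less_induct)
    case less
    show ?case
    proof (cases "m \<in> standard h e")
      case True
      then show ?thesis unfolding T_def using is_ideal_zero[OF I] by (intro CollectI bexI[of _ 0]) auto
    next
      case False
      define U where "U = {x. e \<le> coef m x}"
      have U: "U \<in> ?UU" using False by (simp add: standard_def U_def not_le)
      obtain \<mu> where mu: "\<mu> \<in> keys (f U)" "\<And>m. m \<in> keys (f U) \<Longrightarrow> m \<noteq> \<mu> \<Longrightarrow> weight w m < weight w \<mu>"
        using lead[OF U] by blast
      obtain k where k: "\<And>m. m \<in> keys (f U) \<Longrightarrow> mdeg m = k" using f[OF U] by blast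
      have muS: "\<mu> \<in> S" using mu(1) U by (auto simp: S_def)
      have le: "coef \<mu> x \<le> coef m x" for x
      proof (cases "x \<in> U")
        case True
        then show ?thesis using e[OF muS, of x] by (simp add: U_def)
      next
        case False
        then have "x \<notin> keys \<mu>" using f[OF U] mu(1) by blast
        then show ?thesis by (simp add: in_keys_iff)
      qed
      define r where "r = m - \<mu>"
      have m: "m = \<mu> + r" by (rule poly_mapping_eqI) (use le in \<open>simp add: r_def lookup_add lookup_minus\<close>)
      define l where "l = coef (f U) \<mu>"
      have l: "l \<noteq> 0" using mu(1) by (simp add: l_def in_keys_iff)
      \<comment> \<open>the multiple of \<open>f U\<close> with leading term \<open>m\<close>\<close>
      let ?p = "single r (1 / l) * f U"
      have pI: "?p \<in> I" using f[OF U] by (intro is_ideal_mult(1)[OF I]) blast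
      have "?p = single r (1 / l) * (\<Sum>m'\<in>keys (f U). single m' (coef (f U) m'))"
        using poly_expand[of "f U"] by simp
      also have "\<dots> = (\<Sum>m'\<in>keys (f U). single (r + m') (coef (f U) m' / l))"
        by (simp add: sum_distrib_left mult_single)
      also have "\<dots> = single (r + \<mu>) 1 + (\<Sum>m'\<in>keys (f U) - {\<mu>}. single (r + m') (coef (f U) m' / l))"
        using mu(1) l by (subst sum.remove[of _ \<mu>]) (auto simp: l_def)
      finally have p: "single m 1 = ?p + single 0 (-1) * (\<Sum>m'\<in>keys (f U) - {\<mu>}. single 0 (coef (f U) m' / l) * single (r + m') 1)"
        by (simp add: m add.commute mult_single sum_distrib_left single_uminus sum_negf)
      have "single (r + m') 1 \<in> T (mdeg m)" if m': "m' \<in> keys (f U) - {\<mu>}" for m'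
      proof -
        have "weight w (r + m') < weight w m" using mu(2) m' by (simp add: m)
        moreover have "mdeg (r + m') = mdeg m" using k[of m'] k[of \<mu>] m' mu(1) by (simp add: m mdeg_eq_weight)
        ultimately show ?thesis using less[of "r + m'"] by simp
      qed
      then show ?thesis unfolding p by (intro T_add T_I[OF pI] T_scale T_sum)
    qed
  qed
  have "p \<in> T k" if "\<And>m. m \<in> keys p \<Longrightarrow> mdeg m = k" for p k
  proof -
    have "p = (\<Sum>m\<in>keys p. single 0 (coef p m) * single m 1)"
      using poly_expand[of p] by (simp add: mult_single)
    also have "\<dots> \<in> T k" using mono that by (intro T_sum T_scale) auto
    finally show ?thesis .
  qed
  then show ?thesis using that unfolding T_def by blast
qed

lemma (in vector_space) rank_nullity_finite:
  assumes add: "\<And>x y. f (x + y) = f x + f y" and sc: "\<And>c x. f (scale c x) = scale c (f x)"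
    and V: "subspace V" and T: "finite T" "V \<subseteq> span T"
  shows "dim V = dim {v \<in> V. f v = 0} + dim (f ` V)"
proof -
  let ?K = "{v \<in> V. f v = 0}"
  have fsum: "f (\<Sum>x\<in>X. scale (u x) x) = (\<Sum>x\<in>X. scale (u x) (f x))" for u and X :: "'b set"
  proof (induction X rule: infinite_finite_induct)
    case empty
    show ?case using sc[of 0 0] by simp
  next
    case (infinite X)
    then show ?case using sc[of 0 0] by simp
  qed (simp add: add sc)
  obtain B0 where B0: "B0 \<subseteq> ?K" "independent B0" "?K \<subseteq> span B0" "card B0 = dim ?K"
    using basis_exists .
  obtain B where B: "B0 \<subseteq> B" "B \<subseteq> V" "independent B" "V \<subseteq> span B"
    using maximal_independent_subset_extend[of B0 V] B0 by blast
  have finB: "finite B" using independent_span_bound[OF T(1) B(3)] B(2) T(2) by blast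
  then have finB0: "finite B0" using B(1) finite_subset by blast
  let ?C = "B - B0"
  have fV: "f ` V \<subseteq> span (f ` ?C)"
  proof
    fix y assume "y \<in> f ` V"
    then obtain v where v: "v \<in> V" "y = f v" by blast
    then obtain u where u: "v = (\<Sum>x\<in>B. scale (u x) x)" using B(4) span_finite[OF finB] by auto
    have "y = (\<Sum>x\<in>B. scale (u x) (f x))" using v(2) u fsum by simp
    also have "\<dots> = (\<Sum>x\<in>?C. scale (u x) (f x))"
      using finB B0(1) by (intro sum.mono_neutral_right) auto
    also have "\<dots> \<in> span (f ` ?C)" by (intro span_sum span_scale span_base) auto
    finally show "y \<in> span (f ` ?C)" .
  qed
  obtain D where D: "D \<subseteq> f ` V" "independent D" "f ` V \<subseteq> span D" "card D = dim (f ` V)"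
    using basis_exists .
  have finD: "finite D" using independent_span_bound[of "f ` ?C" D] finB D(1,2) fV by blast
  have "card ?C \<le> card D"
  proof (rule card_le_if_family_independent[where b = f])
    show "f i \<in> span D" if "i \<in> ?C" for i using that B(2) D(3) by blast
    fix u i assume z: "(\<Sum>x\<in>?C. scale (u x) (f x)) = 0" and i: "i \<in> ?C"
    let ?v = "\<Sum>x\<in>?C. scale (u x) x"
    have "?v \<in> V" using B(2) by (intro subspace_sum[OF V] subspace_scale[OF V]) auto
    then have "?v \<in> span B0" using z fsum B0(3) by auto
    then obtain g where g: "?v = (\<Sum>x\<in>B0. scale (g x) x)" using span_finite[OF finB0] by auto
    let ?w = "\<lambda>x. if x \<in> B0 then - g x else u x"
    have "(\<Sum>x\<in>B. scale (?w x) x) = (\<Sum>x\<in>?C. scale (?w x) x) + (\<Sum>x\<in>B0. scale (?w x) x)"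
      by (rule sum.subset_diff[OF B(1) finB])
    also have "(\<Sum>x\<in>?C. scale (?w x) x) = ?v" by (intro sum.cong) auto
    also have "(\<Sum>x\<in>B0. scale (?w x) x) = - (\<Sum>x\<in>B0. scale (g x) x)"
      unfolding sum_negf[symmetric] by (intro sum.cong) auto
    finally have "(\<Sum>x\<in>B. scale (?w x) x) = 0" using g by simp
    from independentD[OF B(3) finB subset_refl this, of i] show "u i = 0" using i by auto
  qed (use finB finD in auto)
  moreover have "dim (f ` V) \<le> card ?C"
    using dim_le_card[OF fV] finB card_image_le[of ?C f] by (meson finite_Diff finite_imageI le_trans)
  moreover have "card ?C = card B - card B0" using B(1) finB0 by (rule card_Diff_subset[rotated])
  moreover have "card B0 \<le> card B" using B(1) finB by (rule card_mono[rotated])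
  moreover have "card B = dim V" using B by (intro basis_card_eq_dim)
  ultimately show ?thesis using D(4) B0(4) by simp
qed

interpretation free_vs: vector_space "\<lambda>c (v :: nat \<Rightarrow> 'x::finite cpoly) q. single 0 c * v q"
  by standard (auto simp: algebra_simps single_add mult_single mult.assoc[symmetric] fun_eq_iff)

text \<open>
  The elements of degree \<open>k\<close> of the free module with \<open>r\<close> basis vectors of
  degrees \<open>a q\<close>. They are functions rather than vectors so that they live in one type
  with a vector space structure.
\<close>

definition piece :: "nat \<Rightarrow> (nat \<Rightarrow> nat) \<Rightarrow> nat \<Rightarrow> (nat \<Rightarrow> 'x::finite cpoly) set" where
  "piece r a k = {v. \<forall>q. (q < r \<or> v q = 0) \<and> (\<forall>m\<in>keys (v q). a q + mdeg m = k)}"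

definition piece_index :: "nat \<Rightarrow> (nat \<Rightarrow> nat) \<Rightarrow> nat \<Rightarrow> (nat \<times> ('x::finite \<Rightarrow>\<^sub>0 nat)) set" where
  "piece_index r a k = {(q, m). q < r \<and> a q + mdeg m = k}"

definition basis_elt :: "nat \<times> ('x::finite \<Rightarrow>\<^sub>0 nat) \<Rightarrow> nat \<Rightarrow> 'x cpoly" where
  "basis_elt z = (\<lambda>p. if p = fst z then single (snd z) 1 else 0)"

lemma fun_sum_apply: "(\<Sum>i\<in>X. f i) x = (\<Sum>i\<in>X. f i x)" for f :: "'b \<Rightarrow> 'c \<Rightarrow> 'd::comm_monoid_add"
  by (induction X rule: infinite_finite_induct) auto

lemma finite_mdeg_le: "finite {m :: 'x::finite \<Rightarrow>\<^sub>0 nat. mdeg m \<le> k}"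
proof (rule finite_subset[OF _ finite_bounded_monomials[of UNIV k]])
  have "coef m x \<le> mdeg m" for m :: "'x \<Rightarrow>\<^sub>0 nat" and x
    unfolding mdeg_def by (rule member_le_sum) auto
  then show "{m :: 'x \<Rightarrow>\<^sub>0 nat. mdeg m \<le> k} \<subseteq> {m. keys m \<subseteq> UNIV \<and> (\<forall>x. coef m x \<le> k)}"
    using order_trans by blast
qed

lemma finite_piece_index: "finite (piece_index r a k :: (nat \<times> ('x::finite \<Rightarrow>\<^sub>0 nat)) set)"
  by (rule finite_subset[of _ "{..<r} \<times> {m. mdeg m \<le> k}"]) (auto simp: piece_index_def finite_mdeg_le)

lemma piece_subspace: "free_vs.subspace (piece r a k)"
proof (rule free_vs.subspaceI)
  fix x y :: "nat \<Rightarrow> 'x::finite cpoly" and c assume x: "x \<in> piece r a k"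
  show "(\<lambda>q. single 0 c * x q) \<in> piece r a k"
    using x by (auto simp: piece_def in_keys_iff coef_const_mult)
  assume y: "y \<in> piece r a k"
  have "a q + mdeg m = k" if "m \<in> keys (x q + y q)" for q m
    using keys_add[of "x q" "y q"] that x y by (auto simp: piece_def)
  then show "x + y \<in> piece r a k" using x y by (fastforce simp: piece_def)
qed (simp add: piece_def)

lemma piece_expand:
  assumes "v \<in> piece r a k"
  shows "v = (\<Sum>z\<in>piece_index r a k. (\<lambda>q. single 0 (coef (v (fst z)) (snd z)) * basis_elt z q))"
proof
  fix q
  have "(\<Sum>z\<in>piece_index r a k. (\<lambda>q. single 0 (coef (v (fst z)) (snd z)) * basis_elt z q)) q
      = (\<Sum>z\<in>piece_index r a k. single 0 (coef (v (fst z)) (snd z)) * basis_elt z q)"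
    by (rule fun_sum_apply)
  also have "\<dots> = (\<Sum>z\<in>Pair q ` keys (v q). single 0 (coef (v (fst z)) (snd z)) * basis_elt z q)"
  proof (rule sum.mono_neutral_right[OF finite_piece_index])
    have deg: "a q + mdeg m = k" and qr: "q < r" if "m \<in> keys (v q)" for m
      using assms that unfolding piece_def by (blast, fastforce)
    show "Pair q ` keys (v q) \<subseteq> piece_index r a k"
      using deg qr by (auto simp: piece_index_def)
    show "\<forall>z\<in>piece_index r a k - Pair q ` keys (v q). single 0 (coef (v (fst z)) (snd z)) * basis_elt z q = 0"
    proof
      fix z assume "z \<in> piece_index r a k - Pair q ` keys (v q)"
      then have "fst z \<noteq> q \<or> snd z \<notin> keys (v q)" by (cases z) auto
      then show "single 0 (coef (v (fst z)) (snd z)) * basis_elt z q = 0"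
        by (auto simp: basis_elt_def in_keys_iff)
    qed
  qed
  also have "\<dots> = (\<Sum>m\<in>keys (v q). single m (coef (v q) m))"
    by (subst sum.reindex) (auto simp: inj_on_def basis_elt_def mult_single)
  finally show "v q = (\<Sum>z\<in>piece_index r a k. (\<lambda>q. single 0 (coef (v (fst z)) (snd z)) * basis_elt z q)) q"
    using poly_expand[of "v q"] by simp
qed

lemma piece_span: "piece r a k \<subseteq> free_vs.span (basis_elt ` piece_index r a k)"
proof
  fix v :: "nat \<Rightarrow> 'x::finite cpoly" assume v: "v \<in> piece r a k"
  have "(\<Sum>z\<in>piece_index r a k. (\<lambda>q. single 0 (coef (v (fst z)) (snd z)) * basis_elt z q))
      \<in> free_vs.span (basis_elt ` piece_index r a k)"
    by (rule free_vs.span_sum, rule free_vs.span_scale, rule free_vs.span_base, rule imageI)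
  then show "v \<in> free_vs.span (basis_elt ` piece_index r a k)"
    unfolding piece_expand[OF v, symmetric] .
qed

lemma basis_elt_in_piece: "z \<in> piece_index r a k \<Longrightarrow> basis_elt z \<in> piece r a k"
  by (auto simp: piece_index_def piece_def basis_elt_def)

lemma piece_dim: "free_vs.dim (piece r a k :: (nat \<Rightarrow> 'x::finite cpoly) set)
    = card (piece_index r a k :: (nat \<times> ('x \<Rightarrow>\<^sub>0 nat)) set)" (is "free_vs.dim ?V = card ?Z")
proof (rule antisym)
  have "free_vs.dim ?V \<le> card (basis_elt ` ?Z)"
    by (rule free_vs.dim_le_card[OF piece_span finite_imageI[OF finite_piece_index]])
  also have "\<dots> \<le> card ?Z" by (rule card_image_le[OF finite_piece_index])
  finally show "free_vs.dim ?V \<le> card ?Z" .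
  obtain B where B: "B \<subseteq> ?V" "free_vs.independent B" "?V \<subseteq> free_vs.span B" "card B = free_vs.dim ?V"
    using free_vs.basis_exists .
  have finB: "finite B" 
    using free_vs.independent_span_bound[OF finite_imageI[OF finite_piece_index] B(2)
        order_trans[OF B(1) piece_span]] by (rule conjunct1)
  have "card ?Z \<le> card B"
  proof (rule free_vs.card_le_if_family_independent[where b = basis_elt])
    show "basis_elt z \<in> free_vs.span B" if "z \<in> ?Z" for z using basis_elt_in_piece[OF that] B by blast
    fix c z assume s: "(\<Sum>z\<in>?Z. (\<lambda>q. single 0 (c z) * basis_elt z q)) = 0" and z: "z \<in> ?Z"
    have "0 = coef ((\<Sum>z\<in>?Z. (\<lambda>q. single 0 (c z) * basis_elt z q)) (fst z)) (snd z)" unfolding s by simp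
    also have "\<dots> = (\<Sum>z'\<in>?Z. c z' * coef (basis_elt z' (fst z)) (snd z))"
      by (simp add: fun_sum_apply lookup_sum coef_const_mult)
    also have "\<dots> = (\<Sum>z'\<in>?Z. if z' = z then c z else 0)"
      by (intro sum.cong refl) (auto simp: basis_elt_def lookup_single prod_eq_iff when_def)
    also have "\<dots> = c z" using z by (simp add: sum.delta[OF finite_piece_index])
    finally show "c z = 0" by simp
  qed (use finB finite_piece_index in auto)
  then show "card ?Z \<le> free_vs.dim ?V" using B(4) by simp
qed

definition act :: "'x::finite cpoly mat \<Rightarrow> (nat \<Rightarrow> 'x cpoly) \<Rightarrow> nat \<Rightarrow> 'x cpoly" where
  "act A v = (\<lambda>p. if p < dim_row A then \<Sum>q<dim_col A. A $$ (p, q) * v q else 0)"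

lemma act_add: "act A (u + v) = act A u + act A v"
  by (auto simp: act_def fun_eq_iff sum.distrib distrib_left)

lemma act_scale: "act A (\<lambda>q. single 0 c * v q) = (\<lambda>q. single 0 c * act A v q)"
  by (auto simp: act_def fun_eq_iff sum_distrib_left mult_ac)

lemma act_vec: "u \<in> carrier_vec (dim_col A) \<Longrightarrow> p < dim_row A \<Longrightarrow> act A (\<lambda>q. u $ q) p = (A *\<^sub>v u) $ p"
  by (subst mult_mat_vec_entry[of A "dim_row A" "dim_col A"]) (auto simp: act_def)

lemma act_degree_part:
  assumes A: "graded_mat (\<lambda>_. 1) a b A" and p: "p < dim_row A"
  shows "act A (\<lambda>q. degree_part (\<lambda>_. 1) (b q) k (v q)) p = degree_part (\<lambda>_. 1) (a p) k (act A v p)"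
  unfolding act_def using p A
  by (auto simp: degree_part_sum graded_mat_def intro!: sum.cong degree_part_homogeneous_mult[symmetric])

lemma degree_part_piece: "(\<lambda>q. if q < r then degree_part (\<lambda>_. 1) (a q) k (v q) else 0) \<in> piece r a k"
  by (auto simp: piece_def mdeg_eq_weight dest!: keys_degree_part)

lemma piece_degree_part: "v \<in> piece r a k \<Longrightarrow> degree_part (\<lambda>_. 1) (a q) k (v q) = v q"
  by (intro degree_part_id) (auto simp: piece_def mdeg_eq_weight)

lemma act_cong: "(\<And>q. q < dim_col A \<Longrightarrow> u q = v q) \<Longrightarrow> act A u = act A v"
  by (auto simp: act_def fun_eq_iff intro!: sum.cong)

lemma act_piece:
  assumes A: "graded_mat (\<lambda>_. 1) a b A" and v: "v \<in> piece r b k"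
  shows "act A v \<in> piece (dim_row A) a k"
proof -
  have eq: "degree_part (\<lambda>_. 1) (a p) k (act A v p) = act A v p" if "p < dim_row A" for p
    using act_degree_part[OF A that, of k v] unfolding piece_degree_part[OF v] by (rule sym)
  have w: "(\<lambda>p. if p < dim_row A then degree_part (\<lambda>_. 1) (a p) k (act A v p) else 0) = act A v"
  proof
    fix p show "(if p < dim_row A then degree_part (\<lambda>_. 1) (a p) k (act A v p) else 0) = act A v p"
    proof (cases "p < dim_row A")
      case True
      then show ?thesis by (simp only: eq if_True)
    qed (simp add: act_def)
  qed
  show ?thesis using degree_part_piece[of "dim_row A" a k "act A v"] unfolding w .
qed

context finite_graded_resolution
begin

abbreviation F :: "nat \<Rightarrow> nat \<Rightarrow> (nat \<Rightarrow> 'x cpoly) set" where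
  "F i k \<equiv> piece (rk d i) (a i) k"

text \<open>
  The part of degree \<open>k\<close> of a preimage is a preimage.
\<close>

lemma act_in_image:
  assumes v: "v \<in> F i k" and u: "u \<in> carrier_vec (rk d (Suc i))"
    and eq: "\<And>p. p < rk d i \<Longrightarrow> v p = (d i *\<^sub>v u) $ p"
  shows "v \<in> act (d i) ` F (Suc i) k"
proof -
  let ?u = "\<lambda>q. if q < rk d (Suc i) then degree_part (\<lambda>_. 1) (a (Suc i) q) k (u $ q) else 0"
  have "act (d i) ?u p = v p" for p
  proof (cases "p < rk d i")
    case True
    have "act (d i) ?u p = act (d i) (\<lambda>q. degree_part (\<lambda>_. 1) (a (Suc i) q) k (u $ q)) p"
      by (rule fun_cong[OF act_cong]) (simp add: res_dim_col[OF res])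
    also have "\<dots> = degree_part (\<lambda>_. 1) (a i p) k (act (d i) (\<lambda>q. u $ q) p)" by (rule act_degree_part[OF graded True])
    also have "act (d i) (\<lambda>q. u $ q) p = v p"
      using u True eq by (subst act_vec) (auto simp: res_dim_col[OF res])
    also have "degree_part (\<lambda>_. 1) (a i p) k (v p) = v p" by (rule piece_degree_part[OF v])
    finally show ?thesis .
  next
    case False
    then show ?thesis using v by (auto simp: act_def piece_def)
  qed
  then have "v = act (d i) ?u" by (simp add: fun_eq_iff)
  then show ?thesis using degree_part_piece by blast
qed

lemma piece_exact: "{v \<in> F (Suc i) k. act (d i) v = 0} = act (d (Suc i)) ` F (Suc (Suc i)) k"
proof (rule subset_antisym; rule subsetI)
  fix v assume "v \<in> {v \<in> F (Suc i) k. act (d i) v = 0}"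
  then have v: "v \<in> F (Suc i) k" and z: "act (d i) v = 0" by auto
  let ?v = "Matrix.vec (rk d (Suc i)) v"
  have "act (d i) (\<lambda>q. ?v $ q) = act (d i) v" by (rule act_cong) (simp add: res_dim_col[OF res])
  then have "(d i *\<^sub>v ?v) $ p = 0" if "p < rk d i" for p
    using that z by (subst act_vec[symmetric]) (auto simp: res_dim_col[OF res])
  then have "?v \<in> mat_kernel (d i)" by (auto simp: mat_kernel_iff res_dim_col[OF res] intro!: eq_vecI)
  then obtain u where u: "u \<in> carrier_vec (rk d (Suc (Suc i)))" "?v = d (Suc i) *\<^sub>v u"
    by (auto simp: res_exact[OF res] mat_image_def res_dim_col[OF res])
  have "v p = (d (Suc i) *\<^sub>v u) $ p" if "p < rk d (Suc i)" for p
    unfolding u(2)[symmetric] using that by simp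
  then show "v \<in> act (d (Suc i)) ` F (Suc (Suc i)) k" by (rule act_in_image[OF v u(1)])
next
  fix v assume "v \<in> act (d (Suc i)) ` F (Suc (Suc i)) k"
  then obtain u where u: "u \<in> F (Suc (Suc i)) k" "v = act (d (Suc i)) u" by blast
  have v: "v \<in> F (Suc i) k" unfolding u(2) by (rule act_piece[OF graded u(1)])
  let ?u = "Matrix.vec (rk d (Suc (Suc i))) u"
  let ?w = "d (Suc i) *\<^sub>v ?u"
  have uc: "?u \<in> carrier_vec (dim_col (d (Suc i)))" by (simp add: res_dim_col[OF res])
  have "?w \<in> mat_image (d (Suc i))" by (rule mat_imageI[OF uc])
  then have w: "?w \<in> carrier_vec (rk d (Suc i))" "d i *\<^sub>v ?w = 0\<^sub>v (rk d i)"
    by (auto simp: res_exact[OF res, symmetric] mat_kernel_iff res_dim_col[OF res])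
  have "?w $ q = v q" if "q < rk d (Suc i)" for q
  proof -
    have "?w $ q = act (d (Suc i)) (\<lambda>q. ?u $ q) q" using act_vec[OF uc that] by simp
    also have "act (d (Suc i)) (\<lambda>q. ?u $ q) = v" unfolding u(2)
      by (rule act_cong) (simp add: res_dim_col[OF res])
    finally show ?thesis .
  qed
  then have "act (d i) v = act (d i) (\<lambda>q. ?w $ q)" by (intro act_cong) (simp add: res_dim_col[OF res])
  also have "\<dots> = 0"
  proof
    fix p show "act (d i) (\<lambda>q. ?w $ q) p = 0 p"
    proof (cases "p < rk d i")
      case True
      then have "act (d i) (\<lambda>q. ?w $ q) p = (d i *\<^sub>v ?w) $ p"
        using w(1) by (intro act_vec) (auto simp: res_dim_col[OF res])
      then show ?thesis using w(2) True by simp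
    qed (simp add: act_def)
  qed
  finally show "v \<in> {v \<in> F (Suc i) k. act (d i) v = 0}" using v by simp
qed

definition image_dim :: "nat \<Rightarrow> nat \<Rightarrow> nat" where
  "image_dim i k = free_vs.dim (act (d i) ` F (Suc i) k)"

lemma piece_dim_split:
  "free_vs.dim (F (Suc i) k) = image_dim (Suc i) k + image_dim i k"
  unfolding image_dim_def piece_exact[symmetric]
  by (rule free_vs.rank_nullity_finite[OF act_add act_scale piece_subspace _ piece_span])
     (simp add: finite_piece_index)

text \<open>
  By exactness this is the dimension of the piece of degree \<open>k\<close> of \<open>S/I\<close>.
\<close>

definition hilbert :: "nat \<Rightarrow> int" where
  "hilbert k = (\<Sum>i\<le>c. (-1) ^ i * int (card (piece_index (rk d i) (a i) k :: (nat \<times> ('x \<Rightarrow>\<^sub>0 nat)) set)))"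

text \<open>
  Telescoping, as each piece is an extension of one image by the next.
\<close>

lemma hilbert_eq: "hilbert k = int (free_vs.dim (F 0 k)) - int (image_dim 0 k)"
proof -
  define D where "D i = int (free_vs.dim (F i k))" for i
  define R where "R i = int (image_dim i k)" for i
  have split: "D (Suc i) = R (Suc i) + R i" for i by (simp add: D_def R_def piece_dim_split)
  have "(\<Sum>i\<le>n. (-1) ^ i * D i) = D 0 - R 0 + (-1) ^ n * R n" for n
    by (induction n) (simp_all add: split algebra_simps)
  moreover have "image_dim c k = 0"
  proof -
    have "F (Suc c) k = {0}" using finite_length[of "Suc c"] by (auto simp: piece_def fun_eq_iff)
    moreover have "act (d c) 0 = 0" by (auto simp: act_def fun_eq_iff)
    ultimately have "act (d c) ` F (Suc c) k = {0}" by (simp only: image_insert image_empty)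
    moreover have "free_vs.dim {0 :: nat \<Rightarrow> 'x cpoly} \<le> card ({} :: (nat \<Rightarrow> 'x cpoly) set)" by (intro free_vs.dim_le_card) auto
    ultimately show ?thesis by (simp add: image_dim_def)
  qed
  ultimately have "(\<Sum>i\<le>c. (-1) ^ i * D i) = D 0 - R 0" by (simp add: R_def)
  then show ?thesis unfolding hilbert_def piece_dim[symmetric] D_def R_def .
qed

lemma piece0_ideal: "v \<in> F 0 k \<Longrightarrow> v 0 \<in> I \<Longrightarrow> v \<in> act (d 0) ` F 1 k"
proof -
  assume v: "v \<in> F 0 k" and "v 0 \<in> I"
  then obtain u where u: "u \<in> carrier_vec (rk d 1)" "v 0 = (\<Sum>j<rk d 1. d 0 $$ (0, j) * u $ j)"
    by (auto simp: res_ideal[OF res])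
  have "v p = (d 0 *\<^sub>v u) $ p" if "p < rk d 0" for p
    using that u res_rk0[OF res] mult_mat_vec_entry[OF res_carrier[OF res], of u 0 0] by simp
  then show ?thesis using act_in_image[OF v, of u] u(1) by simp
qed

lemma hilbert_nonneg: "0 \<le> hilbert k"
proof -
  have "act (d 0) ` F (Suc 0) k \<subseteq> free_vs.span (basis_elt ` piece_index (rk d 0) (a 0) k)"
    using act_piece[OF graded] piece_span by blast
  then have "image_dim 0 k \<le> card (basis_elt ` piece_index (rk d 0) (a 0) k :: (nat \<Rightarrow> 'x cpoly) set)"
    unfolding image_dim_def by (rule free_vs.dim_le_card) (simp add: finite_piece_index)
  also have "\<dots> \<le> free_vs.dim (F 0 k)" unfolding piece_dim by (rule card_image_le[OF finite_piece_index])
  finally show ?thesis unfolding hilbert_eq by simp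
qed

lemma hilbert_le:
  fixes S :: "('x \<Rightarrow>\<^sub>0 nat) set"
  assumes S: "finite S" and deg: "\<And>m. m \<in> S \<Longrightarrow> mdeg m = k"
    and sp: "\<And>p. (\<And>m. m \<in> keys p \<Longrightarrow> mdeg m = k) \<Longrightarrow> \<exists>q\<in>I. keys (p - q) \<subseteq> S"
  shows "hilbert k \<le> int (card S)"
proof -
  let ?A = "act (d 0) ` F (Suc 0) k"
  obtain B where B: "B \<subseteq> ?A" "free_vs.independent B" "?A \<subseteq> free_vs.span B" "card B = free_vs.dim ?A"
    using free_vs.basis_exists .
  have Asub: "?A \<subseteq> F 0 k" using act_piece[OF graded] by blast
  have finB: "finite B"
    using free_vs.independent_span_bound[OF finite_imageI[OF finite_piece_index] B(2)
        order_trans[OF order_trans[OF B(1) Asub] piece_span]] by (rule conjunct1)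
  let ?E = "basis_elt ` ((\<lambda>m. (0, m)) ` S)"
  have "F 0 k \<subseteq> free_vs.span (B \<union> ?E)"
  proof
    fix v assume v: "v \<in> F 0 k"
    obtain q where q: "q \<in> I" "keys (v 0 - q) \<subseteq> S"
    proof -
      have "a 0 0 + mdeg m = k" if "m \<in> keys (v 0)" for m using v that unfolding piece_def by blast
      then have "mdeg m = k" if "m \<in> keys (v 0)" for m using a00 that by simp
      then show ?thesis using sp[of "v 0"] that by blast
    qed
    define s where "s = (\<lambda>p::nat. if p = 0 then v 0 - q else (0 :: 'x cpoly))"
    have s: "s \<in> F 0 k" using q(2) deg a00 res_rk0[OF res] by (auto simp: s_def piece_def)
    have "v - s \<in> F 0 k" by (rule free_vs.subspace_diff[OF piece_subspace v s])
    moreover have "(v - s) 0 = q" by (simp add: s_def)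
    ultimately have "v - s \<in> ?A" using piece0_ideal[of "v - s"] q(1) by simp
    then have 1: "v - s \<in> free_vs.span (B \<union> ?E)" using B(3) free_vs.span_mono[of B "B \<union> ?E"] by blast
    have "s = (\<Sum>m\<in>keys (v 0 - q). (\<lambda>p. single 0 (coef (v 0 - q) m) * basis_elt (0, m) p))"
    proof
      fix p show "s p = (\<Sum>m\<in>keys (v 0 - q). (\<lambda>p. single 0 (coef (v 0 - q) m) * basis_elt (0, m) p)) p"
        using poly_expand[of "v 0 - q"] by (simp add: fun_sum_apply s_def basis_elt_def mult_single)
    qed
    also have "\<dots> \<in> free_vs.span (B \<union> ?E)" using q(2) by (intro free_vs.span_sum free_vs.span_scale free_vs.span_base) auto
    finally have "(v - s) + s \<in> free_vs.span (B \<union> ?E)" using 1 by (intro free_vs.span_add)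
    then show "v \<in> free_vs.span (B \<union> ?E)" by simp
  qed
  then have "free_vs.dim (F 0 k) \<le> card (B \<union> ?E)" by (rule free_vs.dim_le_card) (use finB S in simp)
  also have "\<dots> \<le> card B + card ?E" by (rule card_Un_le)
  also have "card ?E \<le> card S" 
    using card_image_le[OF finite_imageI[OF S], of basis_elt "\<lambda>m. (0, m)"] card_image_le[OF S, of "\<lambda>m. (0::nat, m)"]
    by linarith
  finally show ?thesis unfolding hilbert_eq image_dim_def using B(4) by simp
qed

end

section \<open>The Hilbert series\<close>

text \<open>
  The product of the series for the single exponents, multiplied out.
\<close>

lemma power_box_has_sum:
  fixes t :: real
  assumes "finite A" "0 \<le> t" "\<And>x. x \<in> A \<Longrightarrow> ((\<lambda>k. t ^ k) has_sum S x) (B x)"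
  shows "((\<lambda>g. \<Prod>x\<in>A. t ^ g x) has_sum (\<Prod>x\<in>A. S x)) (PiE A B)"
  using assms(1,3)
proof (induction A rule: finite_induct)
  case empty
  show ?case by (simp add: has_sum_finite_iff)
next
  case (insert x A)
  let ?f = "\<lambda>(y, g). t ^ y * (\<Prod>x\<in>A. t ^ g x)"
  have IH: "((\<lambda>g. \<Prod>x\<in>A. t ^ g x) has_sum (\<Prod>x\<in>A. S x)) (PiE A B)"
    using insert by blast
  have Sx: "((\<lambda>k. t ^ k) has_sum S x) (B x)" using insert.prems by simp
  have in1: "((\<lambda>g. ?f (y, g)) has_sum t ^ y * (\<Prod>x\<in>A. S x)) (PiE A B)" for y
    using has_sum_cmult_right[OF IH, of "t ^ y"] by simp
  have in2: "((\<lambda>y. t ^ y * (\<Prod>x\<in>A. S x)) has_sum S x * (\<Prod>x\<in>A. S x)) (B x)"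
    by (rule has_sum_cmult_left[OF Sx])
  have "?f summable_on (B x \<times> PiE A B)"
  proof (rule summable_on_SigmaI[where g = "\<lambda>y. t ^ y * (\<Prod>x\<in>A. S x)"])
    show "(\<lambda>y. t ^ y * (\<Prod>x\<in>A. S x)) summable_on B x" by (rule has_sum_imp_summable[OF in2])
  qed (use in1 assms(2) in \<open>auto intro!: mult_nonneg_nonneg prod_nonneg\<close>)
  then have "(?f has_sum S x * (\<Prod>x\<in>A. S x)) (B x \<times> PiE A B)"
    by (rule has_sum_SigmaI[where g = "\<lambda>y. t ^ y * (\<Prod>x\<in>A. S x)", rotated 2]) (rule in1, rule in2)
  moreover have "?f z = ((\<lambda>g. \<Prod>x\<in>insert x A. t ^ g x) \<circ> (\<lambda>(y, g). g(x := y))) z" for z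
  proof -
    have "(\<Prod>u\<in>A. t ^ ((snd z)(x := fst z)) u) = (\<Prod>u\<in>A. t ^ (snd z) u)"
      using insert.hyps by (intro prod.cong) auto
    then show ?thesis using insert.hyps by (simp add: case_prod_beta)
  qed
  ultimately have "(((\<lambda>g. \<Prod>x\<in>insert x A. t ^ g x) \<circ> (\<lambda>(y, g). g(x := y))) has_sum S x * (\<Prod>x\<in>A. S x)) (B x \<times> PiE A B)"
    by (subst has_sum_cong[symmetric]) auto
  then have "((\<lambda>g. \<Prod>x\<in>insert x A. t ^ g x) has_sum S x * (\<Prod>x\<in>A. S x)) (PiE (insert x A) B)"
    unfolding PiE_insert_eq by (subst has_sum_reindex) (use insert.hyps in \<open>auto intro!: inj_combinator\<close>)
  then show ?case using insert.hyps by simp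
qed

lemma monomial_box_has_sum:
  fixes t :: real
  assumes "0 \<le> t" "\<And>x::'x::finite. ((\<lambda>k. t ^ k) has_sum S x) (B x)"
  shows "((\<lambda>m. t ^ mdeg m) has_sum (\<Prod>x\<in>UNIV. S x)) {m. \<forall>x. coef m x \<in> B x}"
proof -
  have bij: "bij_betw coef {m :: 'x \<Rightarrow>\<^sub>0 nat. \<forall>x. coef m x \<in> B x} (PiE UNIV B)"
    by (rule bij_betw_byWitness[where f' = Abs_poly_mapping]) auto
  have "t ^ mdeg m = (\<Prod>x\<in>UNIV. t ^ coef m x)" for m :: "'x \<Rightarrow>\<^sub>0 nat"
    unfolding mdeg_def by (rule power_sum)
  then show ?thesis
    using has_sum_reindex_bij_betw[OF bij, of "\<lambda>g. \<Prod>x\<in>UNIV. t ^ g x"] power_box_has_sum[of UNIV t B S, OF _ assms(1)] assms(2) by simp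
qed

lemma geometric_has_sum:
  fixes t :: real
  assumes "0 \<le> t" "t < 1"
  shows "((\<lambda>k. t ^ k) has_sum 1 / (1 - t)) UNIV"
  using assms by (intro sums_nonneg_imp_has_sum geometric_sums) auto

lemma has_sum_by_degree:
  fixes t :: real and deg :: "'z \<Rightarrow> nat"
  assumes s: "((\<lambda>z. t ^ deg z) has_sum S) A" and fin: "\<And>k. finite {z \<in> A. deg z = k}"
  shows "((\<lambda>k. real (card {z \<in> A. deg z = k}) * t ^ k) has_sum S) UNIV"
proof -
  let ?B = "\<lambda>k. {z \<in> A. deg z = k}"
  have bij: "bij_betw snd (SIGMA k:UNIV. ?B k) A"
    by (rule bij_betw_byWitness[where f' = "\<lambda>z. (deg z, z)"]) auto
  have "((\<lambda>z. t ^ deg (snd z)) has_sum S) (SIGMA k:UNIV. ?B k)"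
    using has_sum_reindex_bij_betw[OF bij, of "\<lambda>z. t ^ deg z"] s by simp
  then show ?thesis
  proof (rule has_sum_SigmaD[where A = UNIV and B = ?B and f = "\<lambda>z. t ^ deg (snd z)"])
    fix k
    have "(\<Sum>z\<in>?B k. t ^ deg z) = (\<Sum>z\<in>?B k. t ^ k)" by (rule sum.cong) auto
    then show "((\<lambda>y. t ^ deg (snd (k, y))) has_sum real (card (?B k)) * t ^ k) (?B k)"
      using fin[of k] by (simp add: has_sum_finite_iff)
  qed
qed

lemma piece_generating_function:
  fixes t :: real
  assumes t: "0 \<le> t" "t < 1"
  shows "((\<lambda>k. real (card (piece_index r a k :: (nat \<times> ('x::finite \<Rightarrow>\<^sub>0 nat)) set)) * t ^ k)
    has_sum (\<Sum>q<r. t ^ a q) * (1 / (1 - t)) ^ CARD('x)) UNIV"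
proof -
  let ?G = "(1 / (1 - t)) ^ CARD('x)"
  let ?deg = "\<lambda>z :: nat \<times> ('x \<Rightarrow>\<^sub>0 nat). a (fst z) + mdeg (snd z)"
  have G: "((\<lambda>m :: 'x \<Rightarrow>\<^sub>0 nat. t ^ mdeg m) has_sum ?G) UNIV"
    using monomial_box_has_sum[OF t(1) geometric_has_sum[OF t], where 'x = 'x] by simp
  have in1: "((\<lambda>m. t ^ ?deg (q, m)) has_sum t ^ a q * ?G) UNIV" for q
    using has_sum_cmult_right[OF G, of "t ^ a q"] by (simp add: power_add)
  have in2: "((\<lambda>q. t ^ a q * ?G) has_sum (\<Sum>q<r. t ^ a q) * ?G) {..<r}"
    by (simp add: has_sum_finite_iff sum_distrib_right)
  have "(\<lambda>z. t ^ ?deg z) summable_on ({..<r} \<times> UNIV)"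
  proof (rule summable_on_SigmaI[where g = "\<lambda>q. t ^ a q * ?G"])
    show "(\<lambda>q. t ^ a q * ?G) summable_on {..<r}" by (rule has_sum_imp_summable[OF in2])
  qed (use in1 t in auto)
  then have "((\<lambda>z. t ^ ?deg z) has_sum (\<Sum>q<r. t ^ a q) * ?G) ({..<r} \<times> UNIV)"
    by (rule has_sum_SigmaI[where g = "\<lambda>q. t ^ a q * ?G", rotated 2]) (rule in1, rule in2)
  moreover have eq: "{z \<in> {..<r} \<times> UNIV. ?deg z = k} = piece_index r a k" for k
    by (auto simp: piece_index_def)
  ultimately show ?thesis
    using has_sum_by_degree[of t ?deg "{..<r} \<times> UNIV" "(\<Sum>q<r. t ^ a q) * ?G"] by (simp add: eq finite_piece_index)
qed

lemma sum_UNION_le: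
  fixes f :: "'b \<Rightarrow> real"
  assumes "finite V" "\<And>i. i \<in> V \<Longrightarrow> finite (B i)" "\<And>x. 0 \<le> f x"
  shows "sum f (\<Union>i\<in>V. B i) \<le> (\<Sum>i\<in>V. sum f (B i))"
  using assms(1,2)
proof (induction V rule: finite_induct)
  case (insert i V)
  let ?U = "\<Union>i\<in>V. B i"
  have "sum f (B i \<union> ?U) + sum f (B i \<inter> ?U) = sum f (B i) + sum f ?U"
    using insert by (intro sum.union_inter) auto
  moreover have "0 \<le> sum f (B i \<inter> ?U)" using assms(3) by (rule sum_nonneg)
  ultimately have "sum f (B i \<union> ?U) \<le> sum f (B i) + sum f ?U" by linarith
  then show ?case using insert by simp
qed simp

text \<open>
  The standard monomials are covered by boxes, one for each set \<open>V\<close> of at most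
  \<open>CARD('x) - h\<close> variables, in which the exponents outside \<open>V\<close> are below
  \<open>e\<close>. The sum over a box is a product of geometric series.
\<close>

lemma standard_sum_bound:
  fixes t :: real and X :: "('x::finite \<Rightarrow>\<^sub>0 nat) set"
  assumes t: "0 \<le> t" "t < 1" and X: "finite X" "X \<subseteq> standard h e" and h: "h \<le> CARD('x)"
  shows "(\<Sum>m\<in>X. t ^ mdeg m) \<le> 2 ^ CARD('x) * real (Suc e) ^ CARD('x) * (1 / (1 - t)) ^ (CARD('x) - h)"
proof -
  let ?V = "{V :: 'x set. card V + h \<le> CARD('x)}"
  let ?box = "\<lambda>V. {m :: 'x \<Rightarrow>\<^sub>0 nat. \<forall>x. coef m x \<in> (if x \<in> V then UNIV else {..<e})}"
  let ?g = "1 / (1 - t)"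
  let ?b = "real (Suc e) ^ CARD('x) * ?g ^ (CARD('x) - h)"
  have g1: "1 \<le> ?g" using t by (simp add: field_simps)
  have box: "(\<Sum>m\<in>X \<inter> ?box V. t ^ mdeg m) \<le> ?b" if V: "V \<in> ?V" for V
  proof -
    let ?S = "\<lambda>x. if x \<in> V then ?g else (\<Sum>k<e. t ^ k)"
    have "((\<lambda>k. t ^ k) has_sum ?S x) (if x \<in> V then UNIV else {..<e})" for x
      using geometric_has_sum[OF t] by (simp add: has_sum_finite_iff)
    from monomial_box_has_sum[OF t(1) this]
    have "((\<lambda>m. t ^ mdeg m) has_sum (\<Prod>x\<in>UNIV. ?S x)) (?box V)" .
    then have "(\<Sum>m\<in>X \<inter> ?box V. t ^ mdeg m) \<le> (\<Prod>x\<in>UNIV. ?S x)"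
      by (rule finite_sum_le_has_sum) (use X t in auto)
    also have "\<dots> \<le> (\<Prod>x\<in>UNIV. if x \<in> V then ?g else real (Suc e))"
    proof (rule prod_mono)
      fix x :: 'x
      have "(\<Sum>k<e. t ^ k) \<le> (\<Sum>k<e. 1)" using t by (intro sum_mono power_le_one) auto
      moreover have "0 \<le> (\<Sum>k<e. t ^ k)" using t by (intro sum_nonneg) auto
      ultimately show "0 \<le> ?S x \<and> ?S x \<le> (if x \<in> V then ?g else real (Suc e))"
        using g1 t by auto
    qed
    also have "\<dots> = ?g ^ card V * real (Suc e) ^ card (- V)"
      by (subst prod.If_cases) (auto simp: Compl_eq)
    also have "\<dots> \<le> ?g ^ (CARD('x) - h) * real (Suc e) ^ CARD('x)"
      using V g1 t by (intro mult_mono power_increasing card_mono) auto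
    finally show ?thesis by (simp add: mult.commute)
  qed
  have "X \<subseteq> (\<Union>V\<in>?V. X \<inter> ?box V)"
  proof
    fix m assume m: "m \<in> X"
    let ?W = "{x. e \<le> coef m x}"
    have "?W \<in> ?V" using m X(2) by (auto simp: standard_def)
    moreover have "m \<in> ?box ?W" by auto
    ultimately show "m \<in> (\<Union>V\<in>?V. X \<inter> ?box V)" using m by blast
  qed
  then have "(\<Sum>m\<in>X. t ^ mdeg m) \<le> (\<Sum>m\<in>(\<Union>V\<in>?V. X \<inter> ?box V). t ^ mdeg m)"
    using X t by (intro sum_mono2) auto
  also have "\<dots> \<le> (\<Sum>V\<in>?V. \<Sum>m\<in>X \<inter> ?box V. t ^ mdeg m)"
    using X t by (intro sum_UNION_le) auto
  also have "\<dots> \<le> (\<Sum>V\<in>?V. ?b)" by (intro sum_mono box)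
  also have "\<dots> = real (card ?V) * ?b" by simp
  also have "\<dots> \<le> 2 ^ CARD('x) * ?b"
  proof (rule mult_right_mono)
    have "card ?V \<le> card (UNIV :: 'x set set)" by (intro card_mono) auto
    also have "\<dots> = 2 ^ CARD('x)" unfolding Pow_UNIV[symmetric] by (rule card_Pow) simp
    finally have "real (card ?V) \<le> real (2 ^ CARD('x))" by (rule of_nat_mono)
    then show "real (card ?V) \<le> 2 ^ CARD('x)" by simp
    show "0 \<le> ?b" using t by simp
  qed
  finally show ?thesis by (simp add: mult.assoc)
qed

lemma has_sum_finite_sum:
  fixes f :: "'i \<Rightarrow> 'b \<Rightarrow> real"
  assumes "\<And>i. i \<in> A \<Longrightarrow> (f i has_sum S i) B"
  shows "((\<lambda>x. \<Sum>i\<in>A. f i x) has_sum (\<Sum>i\<in>A. S i)) B"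
  using assms by (induction A rule: infinite_finite_induct) (auto intro: has_sum_add)

context finite_graded_resolution
begin

text \<open>
  The Hilbert series is this polynomial divided by \<open>(1 - t) ^ n\<close>, with \<open>n\<close>
  the number of variables.
\<close>

definition numerator :: "real \<Rightarrow> real" where
  "numerator t = (\<Sum>i\<le>c. (-1) ^ i * (\<Sum>q<rk d i. t ^ a i q))"

lemma hilbert_series:
  fixes t :: real
  assumes t: "0 \<le> t" "t < 1"
  shows "((\<lambda>k. real_of_int (hilbert k) * t ^ k) has_sum numerator t * (1 / (1 - t)) ^ CARD('x)) UNIV"
proof -
  have "((\<lambda>k. \<Sum>i\<le>c. (-1) ^ i * (real (card (piece_index (rk d i) (a i) k :: (nat \<times> ('x \<Rightarrow>\<^sub>0 nat)) set)) * t ^ k))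
      has_sum (\<Sum>i\<le>c. (-1) ^ i * ((\<Sum>q<rk d i. t ^ a i q) * (1 / (1 - t)) ^ CARD('x)))) UNIV"
    by (intro has_sum_finite_sum has_sum_cmult_right piece_generating_function t)
  then show ?thesis
    by (simp add: hilbert_def numerator_def sum_distrib_right mult.assoc)
qed

lemma numerator_bound:
  assumes std: "\<And>p k. (\<And>m. m \<in> keys p \<Longrightarrow> mdeg m = k) \<Longrightarrow>
    \<exists>q\<in>I. keys (p - q) \<subseteq> {m \<in> standard h e. mdeg m = k}" and h: "h \<le> CARD('x)"
  shows "\<exists>C. \<forall>t. 0 \<le> t \<and> t < 1 \<longrightarrow> 0 \<le> numerator t \<and> numerator t \<le> C * (1 - t) ^ h"
proof (intro exI allI impI)
  fix t :: real assume "0 \<le> t \<and> t < 1"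
  then have t: "0 \<le> t" "t < 1" by auto
  let ?n = "CARD('x)"
  let ?C = "2 ^ ?n * real (Suc e) ^ ?n"
  let ?S = "\<lambda>k. {m \<in> standard h e. mdeg m = k} :: ('x \<Rightarrow>\<^sub>0 nat) set"
  have finS: "finite (?S k)" for k by (rule finite_subset[OF _ finite_mdeg_le[of k]]) auto
  note HS = hilbert_series[OF t]
  have "0 \<le> numerator t * (1 / (1 - t)) ^ ?n"
    by (rule has_sum_nonneg[OF HS]) (use hilbert_nonneg t in auto)
  moreover have "0 < (1 / (1 - t)) ^ ?n" using t by simp
  ultimately have "0 \<le> numerator t" by (meson mult_neg_pos not_le)
  moreover have "numerator t * (1 / (1 - t)) ^ ?n \<le> ?C * (1 / (1 - t)) ^ (?n - h)"
  proof (rule has_sum_le_finite_sums[OF HS])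
    fix K :: "nat set" assume K: "finite K"
    have "(\<Sum>k\<in>K. real_of_int (hilbert k) * t ^ k) \<le> (\<Sum>k\<in>K. real (card (?S k)) * t ^ k)"
    proof (intro sum_mono mult_right_mono)
      fix k have "hilbert k \<le> int (card (?S k))" by (rule hilbert_le[OF finS]) (use std in auto)
      then show "real_of_int (hilbert k) \<le> real (card (?S k))" by linarith
    qed (use t in auto)
    also have "\<dots> = (\<Sum>k\<in>K. \<Sum>m\<in>?S k. t ^ mdeg m)"
      by (intro sum.cong refl) (simp add: sum.cong[of "?S _" "?S _" "\<lambda>m. t ^ mdeg m"])
    also have "\<dots> = (\<Sum>m\<in>(\<Union>k\<in>K. ?S k). t ^ mdeg m)"
      using K finS by (intro sum.UNION_disjoint[symmetric]) auto
    also have "\<dots> \<le> ?C * (1 / (1 - t)) ^ (?n - h)"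
      using K finS by (intro standard_sum_bound t h finite_UN_I) auto
    finally show "(\<Sum>k\<in>K. real_of_int (hilbert k) * t ^ k) \<le> ?C * (1 / (1 - t)) ^ (?n - h)" .
  qed
  then have "numerator t * (1 / (1 - t)) ^ ?n * (1 - t) ^ ?n \<le> ?C * (1 / (1 - t)) ^ (?n - h) * (1 - t) ^ ?n"
    by (rule mult_right_mono) (use t in auto)
  moreover have "(1 / (1 - t)) ^ ?n * (1 - t) ^ ?n = 1" using t by (simp add: power_mult_distrib[symmetric])
  moreover have "(1 / (1 - t)) ^ (?n - h) * (1 - t) ^ ?n = (1 - t) ^ h"
  proof -
    have "(1 - t) ^ ?n = (1 - t) ^ (?n - h) * (1 - t) ^ h" using h by (simp add: power_add[symmetric])
    then show ?thesis using t by (simp add: power_divide)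
  qed
  ultimately show "0 \<le> numerator t \<and> numerator t \<le> ?C * (1 - t) ^ h"
    by (simp add: mult.assoc)
qed

end

text \<open>
  A zero of order \<open>h\<close> at 1, expressed by inequalities to the left of 1.
\<close>

lemma (in gorenstein_graded_resolution) numerator_vanishes:
  assumes cod: "codim I = enat h" "h > 0"
  shows "\<exists>C. \<forall>t. 0 \<le> t \<and> t < 1 \<longrightarrow> 0 \<le> numerator t \<and> numerator t \<le> C * (1 - t) ^ h"
proof -
  have hom: "degree_part (\<lambda>_. 1) 0 k p \<in> I" if p: "p \<in> I" for p k
  proof -
    obtain u where u: "p = (\<Sum>j<rk d 1. d 0 $$ (0, j) * u $ j)"
      using p by (auto simp: res_ideal[OF res])
    have "degree_part (\<lambda>_. 1) 0 k p = (\<Sum>j<rk d 1. degree_part (\<lambda>_. 1) (a 0 0) k (d 0 $$ (0, j) * u $ j))"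
      by (simp add: u degree_part_sum a00)
    also have "\<dots> = (\<Sum>j<rk d 1. d 0 $$ (0, j) * degree_part (\<lambda>_. 1) (a 1 j) k (u $ j))"
      using graded[of 0] res_rk0[OF res]
      by (intro sum.cong refl degree_part_homogeneous_mult) (auto simp: graded_mat_def res_dim_col[OF res])
    finally show ?thesis unfolding res_ideal[OF res]
      by (intro bexI[of _ "Matrix.vec (rk d 1) (\<lambda>j. degree_part (\<lambda>_. 1) (a 1 j) k (u $ j))"]) auto
  qed
  have dep: "\<exists>p\<in>I. p \<noteq> 0 \<and> (\<forall>m\<in>keys p. keys m \<subseteq> U)" if "card U + h > CARD('x)" for U
    using codim_bound[OF ideal_I cod, of U] that by (meson not_le)
  obtain e where e: "\<And>p k. (\<And>m. m \<in> keys p \<Longrightarrow> mdeg m = k) \<Longrightarrow>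
    \<exists>q\<in>I. keys (p - q) \<subseteq> {m \<in> standard h e. mdeg m = k}"
    using standard_monomials_span[OF ideal_I hom dep] by blast
  have "p = 0" if "p \<in> I" "\<And>m. m \<in> keys p \<Longrightarrow> keys m \<subseteq> {}" for p
  proof (rule ccontr)
    assume "p \<noteq> 0"
    then obtain m where m: "m \<in> keys p" by (metis ex_in_conv keys_eq_empty)
    then have "m = 0" using that(2) by (metis keys_eq_empty subset_empty)
    then show False using m constant_term_zero[OF that(1)] by (simp add: in_keys_iff)
  qed
  with codim_bound[OF ideal_I cod, of "{}"] have "h \<le> CARD('x)" by simp
  then show ?thesis using numerator_bound[OF e] by blast
qed

section \<open>The minimal number of generators\<close>

context
  fixes I :: "'x::finite cpoly set" and d :: "nat \<Rightarrow> 'x cpoly mat"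
  assumes res: "free_resolution I d"
begin

lemma exact_fun:
  assumes "\<And>p. p < rk d i \<Longrightarrow> (\<Sum>q<rk d (Suc i). d i $$ (p, q) * s q) = 0"
  obtains w where "\<And>q. q < rk d (Suc i) \<Longrightarrow> s q = (\<Sum>l<rk d (Suc (Suc i)). d (Suc i) $$ (q, l) * w l)"
proof -
  let ?v = "Matrix.vec (rk d (Suc i)) s"
  have vc: "?v \<in> carrier_vec (rk d (Suc i))" by simp
  have "(d i *\<^sub>v ?v) $ p = 0" if "p < rk d i" for p
    using assms[OF that] unfolding mult_mat_vec_entry[OF res_carrier[OF res] vc that] by simp
  then have "?v \<in> mat_kernel (d i)" by (auto simp: mat_kernel_iff res_dim_col[OF res] intro!: eq_vecI)
  then obtain u where u: "u \<in> carrier_vec (rk d (Suc (Suc i)))" "?v = d (Suc i) *\<^sub>v u"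
    by (auto simp: res_exact[OF res] mat_image_def res_dim_col[OF res])
  have "s q = (\<Sum>l<rk d (Suc (Suc i)). d (Suc i) $$ (q, l) * u $ l)" if q: "q < rk d (Suc i)" for q
    using arg_cong[OF u(2), of "\<lambda>v. v $ q"] q mult_mat_vec_entry[OF res_carrier[OF res] u(1) q] by simp
  then show ?thesis using that[of "\<lambda>l. u $ l"] by blast
qed

lemma kernel_ct:
  assumes m: "minimal_resolution d"
    and z: "\<And>p. p < rk d i \<Longrightarrow> (\<Sum>q<rk d (Suc i). d i $$ (p, q) * s q) = 0" and q: "q < rk d (Suc i)"
  shows "ct (s q) = 0"
proof -
  obtain w where "s q = (\<Sum>l<rk d (Suc (Suc i)). d (Suc i) $$ (q, l) * w l)"
    using exact_fun[OF z] q by metis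
  then show ?thesis using m q by (simp add: ct_sum ct_mult minimal_entry_ct res_dim_col[OF res])
qed

text \<open>
  Minimal generators are independent modulo the multiples of \<open>I\<close> by variables, because
  the syzygies have no constant terms.
\<close>

lemma generator_coefficients_unique:
  assumes m: "minimal_resolution d"
    and eq: "(\<Sum>j<rk d 1. d 0 $$ (0, j) * s j) = (\<Sum>j<rk d 1. d 0 $$ (0, j) * t j)" and j: "j < rk d 1"
  shows "ct (s j) = ct (t j)"
proof -
  have "(\<Sum>q<rk d (Suc 0). d 0 $$ (p, q) * (s q - t q)) = 0" if "p < rk d 0" for p
    using eq that res_rk0[OF res] by (simp add: right_diff_distrib sum_subtractf)
  from kernel_ct[OF m this, of j] j show ?thesis by (simp add: lookup_minus)
qed

lemma in_ideal_fun: "x \<in> I \<longleftrightarrow> (\<exists>u. x = (\<Sum>j<rk d 1. d 0 $$ (0, j) * u j))"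
proof
  assume "x \<in> I"
  then show "\<exists>u. x = (\<Sum>j<rk d 1. d 0 $$ (0, j) * u j)" unfolding res_ideal[OF res] by blast
next
  assume "\<exists>u. x = (\<Sum>j<rk d 1. d 0 $$ (0, j) * u j)"
  then obtain u where u: "x = (\<Sum>j<rk d 1. d 0 $$ (0, j) * u j)" by blast
  show "x \<in> I" unfolding res_ideal[OF res]
    by (rule bexI[of _ "Matrix.vec (rk d 1) u"]) (simp_all add: u)
qed

lemma generator_in_ideal: "j < rk d 1 \<Longrightarrow> d 0 $$ (0, j) \<in> I"
proof -
  assume j: "j < rk d 1"
  have "d 0 $$ (0, j) = (\<Sum>k<rk d 1. d 0 $$ (0, k) * (if k = j then 1 else 0))"
    using j by (simp add: if_distrib[of "\<lambda>y. _ * y"] cong: if_cong)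
  then show ?thesis unfolding in_ideal_fun by (rule exI[of _ "\<lambda>k. if k = j then 1 else 0"])
qed

text \<open>
  Modulo the variables, rewriting the minimal generators in terms of \<open>G\<close> and back is the
  identity, so \<open>G\<close> is no smaller.
\<close>

lemma min_number_of_generators_eq:
  assumes m: "minimal_resolution d" and I: "is_ideal I"
  shows "min_number_of_generators I = rk d 1"
proof -
  define e where "e j = d 0 $$ (0, j)" for j
  let ?G0 = "e ` {..<rk d 1}"
  have gen0: "genideal class_ring ?G0 = I"
  proof
    show "genideal class_ring ?G0 \<subseteq> I"
      unfolding genideal_def using I generator_in_ideal by (auto simp: ideal_iff e_def)
    show "I \<subseteq> genideal class_ring ?G0"
    proof
      fix x assume "x \<in> I"
      then obtain u where "x = (\<Sum>j<rk d 1. e j * u j)" unfolding in_ideal_fun e_def by blast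
      then show "x \<in> genideal class_ring ?G0"
        unfolding genideal_def by (auto simp: ideal_iff intro!: is_ideal_sum is_ideal_mult(2))
    qed
  qed
  have lower: "rk d 1 \<le> card G" if G: "finite G" "genideal class_ring G = I" for G
  proof -
    have "\<exists>u. g = (\<Sum>j<rk d 1. e j * u j)" if "g \<in> G" for g
    proof -
      have "g \<in> I" using that G(2) unfolding genideal_def by auto
      then show ?thesis unfolding in_ideal_fun e_def .
    qed
    then have "\<forall>g\<in>G. \<exists>u. g = (\<Sum>j<rk d 1. e j * u j)" by (rule ballI)
    from bchoice[OF this] obtain u where u: "\<forall>g\<in>G. g = (\<Sum>j<rk d 1. e j * u g j)" ..
    have "\<forall>j\<in>{..<rk d 1}. \<exists>c. e j = (\<Sum>g\<in>G. c g * g)"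
    proof
      fix j assume "j \<in> {..<rk d 1}"
      then have that: "j < rk d 1" by simp
      have "e j \<in> {\<Sum>g\<in>G. c g * g | c. True}"
        using generator_in_ideal[OF that] unfolding genideal_eq[OF G(1), symmetric] G(2) e_def .
      then show "\<exists>c. e j = (\<Sum>g\<in>G. c g * g)" by blast
    qed
    from bchoice[OF this] obtain c where c: "\<forall>j\<in>{..<rk d 1}. e j = (\<Sum>g\<in>G. c j g * g)" ..
    have "card {..<rk d 1} \<le> card G"
    proof (rule card_le_if_left_inverse[where A = "\<lambda>g j. ct (u g j)" and B = "\<lambda>j g. ct (c j g)"])
      fix q q' assume q: "q \<in> {..<rk d 1}" "q' \<in> {..<rk d 1}"
      have "(\<Sum>j<rk d 1. e j * (\<Sum>g\<in>G. c q g * u g j)) = (\<Sum>g\<in>G. c q g * (\<Sum>j<rk d 1. e j * u g j))"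
        by (simp add: sum_distrib_left mult_ac sum.swap[of _ G])
      also have "\<dots> = (\<Sum>g\<in>G. c q g * g)" 
      proof (rule sum.cong[OF refl])
        fix g assume "g \<in> G"
        then have "(\<Sum>j<rk d 1. e j * u g j) = g" by (rule bspec[OF u, symmetric])
        then show "c q g * (\<Sum>j<rk d 1. e j * u g j) = c q g * g" by (rule arg_cong)
      qed
      also have "\<dots> = e q" using bspec[OF c q(1)] by (rule sym)
      also have "\<dots> = (\<Sum>j<rk d 1. e j * (if q = j then 1 else 0))"
        using q by (simp add: if_distrib[of "\<lambda>y. _ * y"] cong: if_cong)
      finally have "ct (\<Sum>g\<in>G. c q g * u g q') = ct (if q = q' then 1 else 0 :: 'x cpoly)"
        unfolding e_def using q(2)
        by (intro generator_coefficients_unique[OF m, where s = "\<lambda>j. \<Sum>g\<in>G. c q g * u g j" and t = "\<lambda>j. if q = j then 1 else 0"]) auto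
      then show "(\<Sum>g\<in>G. ct (c q g) * ct (u g q')) = (if q = q' then 1 else 0)"
        by (simp add: ct_sum ct_mult split: if_splits)
    qed (use G in auto)
    then show ?thesis by simp
  qed
  have "card ?G0 = rk d 1"
    using lower[OF _ gen0] card_image_le[of "{..<rk d 1}" e] by simp
  then show ?thesis unfolding min_number_of_generators_def
    using gen0 lower by (intro Least_equality) auto
qed

end

section \<open>Hypersurface sections\<close>

text \<open>
  The solutions of one linear equation in three unknowns form at least a plane.
\<close>

lemma no_plane_in_line:
  fixes l1 l2 l3 m1 m2 m3 :: complex
  assumes "\<And>c1 c2 c3. c1 * l1 + c2 * l2 + c3 * l3 = 0 \<Longrightarrow> \<exists>k. c1 = k * m1 \<and> c2 = k * m2 \<and> c3 = k * m3"
  shows False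
proof -
  have 1: "l1 = 0"
  proof (rule ccontr)
    assume n: "l1 \<noteq> 0"
    show False using assms[of l2 "-l1" 0] assms[of l3 0 "-l1"] n by auto
  qed
  have 2: "l2 = 0"
  proof (rule ccontr)
    assume n: "l2 \<noteq> 0"
    show False using assms[of "-l2" l1 0] assms[of 0 l3 "-l2"] n by auto
  qed
  have 3: "l3 = 0"
  proof (rule ccontr)
    assume n: "l3 \<noteq> 0"
    show False using assms[of "-l3" 0 l1] assms[of 0 "-l3" l2] n by auto
  qed
  show False using assms[of 1 0 0] assms[of 0 1 0] 1 2 3 by auto
qed

lemma keys_mult_mdeg:
  assumes "m \<in> keys (p * q)" "\<And>u. u \<in> keys p \<Longrightarrow> k \<le> mdeg u"
  shows "k \<le> mdeg m"
proof -
  obtain u v where "m = u + v" "u \<in> keys p" using keys_mult[of p q] assms(1) by blast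
  then show ?thesis using assms(2)[of u] by (simp add: mdeg_eq_weight)
qed

context gorenstein_graded_resolution
begin

lemma generator_degree:
  assumes "j < rk d 1" "m \<in> keys (d 0 $$ (0, j))"
  shows "mdeg m = a 1 j"
  using graded[of 0] assms res_rk0[OF res] a00
  by (auto simp: graded_mat_def mdeg_eq_weight res_dim_col[OF res])

text \<open>
  The constant terms of \<open>w\<close> are the class of the syzygy \<open>s\<close> in
  \<open>Tor\<^sub>2\<close>. If \<open>s\<close> vanishes in the degree of the \<open>q\<close>-th
  basis vector, then the part of \<open>w\<close> of this degree lies in the kernel of
  \<open>d 1\<close> and has no constant terms.
\<close>

lemma syzygy_low_degree:
  assumes s: "\<And>p. p < rk d 1 \<Longrightarrow> s p = (\<Sum>q<rk d 2. d 1 $$ (p, q) * w q)"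
    and low: "\<And>p m. p < rk d 1 \<Longrightarrow> m \<in> keys (s p) \<Longrightarrow> k < a 1 p + mdeg m"
    and q: "q < rk d 2" "a 2 q \<le> k"
  shows "ct (w q) = 0"
proof -
  let ?k = "a 2 q"
  let ?w = "\<lambda>l. degree_part (\<lambda>_. 1) (a 2 l) ?k (w l)"
  have "(\<Sum>l<rk d (Suc 1). d 1 $$ (p, l) * ?w l) = 0" if p: "p < rk d 1" for p
  proof -
    have "(\<Sum>l<rk d 2. d 1 $$ (p, l) * ?w l) = (\<Sum>l<rk d 2. degree_part (\<lambda>_. 1) (a 1 p) ?k (d 1 $$ (p, l) * w l))"
      using graded[of 1] p
      by (intro sum.cong refl degree_part_homogeneous_mult[symmetric])
         (auto simp: graded_mat_def res_dim_col[OF res] numeral_2_eq_2)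
    also have "\<dots> = degree_part (\<lambda>_. 1) (a 1 p) ?k (s p)" using s[OF p] by (simp add: degree_part_sum)
    also have "\<dots> = 0"
      using low[OF p] q(2) by (intro poly_mapping_eqI) (fastforce simp: coef_degree_part in_keys_iff when_def mdeg_eq_weight)
    finally show ?thesis by (simp add: numeral_2_eq_2)
  qed
  from kernel_ct[OF res minimal this, of q] q(1) have "ct (?w q) = 0" by (simp add: numeral_2_eq_2)
  then show ?thesis by (simp add: coef_degree_part)
qed

text \<open>
  Let \<open>g p\<close> be the minimal generators. For three of them, of degree \<open>e\<close>, consider the Koszul syzygies
  with \<open>f\<close>. They live in degrees \<open>b + e\<close> and above, where \<open>Tor\<^sub>2\<close> has dimension at most 1, so
  their classes satisfy two independent linear relations. Such a relation means that the Koszul syzygy of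
  \<open>f\<close> and some combination \<open>G\<close> of the three generators is trivial in \<open>Tor\<^sub>2\<close>, and it suffices to
  show that \<open>G\<close> is then a multiple of \<open>f\<close> modulo the multiples of \<open>I\<close> by variables.

  To this end write \<open>g p = y p + h p * f\<close> with \<open>y p \<in> J\<close>. Pairing with the coefficients \<open>h p\<close> maps every
  syzygy into \<open>J\<close>, since \<open>f\<close> is a nonzerodivisor modulo \<open>J\<close>; so it maps a syzygy that is trivial in
  \<open>Tor\<^sub>2\<close> to a multiple of \<open>I\<close> by variables. The Koszul syzygy of \<open>f\<close> and \<open>G\<close> is mapped to
  \<open>H * f - G * U\<close> with \<open>U\<close> of constant term 1.
\<close>

lemma not_hypersurface_section:
  assumes J: "is_ideal J" and nzd: "nonzerodivisor_mod J f"
    and JI: "J \<subseteq> I" and fI: "f \<in> I" and dec: "\<And>x. x \<in> I \<Longrightarrow> \<exists>y\<in>J. \<exists>h. x = y + h * f"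
    and deg: "\<And>j. j < rk d 1 \<Longrightarrow> b \<le> a 1 j"
    and T: "j1 < rk d 1" "j2 < rk d 1" "j3 < rk d 1" "a 1 j1 = e" "a 1 j2 = e" "a 1 j3 = e"
      "j1 \<noteq> j2" "j1 \<noteq> j3" "j2 \<noteq> j3"
    and top: "\<And>q q'. q < rk d 2 \<Longrightarrow> q' < rk d 2 \<Longrightarrow> b + e \<le> a 2 q \<Longrightarrow> b + e \<le> a 2 q' \<Longrightarrow> q = q'"
  shows False
proof -
  define g where "g j = d 0 $$ (0, j)" for j
  have fin: "x \<in> I \<longleftrightarrow> (\<exists>u. x = (\<Sum>j<rk d 1. g j * u j))" for x
    unfolding g_def by (rule in_ideal_fun[OF res])
  obtain u where u: "f = (\<Sum>p<rk d 1. g p * u p)" using fI unfolding fin by blast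
  have "\<forall>p\<in>{..<rk d 1}. \<exists>h. g p - h * f \<in> J"
  proof
    fix p assume "p \<in> {..<rk d 1}"
    then obtain y h where "y \<in> J" "g p = y + h * f"
      using dec[OF generator_in_ideal[OF res]] unfolding g_def by blast
    then have "g p - h * f \<in> J" by simp
    then show "\<exists>h. g p - h * f \<in> J" ..
  qed
  from bchoice[OF this] obtain h where h: "\<forall>p\<in>{..<rk d 1}. g p - h p * f \<in> J" ..
  define y where "y p = g p - h p * f" for p
  have yJ: "y p \<in> J" if "p \<in> {..<rk d 1}" for p using h that unfolding y_def by blast
  have gy: "g p = y p + h p * f" for p by (simp add: y_def)
  have split: "(\<Sum>p<rk d 1. (y p + h p * f) * s p) = (\<Sum>p<rk d 1. y p * s p) + f * (\<Sum>p<rk d 1. h p * s p)" for s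
  proof -
    have "(y p + h p * f) * s p = y p * s p + f * (h p * s p)" for p by (simp add: algebra_simps)
    then show ?thesis by (simp only: sum.distrib sum_distrib_left)
  qed
  define U where "U = (\<Sum>p<rk d 1. h p * u p)"
  have cancel: "x \<in> J" if "f * x \<in> J" for x using nzd that by (simp add: nonzerodivisor_mod_def)
  have phi: "(\<Sum>p<rk d 1. h p * s p) \<in> J" if z: "(\<Sum>p<rk d 1. g p * s p) = 0" for s
  proof (rule cancel)
    have "0 = (\<Sum>p<rk d 1. (y p + h p * f) * s p)" unfolding z[symmetric] gy ..
    also have "\<dots> = (\<Sum>p<rk d 1. y p * s p) + f * (\<Sum>p<rk d 1. h p * s p)" by (rule split)
    finally have "f * (\<Sum>p<rk d 1. h p * s p) = 0 - (\<Sum>p<rk d 1. y p * s p)" by (simp add: eq_neg_iff_add_eq_0 add.commute)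
    also have "\<dots> \<in> J"
      by (intro yJ is_ideal_diff[OF J] is_ideal_zero[OF J] is_ideal_sum[OF J] is_ideal_mult(2)[OF J])
    finally show "f * (\<Sum>p<rk d 1. h p * s p) \<in> J" .
  qed
  have "1 - U \<in> J"
  proof (rule cancel)
    have "(\<Sum>p<rk d 1. (y p + h p * f) * u p) = (\<Sum>p<rk d 1. y p * u p) + f * U"
      unfolding U_def by (rule split)
    moreover have "(\<Sum>p<rk d 1. (y p + h p * f) * u p) = f" unfolding gy[symmetric] by (rule u[symmetric])
    ultimately have "f * (1 - U) = (\<Sum>p<rk d 1. y p * u p)" by (simp add: right_diff_distrib diff_eq_eq)
    also have "\<dots> \<in> J" by (intro yJ is_ideal_sum[OF J] is_ideal_mult(2)[OF J])
    finally show "f * (1 - U) \<in> J" .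
  qed
  then have "ct (1 - U) = 0" using JI constant_term_zero by blast
  then have ctU: "ct U = 1" by (simp add: lookup_minus)
  have f_deg: "b \<le> mdeg m" if mf: "m \<in> keys f" for m
  proof -
    obtain p where p: "p < rk d 1" "m \<in> keys (g p * u p)"
      using mf keys_sum[of "\<lambda>p. g p * u p" "{..<rk d 1}"] unfolding u by blast
    show ?thesis
      by (rule keys_mult_mdeg[OF p(2)]) (use generator_degree[OF p(1)] deg[OF p(1)] in \<open>auto simp: g_def\<close>)
  qed
  \<comment> \<open>the Koszul syzygy of \<open>f\<close> and \<open>g j\<close>\<close>
  define s where "s j p = (if p = j then f else 0) - g j * u p" for j p
  have s_ker: "(\<Sum>p<rk d 1. g p * s j p) = 0" if "j < rk d 1" for j
  proof -
    have "(\<Sum>p<rk d 1. g p * s j p) = (\<Sum>p<rk d 1. g p * (if p = j then f else 0)) - g j * (\<Sum>p<rk d 1. g p * u p)"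
      by (simp add: s_def right_diff_distrib sum_subtractf sum_distrib_left mult_ac)
    also have "(\<Sum>p<rk d 1. g p * (if p = j then f else 0)) = g j * f"
      using that by (simp add: if_distrib[of "\<lambda>y. _ * y"] cong: if_cong)
    finally show ?thesis unfolding u[symmetric] by simp
  qed
  have "\<forall>j\<in>{..<rk d 1}. \<exists>w. \<forall>p<rk d 1. s j p = (\<Sum>q<rk d 2. d 1 $$ (p, q) * w q)"
  proof
    fix j assume "j \<in> {..<rk d 1}"
    then have j: "j < rk d 1" by simp
    have "(\<Sum>q<rk d (Suc 0). d 0 $$ (p, q) * s j q) = 0" if "p < rk d 0" for p
      using s_ker[OF j] that res_rk0[OF res] by (simp add: g_def)
    from exact_fun[OF res this] obtain w where
      "\<And>q. q < rk d (Suc 0) \<Longrightarrow> s j q = (\<Sum>l<rk d (Suc (Suc 0)). d (Suc 0) $$ (q, l) * w l)" by blast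
    then show "\<exists>w. \<forall>p<rk d 1. s j p = (\<Sum>q<rk d 2. d 1 $$ (p, q) * w q)"
      by (intro exI[of _ w]) (simp add: numeral_2_eq_2)
  qed
  from bchoice[OF this] obtain w where
    "\<forall>j\<in>{..<rk d 1}. \<forall>p<rk d 1. s j p = (\<Sum>q<rk d 2. d 1 $$ (p, q) * w j q)" ..
  then have w: "s j p = (\<Sum>q<rk d 2. d 1 $$ (p, q) * w j q)" if "j < rk d 1" "p < rk d 1" for j p
    using that by blast
  have be: "0 < b + e"
    using degree_lower[of j1 0] T(1,4) by simp
  have w_low: "ct (w j q) = 0" if j: "j < rk d 1" "a 1 j = e" and q: "q < rk d 2" "a 2 q < b + e" for j q
  proof (rule syzygy_low_degree[where s = "s j" and w = "w j" and k = "b + e - 1" and q = q])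
    fix p m assume p: "p < rk d 1" and m: "m \<in> keys (s j p)"
    have "m \<in> keys (if p = j then f else 0) \<or> m \<in> keys (g j * u p)"
      using m by (auto simp: s_def in_keys_iff lookup_minus)
    then have "b + e \<le> a 1 p + mdeg m"
    proof
      assume "m \<in> keys (if p = j then f else 0)"
      then show ?thesis using f_deg[of m] j by (auto split: if_splits)
    next
      assume "m \<in> keys (g j * u p)"
      then have "e \<le> mdeg m"
        by (rule keys_mult_mdeg) (use generator_degree[OF j(1)] j(2) in \<open>auto simp: g_def\<close>)
      then show ?thesis using deg[OF p] by simp
    qed
    then show "b + e - 1 < a 1 p + mdeg m" using be by linarith
  next
    show "a 2 q \<le> b + e - 1" using q(2) be by linarith
  qed (use w j q in auto)
  have "\<exists>q0. \<forall>q<rk d 2. b + e \<le> a 2 q \<longrightarrow> q = q0"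
    using top by (cases "\<exists>q<rk d 2. b + e \<le> a 2 q") blast+
  then obtain q0 where q0: "\<And>q. q < rk d 2 \<Longrightarrow> b + e \<le> a 2 q \<Longrightarrow> q = q0" by blast
  have "\<forall>q\<in>{..<rk d 2}. \<exists>z. (\<Sum>p<rk d 1. h p * d 1 $$ (p, q)) = (\<Sum>p<rk d 1. g p * z p)"
  proof
    fix q assume "q \<in> {..<rk d 2}"
    then have q: "q < rk d 2" by simp
    have q': "q < rk d (Suc (Suc 0))" using q by (simp only: numeral_2_eq_2)
    have r0: "0 < rk d 0" using res_rk0[OF res] by simp
    have "(d 0 * d (Suc 0)) $$ (0, q) = 0"
      unfolding res_dd[OF res, of 0] using q' r0 by (rule index_zero_mat(1)[rotated])
    then have "(\<Sum>p<rk d 1. g p * d 1 $$ (p, q)) = 0"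
      unfolding mult_mat_entry[OF res_carrier[OF res] res_carrier[OF res] r0 q'] g_def One_nat_def .
    from phi[OF this] have "(\<Sum>p<rk d 1. h p * d 1 $$ (p, q)) \<in> I" using JI by (rule rev_subsetD)
    then show "\<exists>z. (\<Sum>p<rk d 1. h p * d 1 $$ (p, q)) = (\<Sum>p<rk d 1. g p * z p)" unfolding fin .
  qed
  from bchoice[OF this] obtain z where
    z: "\<forall>q\<in>{..<rk d 2}. (\<Sum>p<rk d 1. h p * d 1 $$ (p, q)) = (\<Sum>p<rk d 1. g p * z q p)" ..
  let ?T = "{j1, j2, j3}"
  have key: "\<exists>\<kappa>. \<forall>p\<in>?T. c p = \<kappa> * ct (u p)" if c: "(\<Sum>j\<in>?T. c j * ct (w j q0)) = 0" for c :: "nat \<Rightarrow> complex"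
  proof -
    have Tr: "j < rk d 1" "a 1 j = e" if "j \<in> ?T" for j using that T by auto
    define H where "H = (\<Sum>j\<in>?T. single 0 (c j) * h j)"
    \<comment> \<open>the combination of the Koszul syzygies with coefficients \<open>c\<close>, in terms of \<open>d 1\<close>\<close>
    define W where "W q = (\<Sum>j\<in>?T. single 0 (c j) * w j q)" for q
    define c' where "c' p = (if p \<in> ?T then c p else 0)" for p
    have ctW: "ct (W q) = 0" if q: "q < rk d 2" for q
    proof (cases "a 2 q < b + e")
      case True
      then have "ct (w j q) = 0" if "j \<in> ?T" for j using w_low Tr[OF that] q by blast
      then show ?thesis by (simp only: W_def ct_sum coef_const_mult) (simp add: sum.neutral)
    next
      case False
      then have "q = q0" using q0 q by simp
      then show ?thesis using c by (simp only: W_def ct_sum coef_const_mult)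
    qed
    have comb: "(\<Sum>j\<in>?T. single 0 (c j) * s j p) = single 0 (c' p) * f - (\<Sum>j\<in>?T. single 0 (c j) * g j) * u p" for p
    proof -
      have "(\<Sum>j\<in>?T. single 0 (c j) * s j p) = (\<Sum>j\<in>?T. single 0 (c j) * (if p = j then f else 0)) - (\<Sum>j\<in>?T. single 0 (c j) * g j) * u p"
        by (simp only: s_def right_diff_distrib sum_subtractf sum_distrib_right mult.assoc)
      also have "(\<Sum>j\<in>?T. single 0 (c j) * (if p = j then f else 0)) = single 0 (c' p) * f"
        unfolding c'_def by (simp add: if_distrib[of "\<lambda>y. _ * y"] cong: if_cong)
      finally show ?thesis .
    qed
    have G: "(\<Sum>j\<in>?T. single 0 (c j) * g j) = (\<Sum>p<rk d 1. g p * single 0 (c' p))"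
    proof -
      have "(\<Sum>p<rk d 1. g p * single 0 (c' p)) = (\<Sum>p\<in>?T. g p * single 0 (c' p))"
        using Tr(1) by (intro sum.mono_neutral_right) (auto simp: c'_def)
      also have "\<dots> = (\<Sum>j\<in>?T. single 0 (c j) * g j)"
        by (intro sum.cong) (auto simp: c'_def mult.commute)
      finally show ?thesis ..
    qed
    let ?G = "\<Sum>j\<in>?T. single 0 (c j) * g j"
    have "(\<Sum>p<rk d 1. h p * (\<Sum>j\<in>?T. single 0 (c j) * s j p))
        = (\<Sum>p<rk d 1. h p * (\<Sum>q<rk d 2. d 1 $$ (p, q) * W q))"
    proof (rule sum.cong[OF refl])
      fix p assume "p \<in> {..<rk d 1}"
      then have "(\<Sum>j\<in>?T. single 0 (c j) * s j p) = (\<Sum>j\<in>?T. single 0 (c j) * (\<Sum>q<rk d 2. d 1 $$ (p, q) * w j q))"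
        using w Tr(1) by (intro sum.cong) auto
      also have "\<dots> = (\<Sum>j\<in>?T. \<Sum>q<rk d 2. d 1 $$ (p, q) * (single 0 (c j) * w j q))"
        by (simp only: sum_distrib_left mult.left_commute)
      also have "\<dots> = (\<Sum>q<rk d 2. d 1 $$ (p, q) * W q)"
        unfolding W_def sum_distrib_left by (rule sum.swap)
      finally show "h p * (\<Sum>j\<in>?T. single 0 (c j) * s j p) = h p * (\<Sum>q<rk d 2. d 1 $$ (p, q) * W q)"
        by (rule arg_cong)
    qed
    also have "\<dots> = (\<Sum>q<rk d 2. W q * (\<Sum>p<rk d 1. h p * d 1 $$ (p, q)))"
      unfolding sum_distrib_left by (subst sum.swap) (simp only: mult_ac)
    also have "\<dots> = (\<Sum>q<rk d 2. W q * (\<Sum>p<rk d 1. g p * z q p))"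
      using z by (intro sum.cong) auto
    also have "\<dots> = (\<Sum>p<rk d 1. g p * (\<Sum>q<rk d 2. W q * z q p))"
      unfolding sum_distrib_left by (subst sum.swap) (simp only: mult_ac)
    \<comment> \<open>the pairing with \<open>h\<close>, computed through \<open>d 1\<close>: the coefficients of the \<open>g p\<close> have no constant terms\<close>
    finally have R: "(\<Sum>p<rk d 1. h p * (\<Sum>j\<in>?T. single 0 (c j) * s j p)) = (\<Sum>p<rk d 1. g p * (\<Sum>q<rk d 2. W q * z q p))" .
    have "(\<Sum>p<rk d 1. h p * (\<Sum>j\<in>?T. single 0 (c j) * s j p)) = (\<Sum>p<rk d 1. h p * single 0 (c' p)) * f - ?G * U"
    proof -
      have "h p * (x * f - y * u p) = (h p * x) * f - y * (h p * u p)" for p x y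
        by (simp add: algebra_simps)
      then show ?thesis
        unfolding comb U_def by (simp only: sum_subtractf sum_distrib_left[of ?G] sum_distrib_right[of _ _ f])
    qed
    also have "(\<Sum>p<rk d 1. h p * single 0 (c' p)) = H"
    proof -
      have "(\<Sum>p<rk d 1. h p * single 0 (c' p)) = (\<Sum>p\<in>?T. h p * single 0 (c' p))"
        using Tr(1) by (intro sum.mono_neutral_right) (auto simp: c'_def)
      also have "\<dots> = H" unfolding H_def by (intro sum.cong) (auto simp: c'_def mult.commute)
      finally show ?thesis .
    qed
    also have "H * f = (\<Sum>p<rk d 1. g p * (u p * H))"
      by (subst u) (simp add: sum_distrib_left mult_ac)
    also have "?G * U = (\<Sum>p<rk d 1. g p * (single 0 (c' p) * U))"
      unfolding G sum_distrib_right by (simp only: mult.assoc)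
    also have "(\<Sum>p<rk d 1. g p * (u p * H)) - (\<Sum>p<rk d 1. g p * (single 0 (c' p) * U))
        = (\<Sum>p<rk d 1. g p * (u p * H - single 0 (c' p) * U))"
      by (simp only: sum_subtractf[symmetric] right_diff_distrib)
    \<comment> \<open>the same pairing, computed from the definition of the Koszul syzygies\<close>
    finally have L: "(\<Sum>p<rk d 1. g p * (\<Sum>q<rk d 2. W q * z q p)) = (\<Sum>p<rk d 1. g p * (u p * H - single 0 (c' p) * U))"
      unfolding R .
    have "c p = ct H * ct (u p)" if p: "p \<in> ?T" for p
    proof -
      have "ct (\<Sum>q<rk d 2. W q * z q p) = ct (u p * H - single 0 (c' p) * U)"
        by (rule generator_coefficients_unique[OF res minimal L[unfolded g_def] Tr(1)[OF p]])
      moreover have "ct (\<Sum>q<rk d 2. W q * z q p) = 0" using ctW by (simp add: ct_sum ct_mult)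
      ultimately have "ct (u p) * ct H = c' p" by (simp add: lookup_minus ct_mult coef_const_mult ctU)
      then show ?thesis using p by (simp add: c'_def mult.commute)
    qed
    then show ?thesis by blast
  qed
  show False
  proof (rule no_plane_in_line)
    fix c1 c2 c3 assume c: "c1 * ct (w j1 q0) + c2 * ct (w j2 q0) + c3 * ct (w j3 q0) = 0"
    define c where "c j = (if j = j1 then c1 else if j = j2 then c2 else c3)" for j
    have cj: "c j1 = c1" "c j2 = c2" "c j3 = c3" using T by (auto simp: c_def)
    have "(\<Sum>j\<in>?T. c j * ct (w j q0)) = 0" using c T(7,8,9) by (simp add: cj add.assoc)
    from key[OF this] show "\<exists>k. c1 = k * ct (u j1) \<and> c2 = k * ct (u j2) \<and> c3 = k * ct (u j3)"
      by (auto simp: cj)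
  qed
qed

end

section \<open>Betti tables of type [310]\<close>

lemma bounded_by_power_vanishes:
  fixes f :: "real \<Rightarrow> real"
  assumes f: "continuous (at 1) f" and n: "n > 0"
    and b: "\<And>t. 0 \<le> t \<Longrightarrow> t < 1 \<Longrightarrow> 0 \<le> f t \<and> f t \<le> C * (1 - t) ^ n"
  shows "f 1 = 0"
proof -
  have ev: "eventually (\<lambda>t::real. 0 \<le> t \<and> t < 1) (at_left 1)"
    unfolding eventually_at_left_field by (intro exI[of _ 0]) auto
  have f1: "(f \<longlongrightarrow> f 1) (at_left 1)"
    using f by (auto simp: continuous_def intro: tendsto_within_subset)
  have "((\<lambda>t. C * (1 - t) ^ n) \<longlongrightarrow> C * (1 - 1) ^ n) (at_left 1)"
    by (intro tendsto_intros)
  then have g: "((\<lambda>t. C * (1 - t) ^ n) \<longlongrightarrow> 0) (at_left 1)" using n by (simp add: power_0_left)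
  have "(f \<longlongrightarrow> 0) (at_left 1)"
    by (rule tendsto_sandwich[OF _ _ tendsto_const g]) (use ev b in \<open>auto elim: eventually_mono\<close>)
  with f1 show ?thesis by (rule tendsto_unique[rotated]) simp
qed

text \<open>
  The value at 1 determines \<open>\<gamma>\<close>; the polynomial is then
  \<open>(1 - t)\<^sup>2\<close> times one whose value at 1 is \<open>5 - \<beta>\<close>.
\<close>

lemma palindromic_numerator:
  fixes \<beta> \<gamma> C :: real
  assumes b: "\<And>t. 0 \<le> t \<Longrightarrow> t < 1 \<Longrightarrow>
      0 \<le> 1 - 3 * t^2 + (1 - \<beta>) * t^3 + \<gamma> * t^4 + (1 - \<beta>) * t^5 - 3 * t^6 + t^8 \<and>
      1 - 3 * t^2 + (1 - \<beta>) * t^3 + \<gamma> * t^4 + (1 - \<beta>) * t^5 - 3 * t^6 + t^8 \<le> C * (1 - t) ^ 4"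
  shows "\<beta> = 5"
proof -
  let ?K = "\<lambda>t. 1 - 3 * t^2 + (1 - \<beta>) * t^3 + \<gamma> * t^4 + (1 - \<beta>) * t^5 - 3 * t^6 + t^8"
  have "?K 1 = 0"
  proof (rule bounded_by_power_vanishes[where f = ?K and n = 4 and C = C])
    show "continuous (at 1) ?K" by (intro continuous_intros)
    show "0 \<le> ?K t \<and> ?K t \<le> C * (1 - t) ^ 4" if "0 \<le> t" "t < 1" for t by (rule b[OF that])
  qed simp
  then have \<gamma>: "\<gamma> = 2 * \<beta> + 2" by simp
  let ?Q = "\<lambda>t. 1 + 2 * t - (1 + \<beta>) * t^3 + 2 * t^5 + t^6"
  \<comment> \<open>the coefficients of the quotient are the twice iterated partial sums of those of \<open>?K\<close>\<close>
  have KQ: "?K t = (1 - t)^2 * ?Q t" for t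
    unfolding \<gamma> by (simp add: power2_eq_square algebra_simps eval_nat_numeral)
  have "?Q 1 = 0"
  proof (rule bounded_by_power_vanishes[where f = ?Q and n = 2 and C = C])
    fix t :: real assume t: "0 \<le> t" "t < 1"
    have p: "0 < (1 - t)^2" using t by simp
    have "C * (1 - t) ^ 4 = (1 - t)^2 * (C * (1 - t)^2)"
      by (simp add: power2_eq_square eval_nat_numeral)
    then have "0 \<le> (1 - t)^2 * ?Q t" "(1 - t)^2 * ?Q t \<le> (1 - t)^2 * (C * (1 - t)^2)"
      using b[OF t] unfolding KQ by (simp_all only:)
    then show "0 \<le> ?Q t \<and> ?Q t \<le> C * (1 - t)^2"
      unfolding mult_le_cancel_left_pos[OF p] using p by (meson mult_pos_neg not_le)
  next
    show "continuous (at 1) ?Q" by (intro continuous_intros)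
  qed simp
  then show ?thesis by simp
qed

text \<open>
  Basis vectors of \<open>F i\<close> have degree at least \<open>i + 1\<close> for
  \<open>i > 0\<close> and at most \<open>i + 4\<close>. With the symmetry only the graded ranks
  \<open>\<beta>\<close> in position 1, degree 3 and \<open>\<gamma>\<close> in position 2, degree 4
  remain to be determined, and the numerator of the Hilbert series is palindromic.
\<close>

lemma (in gorenstein_graded_resolution) type_310:
  assumes c4: "c = 4" and cod: "codim I = enat 4"
    and lin: "\<forall>p\<in>I. homogeneous 1 p \<longrightarrow> p = 0"
    and reg: "\<And>i j. graded_rank d a i j \<noteq> 0 \<Longrightarrow> int j - int i \<le> 4"
    and reg_attained: "\<exists>i j. graded_rank d a i j \<noteq> 0 \<and> int j - int i = 4"
    and b12: "graded_rank d a 1 2 = 3" and b23: "graded_rank d a 2 3 = 1" and b34: "graded_rank d a 3 4 = 0"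
  shows "graded_rank d a 1 3 = 5" "rk d 1 = 8" "\<And>j. j < rk d 1 \<Longrightarrow> 2 \<le> a 1 j"
    "card {q. q < rk d 2 \<and> 5 \<le> a 2 q} = 1"
proof -
  have rk0: "rk d 0 = 1" and rk4: "rk d 4 = 1" using res_rk0[OF res] last_rank c4 by auto
  show l1: "2 \<le> a 1 j" if j: "j < rk d 1" for j
  proof -
    have "a 1 j \<noteq> 1"
    proof
      assume "a 1 j = 1"
      then have "homogeneous 1 (d 0 $$ (0, j))" using generator_degree[OF j] by (simp add: homogeneous_def)
      then have "d 0 $$ (0, j) = 0" using lin generator_in_ideal[OF res j] by blast
      moreover obtain p where "p < rk d 0" "d 0 $$ (p, j) \<noteq> 0"
        using minimal_column_nonzero[OF res minimal, of j 0] j by auto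
      ultimately show False using rk0 by simp
    qed
    then show ?thesis using degree_lower[of j 0] j by simp
  qed
  have step: "\<exists>p<rk d i. a i p < a (Suc i) q" if "q < rk d (Suc i)" for i q
    using minimal_column_nonzero[OF res minimal that] degree_step[OF _ that] by metis
  have l2: "3 \<le> a 2 q" if "q < rk d 2" for q
    using step[of q 1] l1 that by (fastforce simp: numeral_2_eq_2)
  have l3: "4 \<le> a 3 q" if "q < rk d 3" for q
    using step[of q 2] l2 that by (fastforce simp: numeral_3_eq_3)
  have graded_rank_pos: "graded_rank d a i (a i q) \<noteq> 0" if "q < rk d i" for i q
    using that by (auto simp: graded_rank_def card_eq_0_iff)
  have graded_rank_ex: "\<exists>q<rk d i. a i q = j" if "graded_rank d a i j \<noteq> 0" for i j
  proof (rule ccontr)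
    assume "\<not> ?thesis"
    then have "{q. q < rk d i \<and> a i q = j} = {}" by blast
    then show False using that by (simp add: graded_rank_def)
  qed
  have up: "a i q \<le> i + 4" if "q < rk d i" for i q using reg[OF graded_rank_pos[OF that]] by linarith
  have socle: "a 4 0 = 8"
  proof (rule antisym)
    show "a 4 0 \<le> 8" using up[of 0 4] rk4 by simp
    obtain i j where ij: "graded_rank d a i j \<noteq> 0" "int j - int i = 4" using reg_attained by blast
    \<comment> \<open>a basis vector of \<open>F i\<close> of degree \<open>i + 4\<close> forces degree at least 8 at the end of the resolution\<close>
    obtain q where q: "q < rk d i" "a i q = j" using graded_rank_ex[OF ij(1)] by blast
    have "i \<le> 4" using finite_length[of i] q(1) c4 by (cases "i \<le> 4") auto
    then have "a i q + (4 - i) \<le> a 4 0" using degree_upper[of i q] q(1) c4 by simp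
    moreover have "a i q = i + 4" using q(2) ij(2) by linarith
    ultimately show "8 \<le> a 4 0" using \<open>i \<le> 4\<close> by linarith
  qed
  have sym: "graded_rank d a i j = graded_rank d a (4 - i) (8 - j)" if "i \<le> 4" "j \<le> 8" for i j
    using betti_symmetry[of i j] that c4 socle by simp
  have z: "graded_rank d a i j = 0" if "\<And>q. q < rk d i \<Longrightarrow> a i q \<noteq> j" for i j
    using graded_rank_ex[of i j] that by blast
  have n0: "graded_rank d a 0 j = (if j = 0 then 1 else 0)" for j
  proof -
    have "{q. q < rk d 0 \<and> a 0 q = j} = (if j = 0 then {0} else {})" using rk0 a00 by auto
    then show ?thesis by (simp add: graded_rank_def)
  qed
  have n4: "graded_rank d a 4 j = (if j = 8 then 1 else 0)" for j
  proof -
    have "{q. q < rk d 4 \<and> a 4 q = j} = (if j = 8 then {0} else {})" using rk4 socle by auto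
    then show ?thesis by (simp add: graded_rank_def)
  qed
  define \<beta> where "\<beta> = graded_rank d a 1 3"
  define \<gamma> where "\<gamma> = graded_rank d a 2 4"
  have n3_lo: "graded_rank d a 3 j = 0" if "j < 4" for j using z[of 3 j] l3 that by fastforce
  have n2_lo: "graded_rank d a 2 j = 0" if "j < 3" for j using z[of 2 j] l2 that by fastforce
  have n1_lo: "graded_rank d a 1 j = 0" if "j < 2" for j using z[of 1 j] l1 that by fastforce
  have hi: "graded_rank d a i j = 0" if "j > i + 4" for i j using z[of i j] up that by fastforce
  have n1: "graded_rank d a 1 4 = 0" "graded_rank d a 1 5 = 0" using sym[of 1 4] sym[of 1 5] b34 n3_lo[of 3] by auto
  have n2: "graded_rank d a 2 5 = 1" "graded_rank d a 2 6 = 0" using sym[of 2 5] sym[of 2 6] b23 n2_lo[of 2] by auto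
  have n3: "graded_rank d a 3 5 = \<beta>" "graded_rank d a 3 6 = 3" "graded_rank d a 3 7 = 0"
    using sym[of 3 5] sym[of 3 6] sym[of 3 7] b12 n1_lo[of 1] by (auto simp: \<beta>_def)
  have by_degree: "(\<Sum>q<rk d i. t ^ a i q) = (\<Sum>j\<le>8. real (graded_rank d a i j) * t ^ j)" if i: "i \<le> 4" for i and t :: real
  proof -
    have "(\<Sum>q<rk d i. t ^ a i q) = (\<Sum>j\<le>8. \<Sum>q\<in>{q \<in> {..<rk d i}. a i q = j}. t ^ a i q)"
      using up i by (intro sum.group[symmetric]) fastforce+
    also have "\<dots> = (\<Sum>j\<le>8. real (graded_rank d a i j) * t ^ j)"
    proof (rule sum.cong[OF refl])
      fix j
      have "(\<Sum>q\<in>{q \<in> {..<rk d i}. a i q = j}. t ^ a i q) = (\<Sum>q\<in>{q \<in> {..<rk d i}. a i q = j}. t ^ j)"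
        by (rule sum.cong) auto
      then show "(\<Sum>q\<in>{q \<in> {..<rk d i}. a i q = j}. t ^ a i q) = real (graded_rank d a i j) * t ^ j"
        by (simp add: graded_rank_def)
    qed
    finally show ?thesis .
  qed
  have sum8: "(\<Sum>j\<le>8. f j) = f 0 + f 1 + f 2 + f 3 + f 4 + f 5 + f 6 + f 7 + f 8" for f :: "nat \<Rightarrow> real"
    by (simp add: eval_nat_numeral)
  have s0: "(\<Sum>q<rk d 0. t ^ a 0 q) = 1" for t :: real
    using by_degree[of 0 t] unfolding sum8 by (simp add: n0)
  have s1: "(\<Sum>q<rk d 1. t ^ a 1 q) = 3 * t^2 + real \<beta> * t^3" for t :: real
    using by_degree[of 1 t] unfolding sum8 by (simp add: n1_lo n1 hi b12 \<beta>_def[symmetric] del: One_nat_def)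
  have s2: "(\<Sum>q<rk d 2. t ^ a 2 q) = t^3 + real \<gamma> * t^4 + t^5" for t :: real
    using by_degree[of 2 t] unfolding sum8 by (simp add: n2_lo n2 hi b23 \<gamma>_def[symmetric])
  have s3: "(\<Sum>q<rk d 3. t ^ a 3 q) = real \<beta> * t^5 + 3 * t^6" for t :: real
    using by_degree[of 3 t] unfolding sum8 by (simp add: n3_lo n3 hi b34)
  have s4: "(\<Sum>q<rk d 4. t ^ a 4 q) = t^8" for t :: real
    using by_degree[of 4 t] unfolding sum8 by (simp add: n4)
  have num: "numerator t = 1 - 3 * t^2 + (1 - real \<beta>) * t^3 + real \<gamma> * t^4 + (1 - real \<beta>) * t^5 - 3 * t^6 + t^8" for t
  proof -
    have "{..4::nat} = {0, 1, 2, 3, 4}" by auto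
    then have "numerator t = (\<Sum>q<rk d 0. t ^ a 0 q) - (\<Sum>q<rk d 1. t ^ a 1 q) + (\<Sum>q<rk d 2. t ^ a 2 q)
        - (\<Sum>q<rk d 3. t ^ a 3 q) + (\<Sum>q<rk d 4. t ^ a 4 q)"
      unfolding numerator_def unfolding c4 by simp
    then show ?thesis unfolding s0 s1 s2 s3 s4 by (simp add: algebra_simps)
  qed
  obtain C where "\<And>t. 0 \<le> t \<Longrightarrow> t < 1 \<Longrightarrow> 0 \<le> numerator t \<and> numerator t \<le> C * (1 - t) ^ 4"
    using numerator_vanishes[OF cod] by auto
  then have "real \<beta> = 5" unfolding num by (rule palindromic_numerator)
  then show beta: "graded_rank d a 1 3 = 5" by (simp add: \<beta>_def)
  have "real (rk d 1) = 3 + real \<beta>" using s1[of 1] by simp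
  then show "rk d 1 = 8" using beta by (simp add: \<beta>_def)
  have "{q. q < rk d 2 \<and> 5 \<le> a 2 q} = {q. q < rk d 2 \<and> a 2 q = 5}"
  proof -
    have "a 2 q = 5" if q: "q < rk d 2" "5 \<le> a 2 q" for q
    proof -
      have "a 2 q \<noteq> 6" using graded_rank_pos[OF q(1)] n2(2) by metis
      then show ?thesis using up[OF q(1)] q(2) by simp
    qed
    then show ?thesis by auto
  qed
  then show "card {q. q < rk d 2 \<and> 5 \<le> a 2 q} = 1" using n2(1) by (simp add: graded_rank_def)
qed

lemma gorenstein_minimal_resolution:
  assumes g: "gorenstein_ideal c I" and c: "c > 0"
    and r: "graded_free_resolution I d a" and m: "minimal_resolution d"
  shows "gorenstein_graded_resolution I d a c"
proof -
  obtain d' where r': "free_resolution I d'" and len: "\<And>i. i > c \<Longrightarrow> rk d' i = 0"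
    and van: "\<And>i. i < c \<Longrightarrow> ext_cocycles d' i = ext_coboundaries d' i"
    and iso: "ext_iso_quotient I d' c"
    using g unfolding gorenstein_ideal_def by blast
  have res: "free_resolution I d" using r by (simp add: graded_free_resolution_def)
  show ?thesis
  proof
    show "graded_mat (\<lambda>_. 1) (a i) (a (Suc i)) (d i)" for i
      using r by (simp add: graded_free_resolution_def graded_mat_def mdeg_eq_weight)
    show "a 0 0 = 0" using r by (simp add: graded_free_resolution_def)
    show "rk d i = 0" if "c < i" for i by (rule minimal_rank_zero[OF res r' m len[OF that]])
    show "ext_cocycles d i = ext_coboundaries d i" if "i < c" for i
      by (rule ext_vanishing_transfer[OF res r' van[OF that]])
    show "ext_iso_quotient I d c" by (rule ext_iso_transfer[OF res r' iso])
  qed (fact res m c)+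
qed

theorem proposition9p2:
  fixes I :: "'x::finite cpoly set"
    and b :: "nat \<Rightarrow> nat \<Rightarrow> nat"
  assumes "homogeneous_ideal I"
    and "\<forall>p\<in>I. homogeneous 1 p \<longrightarrow> p = 0"
    and "gorenstein_ideal 4 I"
    and "betti_table I b"
    and "has_regularity b 4"
    and "b 1 2 = 3" and "b 2 3 = 1" and "b 3 4 = 0"
  shows "min_number_of_generators I = 8 \<and>
    \<not> (\<exists>J f. gorenstein_ideal 3 J \<and> nonzerodivisor_mod J f \<and>
             I = J <+>\<^bsub>class_ring\<^esub> (PIdl\<^bsub>class_ring\<^esub> f))"
proof -
  obtain d a where r: "graded_free_resolution I d a" and m: "minimal_resolution d"
    and tor: "\<And>i j. b i j = tor_dim d a i j"
    using assms(4) unfolding betti_table_def by blast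
  interpret gorenstein_graded_resolution I d a 4
    by (rule gorenstein_minimal_resolution[OF assms(3) _ r m]) simp
  have b: "b = graded_rank d a" by (intro ext) (simp add: tor tor_dim_minimal[OF res m])
  have cod: "codim I = enat 4" using assms(3) by (simp add: gorenstein_ideal_def)
  have reg: "int j - int i \<le> 4" if "graded_rank d a i j \<noteq> 0" for i j
    using assms(5) that unfolding has_regularity_def b by blast
  have reg': "\<exists>i j. graded_rank d a i j \<noteq> 0 \<and> int j - int i = 4"
    using assms(5) unfolding has_regularity_def b by blast
  note T = type_310[OF refl cod assms(2) reg reg' assms(6-8)[unfolded b]]
  have "min_number_of_generators I = 8"
    using min_number_of_generators_eq[OF res m ideal_I] T(2) by simp
  moreover have False if J: "gorenstein_ideal 3 J" and nzd: "nonzerodivisor_mod J f"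
    and I: "I = J <+>\<^bsub>class_ring\<^esub> (PIdl\<^bsub>class_ring\<^esub> f)" for J f
  proof -
    have idJ: "is_ideal J" using J by (simp add: gorenstein_ideal_def ideal_iff)
    have I': "I = {y + h * f | y h. y \<in> J}"
      unfolding I by (auto simp: set_add_def set_mult_def cgenideal_def)
    have "y + 0 * f \<in> I" if "y \<in> J" for y unfolding I' using that by blast
    then have JI: "J \<subseteq> I" by auto
    have "0 + 1 * f \<in> I" unfolding I' using is_ideal_zero[OF idJ] by blast
    then have fI: "f \<in> I" by simp
    have dec: "\<exists>y\<in>J. \<exists>h. x = y + h * f" if "x \<in> I" for x using that unfolding I' by blast
    have "card {j. j < rk d 1 \<and> a 1 j = 3} \<ge> 3" using T(1) by (simp add: graded_rank_def)
    then obtain S where S: "S \<subseteq> {j. j < rk d 1 \<and> a 1 j = 3}" "card S = 3"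
      by (meson obtain_subset_with_card_n)
    then obtain j1 j2 j3 where j: "S = {j1, j2, j3}" "j1 \<noteq> j2" "j1 \<noteq> j3" "j2 \<noteq> j3"
      by (auto simp: card_3_iff)
    have top: "q = q'" if q: "q < rk d 2" "q' < rk d 2" "2 + 3 \<le> a 2 q" "2 + 3 \<le> a 2 q'" for q q'
    proof -
      obtain q0 where "{q. q < rk d 2 \<and> 5 \<le> a 2 q} = {q0}" using T(4) by (auto simp: card_1_singleton_iff)
      moreover have "q \<in> {q. q < rk d 2 \<and> 5 \<le> a 2 q}" "q' \<in> {q. q < rk d 2 \<and> 5 \<le> a 2 q}"
        using q by auto
      ultimately show ?thesis by auto
    qed
    show False
      by (rule not_hypersurface_section[OF idJ nzd JI fI dec T(3) _ _ _ _ _ _ j(2-4) top])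
         (use S(1) j(1) in auto)
  qed
  ultimately show ?thesis by blast
qed

end
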